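(* For each $\epsilon$ let there be given a Goursat problem, with data $a^\epsilon_{k0}$ on $\mathcal G^\epsilon_k$ ($1\le k\le N$), for a compatible discrete $d$-dimensional hyperbolic system $\delta^{\epsilon_i}_{x_i}a_k=f^\epsilon_{(k,i)}(\vec a)$, $i\in\mathcal E_k$, on $\Omega^\epsilon(\mathbf r)$, where $\epsilon_1=\dots=\epsilon_n=\epsilon$, $\epsilon_{n+1}=\dots=\epsilon_d=1$ and the $f^\epsilon_{(k,i)}$ depend continuously on $\epsilon\in[0,\epsilon_0]$; denote its solution by $\vec a^{\,\epsilon}$. Suppose that $$f^\epsilon_{(k,i)}(\vec a)=f^0_{(k,i)}(\vec a)+\mathcal O(\epsilon)$$ uniformly on any compact subset of $\mathcal X_1\times\dots\times\mathcal X_N$, and that $a^\epsilon_{k0}(\mathbf x)=a^0_{k0}(\mathbf x)+\mathcal O(\epsilon)$ uniformly on $\mathcal G^\epsilon_k$, where $a^0_{k0}$ are functions on $\mathcal G^0_k$. Then there exist $\bar r_i\in(0,r_i]$ for $1\le i\le n$ and Lipschitz-continuous functions $\vec a^{\,0}$ on $\Omega^0(\bar r_1,\dots,\bar r_n,r_{n+1},\dots,r_d)$ such that $$\vec a^{\,\epsilon}=\vec a^{\,0}+\mathcal O(\epsilon)$$ (uniformly on $\Omega^\epsilon(\bar r_1,\dots,\bar r_n,r_{n+1},\dots,r_d)$), and $\vec a^{\,0}$ constitute the unique solution of the limiting Goursat problem $$\partial_{x_i}a_k=f^0_{(k,i)}(\vec a)\ (i\in\mathcal E_k,\ 1\le i\le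 n),\qquad \delta_{x_i}a_k=f^0_{(k,i)}(\vec a)\ (i\in\mathcal E_k,\ n+1\le i\le d),$$ with the Goursat data $a_k=a^0_{k0}$ on $\mathcal G^0_k$ (restricted to this domain). If, in addition, (i) the convergence $f^\epsilon_{(k,i)}\to f^0_{(k,i)}$ is locally uniform in $C^{K+1}$; (ii) the difference quotients of order $\le K+1$ of the discrete Goursat data are bounded independently of $\epsilon$, i.e. $\big|\big(\prod_{i=1}^{p}\delta^\epsilon_{x_{j_i}}\big)a^\epsilon_{k0}\big|\le M$ on $\mathcal G^\epsilon_k$ for $p\le K+1$, where all $j_i$ belong to $\mathcal D_k\cap\{1,\dots,n\}$; and (iii) all limit functions $a^0_{k0}$ belong to $C^K$; then the convergence $\vec a^{\,\epsilon}\to\vec a^{\,0}$ is in the sense of $C^K$, i.e. for $p\le K$ and all $j_i\in\{1,\dots,n\}$, $$\sup\Big|\Big(\prod_{i=1}^p\delta^\epsilon_{x_{j_i}}\Big)a^\epsilon_k(\mathbf x)-\Big(\prod_{i=1}^p\partial_{x_{j_i}}\Big)a^0_k(\mathbf x)\Big|\to0\quad\text{as }\epsilon\to0,$$ the supremum being taken over $\Omega^\epsilon(\bar r_1-K\epsilon,\dots,\bar r_n-K\epsilon,r_{n+1},\dots,r_d)$.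
   Context: $\mathcal X_1,\dots,\mathcal X_N$ are normed vector spaces, $\vec a=(a_1,\dots,a_N)\in\mathcal X_1\times\dots\times\mathcal X_N$. $1\le n\le d$; $r_1,\dots,r_n>0$ are real and $r_{n+1},\dots,r_d$ positive integers. $\epsilon$ takes only values $2^{-j}$, $j$ a positive integer, $\epsilon\le\epsilon_0$; $\mathcal O(\epsilon)$ means bounded in norm by $C\epsilon$, $C$ independent of $\epsilon$. With $[0,r]^{\epsilon}=[0,r]\cap\epsilon\mathbb Z$: $$\Omega^\epsilon(\mathbf r)=\prod_{i=1}^n[0,r_i]^\epsilon\times\prod_{i=n+1}^d\{0,1,\dots,r_i\},\qquad \Omega^0(\mathbf r)=\prod_{i=1}^n[0,r_i]\times\prod_{i=n+1}^d\{0,1,\dots,r_i\}.$$ $\mathbf e_i$ is the $i$-th unit vector; $\delta^{\epsilon_i}_{x_i}p(\mathbf x)=\frac1{\epsilon_i}(p(\mathbf x+\epsilon_i\mathbf e_i)-p(\mathbf x))$, $\delta_{x_i}=\delta^1_{x_i}$; these are considered, and equations are required, wherever defined. For each $1\le k\le N$ a nonempty set $\mathcal E_k\subset\{1,\dots,d\}$ is chosen, $\mathcal D_k=\{1,\dots,d\}\setminus\mathcal E_k$. A discrete $d$-dimensional hyperbolic system is the system $\delta^{\epsilon_i}_{x_i}a_k=f_{(k,i)}(\vec a)$, $1\le k\le N$, $i\in\mathcal E_k$, for $a_k:\Omega^\epsilon(\mathbf r)\to\mathcal X_k$, which is compatible: 1. $f_{(k,i)}$ depends only on those $a_\ell$ with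 $\mathcal E_k\setminus\{i\}\subset\mathcal E_\ell$; 2. for any $k$ and any pair $i\ne j$ in $\mathcal E_k$, identically in $\vec a$, $$\epsilon_if_{(k,i)}(\vec a)+\epsilon_jf_{(k,j)}(\vec a+\epsilon_i\vec f_i(\vec a))=\epsilon_jf_{(k,j)}(\vec a)+\epsilon_if_{(k,i)}(\vec a+\epsilon_j\vec f_j(\vec a)),$$ where $\vec f_i(\vec a)$ has $k$-th component $f_{(k,i)}(\vec a)$ if $i\in\mathcal E_k$ and undefined otherwise (by condition 1 the undefined components do not enter). Its Goursat problem prescribes $a_k=a^\epsilon_{k0}$ on $\mathcal G^\epsilon_k=\{\mathbf x\in\Omega^\epsilon(\mathbf r): x_i=0\text{ for all }i\in\mathcal E_k\}$ and has a unique solution. Likewise $\mathcal G^0_k=\{\mathbf x\in\Omega^0(\mathbf r): x_i=0\text{ for all }i\in\mathcal E_k\}$.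
   Formalization: The formal theorem additionally assumes that the normed spaces X_k are complete, that the limit functions f^0_(k,i) are locally Lipschitz, and that the limiting data a^0_k0 are Lipschitz on G^0_k; without these the statement as given is false. *)

theory Defs
  imports "HOL-Analysis.Analysis"
begin

text \<open>
  The index type \<open>'d\<close> enumerates the \<open>d\<close> lattice directions and \<open>'k\<close> the \<open>N\<close> dependent
  variables. The set \<open>J\<close> plays the role of the directions \<open>1, \<dots>, n\<close> whose mesh size tends to
  zero; in the directions outside \<open>J\<close> the mesh size is always 1. The spaces \<open>X k\<close> may differ
  from each other; they are linear subspaces of one ambient normed space \<open>'v\<close> (any finite
  family of normed spaces embeds in its direct sum), and all conditions are imposed on
  their product only.
\<close>

definition state_space :: "('k::finite \<Rightarrow> 'v::real_normed_vector set) \<Rightarrow> ('v ^ 'k) set" where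
  "state_space X = {a. \<forall>k. a $ k \<in> X k}"

definition scales :: "real \<Rightarrow> real set" where
  "scales \<epsilon>0 = {\<epsilon>. \<epsilon> \<le> \<epsilon>0 \<and> (\<exists>j::nat. 1 \<le> j \<and> \<epsilon> = (1/2) ^ j)}"

definition mesh :: "'d set \<Rightarrow> real \<Rightarrow> 'd \<Rightarrow> real" where
  "mesh J \<epsilon> i = (if i \<in> J then \<epsilon> else 1)"

definition Omega_disc :: "'d::finite set \<Rightarrow> real \<Rightarrow> real ^ 'd \<Rightarrow> (real ^ 'd) set" where
  "Omega_disc J \<epsilon> r =
     {x. \<forall>i. 0 \<le> x $ i \<and> x $ i \<le> r $ i \<and> (\<exists>m::int. x $ i = mesh J \<epsilon> i * of_int m)}"

definition Omega_lim :: "'d::finite set \<Rightarrow> real ^ 'd \<Rightarrow> (real ^ 'd) set" where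
  "Omega_lim J r =
     {x. \<forall>i. 0 \<le> x $ i \<and> x $ i \<le> r $ i \<and> (i \<notin> J \<longrightarrow> x $ i \<in> \<int>)}"

definition goursat_set :: "(real ^ 'd::finite) set \<Rightarrow> 'd set \<Rightarrow> (real ^ 'd) set" where
  "goursat_set \<Omega> Ek = {x \<in> \<Omega>. \<forall>i\<in>Ek. x $ i = 0}"

definition diff_quot ::
  "real \<Rightarrow> 'd::finite \<Rightarrow> (real ^ 'd \<Rightarrow> 'v::real_vector) \<Rightarrow> real ^ 'd \<Rightarrow> 'v" where
  "diff_quot h i u x = (u (x + h *\<^sub>R axis i 1) - u x) /\<^sub>R h"

fun iter_diff_quot ::
  "real \<Rightarrow> 'd::finite list \<Rightarrow> (real ^ 'd \<Rightarrow> 'v::real_vector) \<Rightarrow> real ^ 'd \<Rightarrow> 'v" where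
  "iter_diff_quot h [] u = u"
| "iter_diff_quot h (j # js) u = diff_quot h j (iter_diff_quot h js u)"

text \<open>On boxes, an iterated difference quotient is defined at \<open>x\<close> iff \<open>x\<close> and
  \<open>shift h js x\<close> both belong to the grid.\<close>

definition shift :: "real \<Rightarrow> 'd::finite list \<Rightarrow> real ^ 'd \<Rightarrow> real ^ 'd" where
  "shift h js x = x + (\<Sum>j\<leftarrow>js. h *\<^sub>R axis j 1)"

text \<open>The vector field of direction \<open>i\<close>. Components \<open>k\<close> with \<open>i \<notin> E k\<close> are undefined in the
  mathematics and never enter a compatible system; they are set to 0.\<close>

definition dir_field ::
  "('k::finite \<Rightarrow> 'd set) \<Rightarrow> ('k \<Rightarrow> 'd \<Rightarrow> 'v ^ 'k \<Rightarrow> 'v) \<Rightarrow> 'd \<Rightarrow> 'v ^ 'k \<Rightarrow> 'v::real_normed_vector ^ 'k" where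
  "dir_field E f i a = (\<chi> k. if i \<in> E k then f k i a else 0)"

definition compatible ::
  "('k::finite \<Rightarrow> 'v::real_normed_vector set) \<Rightarrow> ('k \<Rightarrow> 'd set) \<Rightarrow> ('d \<Rightarrow> real)
    \<Rightarrow> ('k \<Rightarrow> 'd \<Rightarrow> 'v ^ 'k \<Rightarrow> 'v) \<Rightarrow> bool" where
  "compatible X E h f \<longleftrightarrow>
     (\<forall>k. \<forall>i\<in>E k. \<forall>a\<in>state_space X. \<forall>b\<in>state_space X.
        (\<forall>l. E k - {i} \<subseteq> E l \<longrightarrow> a $ l = b $ l) \<longrightarrow> f k i a = f k i b) \<and>
     (\<forall>k. \<forall>i\<in>E k. \<forall>j\<in>E k. i \<noteq> j \<longrightarrow> (\<forall>a\<in>state_space X.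
        h i *\<^sub>R f k i a + h j *\<^sub>R f k j (a + h i *\<^sub>R dir_field E f i a) =
        h j *\<^sub>R f k j a + h i *\<^sub>R f k i (a + h j *\<^sub>R dir_field E f j a)))"

definition discrete_goursat_solution ::
  "('k::finite \<Rightarrow> 'v::real_normed_vector set) \<Rightarrow> ('k \<Rightarrow> 'd::finite set) \<Rightarrow> 'd set \<Rightarrow> real \<Rightarrow> real ^ 'd
    \<Rightarrow> ('k \<Rightarrow> 'd \<Rightarrow> 'v ^ 'k \<Rightarrow> 'v) \<Rightarrow> ('k \<Rightarrow> real ^ 'd \<Rightarrow> 'v) \<Rightarrow> (real ^ 'd \<Rightarrow> 'v ^ 'k) \<Rightarrow> bool" where
  "discrete_goursat_solution X E J \<epsilon> r f g a \<longleftrightarrow>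
     a ` Omega_disc J \<epsilon> r \<subseteq> state_space X \<and>
     (\<forall>k. \<forall>i\<in>E k. \<forall>x\<in>Omega_disc J \<epsilon> r. x + mesh J \<epsilon> i *\<^sub>R axis i 1 \<in> Omega_disc J \<epsilon> r \<longrightarrow>
        diff_quot (mesh J \<epsilon> i) i (\<lambda>y. a y $ k) x = f k i (a x)) \<and>
     (\<forall>k. \<forall>x\<in>goursat_set (Omega_disc J \<epsilon> r) (E k). a x $ k = g k x)"

text \<open>Partial derivatives are taken along the domain, hence one-sided at the boundary of a box.\<close>

definition line_filter :: "(real ^ 'd::finite) set \<Rightarrow> 'd \<Rightarrow> real ^ 'd \<Rightarrow> real filter" where
  "line_filter S i x = at 0 within {t. x + t *\<^sub>R axis i 1 \<in> S}"

definition limit_goursat_solution ::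
  "('k::finite \<Rightarrow> 'v::real_normed_vector set) \<Rightarrow> ('k \<Rightarrow> 'd::finite set) \<Rightarrow> 'd set \<Rightarrow> real ^ 'd
    \<Rightarrow> ('k \<Rightarrow> 'd \<Rightarrow> 'v ^ 'k \<Rightarrow> 'v) \<Rightarrow> ('k \<Rightarrow> real ^ 'd \<Rightarrow> 'v) \<Rightarrow> (real ^ 'd \<Rightarrow> 'v ^ 'k) \<Rightarrow> bool" where
  "limit_goursat_solution X E J r f g a \<longleftrightarrow>
     a ` Omega_lim J r \<subseteq> state_space X \<and>
     continuous_on (Omega_lim J r) a \<and>
     (\<forall>k. \<forall>i\<in>E k \<inter> J. \<forall>x\<in>Omega_lim J r.
        ((\<lambda>t. a (x + t *\<^sub>R axis i 1) $ k) has_vector_derivative f k i (a x))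
          (line_filter (Omega_lim J r) i x)) \<and>
     (\<forall>k. \<forall>i\<in>E k - J. \<forall>x\<in>Omega_lim J r. x + axis i 1 \<in> Omega_lim J r \<longrightarrow>
        diff_quot 1 i (\<lambda>y. a y $ k) x = f k i (a x)) \<and>
     (\<forall>k. \<forall>x\<in>goursat_set (Omega_lim J r) (E k). a x $ k = g k x)"

definition partial_on ::
  "(real ^ 'd::finite) set \<Rightarrow> 'd \<Rightarrow> (real ^ 'd \<Rightarrow> 'v::real_normed_vector) \<Rightarrow> real ^ 'd \<Rightarrow> 'v" where
  "partial_on S i u x = vector_derivative (\<lambda>t. u (x + t *\<^sub>R axis i 1)) (line_filter S i x)"

fun iter_partial_on ::
  "(real ^ 'd::finite) set \<Rightarrow> 'd list \<Rightarrow> (real ^ 'd \<Rightarrow> 'v::real_normed_vector) \<Rightarrow> real ^ 'd \<Rightarrow> 'v" where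
  "iter_partial_on S [] u = u"
| "iter_partial_on S (j # js) u = partial_on S j (iter_partial_on S js u)"

text \<open>\<open>C\<^sup>K\<close> on a box in the continuous directions \<open>I\<close> along which the box extends.\<close>

definition CK_on ::
  "nat \<Rightarrow> 'd::finite set \<Rightarrow> (real ^ 'd) set \<Rightarrow> (real ^ 'd \<Rightarrow> 'v::real_normed_vector) \<Rightarrow> bool" where
  "CK_on K I S u \<longleftrightarrow>
     (\<forall>js. set js \<subseteq> I \<and> length js \<le> K \<longrightarrow> continuous_on S (iter_partial_on S js u)) \<and>
     (\<forall>js. \<forall>i\<in>I. set js \<subseteq> I \<and> length js < K \<longrightarrow>
        (\<forall>x\<in>S. (\<lambda>t. iter_partial_on S js u (x + t *\<^sub>R axis i 1)) differentiable (line_filter S i x)))"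

text \<open>Frechet derivatives of all orders up to \<open>m\<close> of a function on a linear subspace \<open>P\<close>:
  \<open>D a [h\<^sub>1, \<dots>, h\<^sub>j]\<close> is the \<open>j\<close>-th derivative at \<open>a\<close> evaluated at \<open>h\<^sub>1, \<dots>, h\<^sub>j \<in> P\<close>.
  Lists are used because the order is a variable; the list of directions in the unit ball
  expresses the operator norm. The library's \<open>has_derivative\<close> is not used because it would
  demand bounded linear maps on the whole ambient space instead of on \<open>P\<close>.\<close>

definition unit_lists :: "'a::real_normed_vector set \<Rightarrow> nat \<Rightarrow> 'a list set" where
  "unit_lists P j = {hs. length hs = j \<and> set hs \<subseteq> P \<inter> cball 0 1}"

definition bounded_multilinear_on ::
  "'a::real_normed_vector set \<Rightarrow> nat \<Rightarrow> ('a list \<Rightarrow> 'b::real_normed_vector) \<Rightarrow> bool" where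
  "bounded_multilinear_on P j T \<longleftrightarrow>
     (\<forall>us vs. \<forall>h\<in>P. \<forall>h'\<in>P. \<forall>c. length us + length vs + 1 = j \<and> set us \<subseteq> P \<and> set vs \<subseteq> P \<longrightarrow>
        T (us @ (h + h') # vs) = T (us @ h # vs) + T (us @ h' # vs) \<and>
        T (us @ (c *\<^sub>R h) # vs) = c *\<^sub>R T (us @ h # vs)) \<and>
     (\<exists>B. \<forall>hs\<in>unit_lists P j. norm (T hs) \<le> B)"

definition Cm_derivatives ::
  "'a::real_normed_vector set \<Rightarrow> nat \<Rightarrow> ('a \<Rightarrow> 'b::real_normed_vector) \<Rightarrow> ('a \<Rightarrow> 'a list \<Rightarrow> 'b) \<Rightarrow> bool" where
  "Cm_derivatives P m f D \<longleftrightarrow>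
     (\<forall>a\<in>P. D a [] = f a) \<and>
     (\<forall>a\<in>P. \<forall>j\<le>m. bounded_multilinear_on P j (D a)) \<and>
     (\<forall>a\<in>P. \<forall>j<m. \<forall>e>0. \<exists>\<delta>>0. \<forall>b\<in>P. dist b a < \<delta> \<longrightarrow>
        (\<forall>hs\<in>unit_lists P j. norm (D b hs - D a hs - D a ((b - a) # hs)) \<le> e * norm (b - a))) \<and>
     (\<forall>a\<in>P. \<forall>j\<le>m. \<forall>e>0. \<exists>\<delta>>0. \<forall>b\<in>P. dist b a < \<delta> \<longrightarrow>
        (\<forall>hs\<in>unit_lists P j. norm (D b hs - D a hs) \<le> e))"

text \<open>\<open>F \<epsilon> \<rightarrow> F 0\<close> in \<open>C\<^sup>m\<close>, uniformly on compact subsets of \<open>P\<close>, as \<open>\<epsilon> \<rightarrow> 0\<close> within \<open>A\<close>.\<close>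

definition Cm_loc_convergent ::
  "real set \<Rightarrow> 'a::real_normed_vector set \<Rightarrow> nat \<Rightarrow> (real \<Rightarrow> 'a \<Rightarrow> 'b::real_normed_vector) \<Rightarrow> bool" where
  "Cm_loc_convergent A P m F \<longleftrightarrow>
     (\<exists>D. (\<forall>\<epsilon>\<in>insert 0 A. Cm_derivatives P m (F \<epsilon>) (D \<epsilon>)) \<and>
       (\<forall>Q. compact Q \<and> Q \<subseteq> P \<longrightarrow> (\<forall>j\<le>m. \<forall>e>0. \<exists>\<eta>>0. \<forall>\<epsilon>\<in>A. \<epsilon> < \<eta> \<longrightarrow>
          (\<forall>a\<in>Q. \<forall>hs\<in>unit_lists P j. norm (D \<epsilon> a hs - D 0 a hs) \<le> e))))"

definition shrink :: "'d::finite set \<Rightarrow> real \<Rightarrow> real ^ 'd \<Rightarrow> real ^ 'd" where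
  "shrink J h r = (\<chi> i. if i \<in> J then r $ i - h else r $ i)"

end

theory Submission
  imports Defs
begin

text \<open>
  The limit is constructed from the discrete solutions themselves. Close to the finitely many
  points whose coordinates in the directions \<open>J\<close> vanish, the discrete solutions stay in neighbourhoods in which the fields
  \<open>f 0\<close> are Lipschitz and approximated with error \<open>O(\<epsilon>)\<close>: convergence on compact sets implies
  convergence near every point. A discrete Gronwall inequality, with the weight
  \<open>exp (\<lambda> (x\<^sub>1 + \<dots> + x\<^sub>d))\<close> treating small and unit steps alike, then bounds the first
  difference quotients in all directions of \<open>J\<close>, and with their help the difference between the
  solutions for \<open>\<epsilon>\<close> and \<open>\<epsilon>/2\<close> by \<open>O(\<epsilon>)\<close>; these differences sum up to a Lipschitz limit.

  For the second part, the difference quotients of order up to \<open>K + 1\<close> are bounded by induction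
  on the order. In a direction of \<open>E k\<close> the equation lowers the order; otherwise the top order
  quotient satisfies an affine Gronwall inequality, by a chain rule for difference quotients.
  Bounded quotients of order \<open>K + 1\<close> and uniform convergence of the function values yield uniform
  convergence of all quotients of order up to \<open>K\<close> by Taylor's formula, so that no equation for the
  derivatives of the limit has to be considered.
\<close>

section \<open>Discrete Gronwall inequality and uniformity near compact sets\<close>

text \<open>Two estimates depend on each other. The fields are controlled only while the discrete
  values stay near the reference states, and the values stay near only while their steps are at most
  \<open>\<Lambda> * \<epsilon>\<close>. The circle is broken by induction over the coordinate sum:
  each step is estimated from strictly earlier points. It closes because \<Lambda> is computed from
  the whole box \<open>r\<close>, so that the side \<open>2 * \<rho>\<close> of the region can be
  chosen after \<Lambda>. In infinite dimension a compact set contains no ball, so rates on compact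
  sets do not directly control the fields where the solutions run; for this reason neighbourhoods
  are obtained by contradiction from convergent sequences. For \<epsilon> > 0 the fields are only
  Lipschitz up to an error of order \<epsilon>. This error is the inhomogeneous term in the Gronwall
  estimates for steps and refinements, and its order is the order of convergence. The final box has
  side \<rho>, half of the controlled side. Forward quotients of any order and Taylor increments
  then find room beyond it once \<epsilon> is small, so one box serves every
  \<open>K\<close>.\<close>

lemma finite_measure_induct:
  fixes m :: "'a \<Rightarrow> real"
  assumes "finite S"
    and step: "\<And>x. x \<in> S \<Longrightarrow> (\<And>y. y \<in> S \<Longrightarrow> m y < m x \<Longrightarrow> P y) \<Longrightarrow> P x"
    and "x \<in> S"
  shows "P x"
  using \<open>x \<in> S\<close>
proof (induction "card {y \<in> S. m y < m x}" arbitrary: x rule: less_induct)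
  case less
  show ?case
  proof (rule step[OF less.prems])
    fix y assume y: "y \<in> S" "m y < m x"
    have "{z \<in> S. m z < m y} \<subset> {z \<in> S. m z < m x}"
      using y by auto
    then have "card {z \<in> S. m z < m y} < card {z \<in> S. m z < m x}"
      using \<open>finite S\<close> by (intro psubset_card_mono) auto
    then show "P y"
      using less.hyps y by blast
  qed
qed

text \<open>The factor \<open>exp ((L + 1) * h)\<close> dominates \<open>1 + (L + 1) * h\<close> for
  every \<open>h > 0\<close>, so the steps may have any size. The \<open>+ 1\<close> absorbs
  \<beta>, which never exceeds the claimed bound. One predecessor \<open>w\<close> for each
  component and point suffices, since \<open>B\<close> bounds all components at
  \<open>w\<close>.\<close>

lemma discrete_gronwall:
  fixes u :: "'k \<Rightarrow> 'a \<Rightarrow> real" and m :: "'a \<Rightarrow> real"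
  assumes "finite S" "0 \<le> \<alpha>" "0 \<le> \<beta>" "0 \<le> L" and m_nonneg: "\<And>x. x \<in> S \<Longrightarrow> 0 \<le> m x"
    and step: "\<And>k x. x \<in> S \<Longrightarrow> u k x \<le> \<alpha> \<or>
      (\<exists>h>0. \<exists>w\<in>S. m w = m x - h \<and>
        (\<forall>B\<ge>0. (\<forall>l. u l w \<le> B) \<longrightarrow> u k x \<le> B + h * (L * B + \<beta>)))"
    and "x \<in> S"
  shows "u k x \<le> (\<alpha> + \<beta>) * exp ((L + 1) * m x)"
proof -
  have "\<forall>k. u k x \<le> (\<alpha> + \<beta>) * exp ((L + 1) * m x)"
  proof (rule finite_measure_induct[where m = m, OF \<open>finite S\<close> _ \<open>x \<in> S\<close>], rule allI)
    fix x k
    assume x: "x \<in> S" and IH: "\<And>y. y \<in> S \<Longrightarrow> m y < m x \<Longrightarrow>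
      \<forall>k. u k y \<le> (\<alpha> + \<beta>) * exp ((L + 1) * m y)"
    from step[OF x, of k] show "u k x \<le> (\<alpha> + \<beta>) * exp ((L + 1) * m x)"
    proof
      assume "u k x \<le> \<alpha>"
      also have "\<alpha> \<le> (\<alpha> + \<beta>) * 1"
        using assms by simp
      also have "\<dots> \<le> (\<alpha> + \<beta>) * exp ((L + 1) * m x)"
        using assms m_nonneg[OF x] by (intro mult_left_mono) auto
      finally show ?thesis .
    next
      assume "\<exists>h>0. \<exists>w\<in>S. m w = m x - h \<and>
        (\<forall>B\<ge>0. (\<forall>l. u l w \<le> B) \<longrightarrow> u k x \<le> B + h * (L * B + \<beta>))"
      then obtain h w where h: "h > 0" and w: "w \<in> S" "m w = m x - h"
        and rec: "\<And>B. B \<ge> 0 \<Longrightarrow> (\<forall>l. u l w \<le> B) \<Longrightarrow> u k x \<le> B + h * (L * B + \<beta>)"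
        by blast
      define B where "B = (\<alpha> + \<beta>) * exp ((L + 1) * m w)"
      have "\<beta> \<le> (\<alpha> + \<beta>) * 1"
        using assms by simp
      also have "\<dots> \<le> B"
        unfolding B_def using assms m_nonneg[OF w(1)] by (intro mult_left_mono) auto
      finally have \<beta>: "\<beta> \<le> B" .
      have B0: "0 \<le> B" using \<beta> \<open>0 \<le> \<beta>\<close> by linarith
      have "u k x \<le> B + h * (L * B + \<beta>)"
        by (rule rec) (use B0 IH[OF w(1)] w(2) h in \<open>auto simp: B_def\<close>)
      also have "\<dots> \<le> B + h * (L * B + B)"
        using h \<beta> by (simp add: mult_left_mono)
      also have "\<dots> = B * (1 + (L + 1) * h)"
        by (simp add: algebra_simps)
      also have "\<dots> \<le> B * exp ((L + 1) * h)"
        using B0 by (intro mult_left_mono exp_ge_add_one_self) auto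
      also have "\<dots> = (\<alpha> + \<beta>) * exp ((L + 1) * m x)"
      proof -
        have "m x = m w + h" using w(2) by simp
        then show ?thesis by (simp add: B_def exp_add distrib_left)
      qed
      finally show ?thesis .
    qed
  qed
  then show ?thesis by blast
qed

text \<open>Minimum of the radii, maximum of the constants. Radius and constant travel together;
  where only one of them matters, the other is a dummy.\<close>

lemma finite_uniform_constants:
  fixes \<Phi> :: "'a \<Rightarrow> real \<Rightarrow> real \<Rightarrow> bool"
  assumes "finite S" and ex: "\<And>z. z \<in> S \<Longrightarrow> \<exists>\<delta>>0. \<exists>L. \<Phi> z \<delta> L"
    and mono: "\<And>z \<delta> L \<delta>' L'. z \<in> S \<Longrightarrow> \<Phi> z \<delta> L \<Longrightarrow> 0 < \<delta>' \<Longrightarrow> \<delta>' \<le> \<delta> \<Longrightarrow> L \<le> L' \<Longrightarrow> \<Phi> z \<delta>' L'"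
  shows "\<exists>\<delta>>0. \<exists>L\<ge>0. \<forall>z\<in>S. \<Phi> z \<delta> L"
  using assms
proof (induction S rule: finite_induct)
  case empty
  then show ?case by (auto intro: exI[of _ 1])
next
  case (insert z S)
  note ex = insert.prems(1) and mono = insert.prems(2)
  have "\<exists>\<delta>>0. \<exists>L\<ge>0. \<forall>z\<in>S. \<Phi> z \<delta> L"
  proof (rule insert.IH)
    show "\<exists>\<delta>>0. \<exists>L. \<Phi> y \<delta> L" if "y \<in> S" for y
      by (rule ex) (use that in simp)
    show "\<Phi> y \<delta>' L'" if "y \<in> S" "\<Phi> y \<delta> L" "0 < \<delta>'" "\<delta>' \<le> \<delta>" "L \<le> L'" for y \<delta> L \<delta>' L'
      by (rule mono[OF _ that(2-5)]) (use that in simp)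
  qed
  then obtain \<delta> L where 1: "\<delta> > 0" "L \<ge> 0" "\<forall>z\<in>S. \<Phi> z \<delta> L"
    by (elim exE conjE)
  obtain \<delta>' L' where 2: "\<delta>' > 0" "\<Phi> z \<delta>' L'"
    using ex[OF insertI1] by (elim exE conjE)
  have pos: "min \<delta> \<delta>' > 0" "max L L' \<ge> 0"
    using 1 2 by auto
  have "\<Phi> y (min \<delta> \<delta>') (max L L')" if "y \<in> insert z S" for y
  proof (cases "y = z")
    case True
    show ?thesis
      unfolding True by (rule mono[OF insertI1 2(2) pos(1)]) auto
  next
    case False
    with that have "y \<in> S" by simp
    show ?thesis
      by (rule mono[OF that bspec[OF 1(3) \<open>y \<in> S\<close>] pos(1)]) auto
  qed
  with pos show ?case by (intro exI[of _ "min \<delta> \<delta>'"] conjI exI[of _ "max L L'"] ballI)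
qed

text \<open>An open set around \<open>l\<close> contains all but finitely many terms. These sets are
  the compact sets on which the convergence hypotheses are tested.\<close>

lemma compact_insert_limit:
  fixes s :: "nat \<Rightarrow> 'a::topological_space"
  assumes "s \<longlonglongrightarrow> l"
  shows "compact (insert l (range s))"
proof (rule compactI)
  fix C assume C: "\<forall>t\<in>C. open t" "insert l (range s) \<subseteq> \<Union>C"
  then obtain U where U: "U \<in> C" "l \<in> U" by blast
  then obtain N where N: "\<And>n. n \<ge> N \<Longrightarrow> s n \<in> U"
    using C(1) topological_tendstoD[OF assms] unfolding eventually_sequentially by blast
  obtain h where h: "\<And>n. h n \<in> C" "\<And>n. s n \<in> h n"
  proof -
    have "\<exists>t\<in>C. s n \<in> t" for n
      using C(2) by auto
    then show ?thesis using that by metis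
  qed
  have "insert l (range s) \<subseteq> \<Union>(insert U (h ` {..<N}))"
  proof (intro subsetI)
    fix x assume "x \<in> insert l (range s)"
    then consider "x = l" | n where "x = s n" "n < N" | n where "x = s n" "N \<le> n"
      by (metis insertE rangeE not_le)
    then show "x \<in> \<Union>(insert U (h ` {..<N}))"
      using N U(2) h(2) by cases auto
  qed
  then show "\<exists>C'\<subseteq>C. finite C' \<and> insert l (range s) \<subseteq> \<Union>C'"
    using h(1) U(1) by (intro exI[of _ "insert U (h ` {..<N})"]) auto
qed

text \<open>\<open>R n b\<close> reads as the failure at \<open>b\<close> of a bound of size
  \<open>n\<close>. If failures of every size came arbitrarily close to \<open>Q\<close>, a
  subsequence of them would converge to a point of \<open>Q\<close>, where the local hypothesis
  excludes them.\<close>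

lemma uniform_near_compact_of_local:
  fixes P Q :: "'a::metric_space set" and R :: "nat \<Rightarrow> 'a \<Rightarrow> bool"
  assumes local: "\<And>q. q \<in> Q \<Longrightarrow> \<exists>\<delta>>0. \<exists>n. \<forall>b\<in>P. dist b q < \<delta> \<longrightarrow> \<not> R n b"
    and mono: "\<And>m n b. R n b \<Longrightarrow> m \<le> n \<Longrightarrow> R m b"
    and Q: "compact Q"
  shows "\<exists>\<delta>>0. \<exists>n. \<forall>q\<in>Q. \<forall>b\<in>P. dist b q < \<delta> \<longrightarrow> \<not> R n b"
proof (rule ccontr)
  assume "\<not> ?thesis"
  then have *: "\<forall>\<delta>>0. \<forall>n. \<exists>q\<in>Q. \<exists>b\<in>P. dist b q < \<delta> \<and> R n b"
    by blast
  have "\<exists>q b. q \<in> Q \<and> b \<in> P \<and> dist b q < 1 / Suc n \<and> R n b" for n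
    using *[rule_format, of "1 / Suc n" n] by auto
  then obtain q b where qb: "\<And>n. q n \<in> Q" "\<And>n. b n \<in> P" "\<And>n. dist (b n) (q n) < 1 / Suc n"
    "\<And>n. R n (b n)"
    by metis
  obtain l s where l: "l \<in> Q" "strict_mono s" "(q \<circ> s) \<longlonglongrightarrow> l"
    using Q qb(1) unfolding compact_eq_seq_compact_metric seq_compact_def by blast
  have "(\<lambda>n. 1 / real (Suc n)) \<longlonglongrightarrow> 0"
    by (rule LIMSEQ_Suc) (rule lim_1_over_n)
  then have "(\<lambda>n. dist (b n) (q n)) \<longlonglongrightarrow> 0"
    by (rule Lim_null_comparison[rotated]) (use qb(3) in \<open>auto intro!: always_eventually less_imp_le\<close>)
  then have "(\<lambda>n. dist (b (s n)) (q (s n))) \<longlonglongrightarrow> 0"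
    using LIMSEQ_subseq_LIMSEQ[OF _ l(2)] by (force simp: o_def)
  moreover have "(\<lambda>n. dist (q (s n)) l) \<longlonglongrightarrow> 0"
    using l(3) unfolding o_def by (subst (asm) tendsto_dist_iff)
  ultimately have "(\<lambda>n. dist (b (s n)) (q (s n)) + dist (q (s n)) l) \<longlonglongrightarrow> 0"
    by (rule tendsto_add_zero)
  then have lim: "(\<lambda>n. dist (b (s n)) l) \<longlonglongrightarrow> 0"
    by (rule tendsto_0_le[where K = 1]) (auto intro!: always_eventually dist_triangle)
  obtain \<delta> n where \<delta>: "\<delta> > 0" "\<forall>b\<in>P. dist b l < \<delta> \<longrightarrow> \<not> R n b"
    using local[OF l(1)] by (elim exE conjE)
  obtain m where "\<And>i. i \<ge> m \<Longrightarrow> dist (b (s i)) l < \<delta>"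
    using order_tendstoD(2)[OF lim \<delta>(1)] unfolding eventually_sequentially by (elim exE) auto
  then have "\<not> R n (b (s (max m n)))"
    using \<delta>(2) qb(2) by simp
  moreover have "n \<le> s (max m n)"
    using seq_suble[OF l(2), of "max m n"] by simp
  ultimately show False
    using mono[OF qb(4)] by simp
qed

text \<open>If a property eventually fails on every compact set, then it eventually fails on a whole
  neighbourhood of every compact set: a sequence of counterexamples converging to a point
  forms a compact set together with its limit.\<close>

lemma uniform_near_compact:
  fixes P Q :: "'a::metric_space set" and R :: "nat \<Rightarrow> 'a \<Rightarrow> bool"
  assumes ex: "\<And>Q. compact Q \<Longrightarrow> Q \<subseteq> P \<Longrightarrow> \<exists>n. \<forall>b\<in>Q. \<not> R n b"
    and mono: "\<And>m n b. R n b \<Longrightarrow> m \<le> n \<Longrightarrow> R m b"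
    and Q: "compact Q" "Q \<subseteq> P"
  shows "\<exists>\<delta>>0. \<exists>n. \<forall>q\<in>Q. \<forall>b\<in>P. dist b q < \<delta> \<longrightarrow> \<not> R n b"
proof (rule uniform_near_compact_of_local[OF _ mono Q(1)])
  fix q assume "q \<in> Q"
  show "\<exists>\<delta>>0. \<exists>n. \<forall>b\<in>P. dist b q < \<delta> \<longrightarrow> \<not> R n b"
  proof (rule ccontr)
    assume "\<not> ?thesis"
    then have *: "\<forall>\<delta>>0. \<forall>n. \<exists>b\<in>P. dist b q < \<delta> \<and> R n b"
      by blast
    have "\<exists>b. b \<in> P \<and> dist b q < 1 / Suc n \<and> R n b" for n
      using *[rule_format, of "1 / Suc n" n] by auto
    then obtain b where b: "\<And>n. b n \<in> P" "\<And>n. dist (b n) q < 1 / Suc n" "\<And>n. R n (b n)"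
      by metis
    have "(\<lambda>n. 1 / real (Suc n)) \<longlonglongrightarrow> 0"
      by (rule LIMSEQ_Suc) (rule lim_1_over_n)
    then have "(\<lambda>n. dist (b n) q) \<longlonglongrightarrow> 0"
      by (rule Lim_null_comparison[rotated]) (use b(2) in \<open>auto intro!: always_eventually less_imp_le\<close>)
    then have "b \<longlonglongrightarrow> q"
      by (subst tendsto_dist_iff)
    then have "compact (insert q (range b))"
      by (rule compact_insert_limit)
    moreover have "insert q (range b) \<subseteq> P"
      using b(1) subsetD[OF Q(2) \<open>q \<in> Q\<close>] by auto
    ultimately have "\<exists>n. \<forall>b\<in>insert q (range b). \<not> R n b"
      by (rule ex)
    then obtain n where n: "\<forall>b\<in>insert q (range b). \<not> R n b"
      by (elim exE)
    with b(3)[of n] show False by simp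
  qed
qed

text \<open>Halving increments sum to twice the first one. This turns an estimate between
  consecutive scales into a rate for the limit, with the limit taken in \<open>S\<close>.\<close>

lemma geometric_Cauchy_limit:
  fixes s :: "nat \<Rightarrow> 'a::metric_space"
  assumes "complete S" "\<And>n. n \<ge> n0 \<Longrightarrow> s n \<in> S"
    and d: "\<And>n. n \<ge> n0 \<Longrightarrow> dist (s (Suc n)) (s n) \<le> C * (1/2)^n"
  shows "\<exists>l\<in>S. s \<longlonglongrightarrow> l \<and> (\<forall>n\<ge>n0. dist (s n) l \<le> 2 * C * (1/2)^n)"
proof -
  have C: "0 \<le> C"
  proof -
    have "0 \<le> C * (1/2)^n0"
      using order_trans[OF zero_le_dist d[of n0]] by simp
    moreover have "(0::real) < (1/2)^n0" by simp
    ultimately show ?thesis by (meson zero_le_mult_iff not_less)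
  qed
  \<comment> \<open>The subtracted term is the tail of the geometric series; with it the induction
    on \<open>m\<close> closes exactly.\<close>
  have dist_le: "dist (s (n + m)) (s n) \<le> 2 * C * (1/2)^n - 2 * C * (1/2)^(n+m)" if "n \<ge> n0" for n m
  proof (induction m)
    case (Suc m)
    have "dist (s (n + Suc m)) (s n) \<le> dist (s (Suc (n + m))) (s (n + m)) + dist (s (n + m)) (s n)"
      by (simp add: dist_triangle)
    also have "\<dots> \<le> C * (1/2)^(n+m) + (2 * C * (1/2)^n - 2 * C * (1/2)^(n+m))"
      using d[of "n + m"] Suc that by (intro add_mono) auto
    finally show ?case by simp
  qed simp
  have le: "dist (s (n + m)) (s n) \<le> 2 * C * (1/2)^n" if "n \<ge> n0" for n m
    using dist_le[OF that, of m] C by (smt (verit) mult_nonneg_nonneg zero_le_power divide_nonneg_nonneg)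
  have lim0: "(\<lambda>n. 2 * C * (1/2)^n) \<longlonglongrightarrow> 0"
    by (intro tendsto_mult_right_zero LIMSEQ_realpow_zero) auto
  have "Cauchy (\<lambda>n. s (n + n0))"
  proof (rule metric_CauchyI)
    fix e :: real assume "e > 0"
    then obtain N where N: "2 * C * (1/2)^N < e / 2"
      using order_tendstoD(2)[OF lim0, of "e / 2"] by (auto simp: eventually_sequentially)
    have "dist (s (m + n0)) (s (N + n0)) < e / 2" if "m \<ge> N" for m
    proof -
      have "dist (s (m + n0)) (s (N + n0)) \<le> 2 * C * (1/2)^(N + n0)"
        using le[of "N + n0" "m - N"] that by (simp add: add.commute)
      also have "\<dots> \<le> 2 * C * (1/2)^N"
        using C by (intro mult_left_mono power_decreasing) auto
      finally show ?thesis using N by simp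
    qed
    then show "\<exists>M. \<forall>m\<ge>M. \<forall>n\<ge>M. dist (s (m + n0)) (s (n + n0)) < e"
      by (meson dist_triangle_half_l dist_commute_lessI)
  qed
  moreover have "\<forall>n. s (n + n0) \<in> S" using assms by auto
  ultimately obtain l where l: "l \<in> S" "(\<lambda>n. s (n + n0)) \<longlonglongrightarrow> l"
    using \<open>complete S\<close> unfolding complete_def by (metis (no_types, lifting))
  then have lim: "s \<longlonglongrightarrow> l"
    by (simp add: LIMSEQ_offset)
  have "dist (s n) l \<le> 2 * C * (1/2)^n" if "n \<ge> n0" for n
  proof (rule LIMSEQ_le_const2)
    show "(\<lambda>m. dist (s n) (s (n + m))) \<longlonglongrightarrow> dist (s n) l"
      using LIMSEQ_ignore_initial_segment[OF lim, of n] by (intro tendsto_intros) (simp add: add.commute)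
    show "\<exists>N. \<forall>m\<ge>N. dist (s n) (s (n + m)) \<le> 2 * C * (1/2)^n"
      using le[OF that] by (auto simp: dist_commute)
  qed
  with l lim show ?thesis by blast
qed

section \<open>A chain rule for iterated difference quotients\<close>

lemma diff_quot_commute:
  "diff_quot h i (diff_quot h j u) = diff_quot h j (diff_quot h i u)"
  by (auto simp: diff_quot_def fun_eq_iff algebra_simps)

text \<open>Difference quotients commute, so the head of the list may be applied first. In this form
  an induction on \<open>js\<close> replaces the function by its quotient and keeps the
  point.\<close>

lemma iter_diff_quot_Cons': "iter_diff_quot h (i # js) u = iter_diff_quot h js (diff_quot h i u)"
  by (induction js) (simp_all add: diff_quot_commute)

lemma iter_diff_quot_append:
  "iter_diff_quot h (is @ js) u = iter_diff_quot h is (iter_diff_quot h js u)"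
  by (induction "is") auto

text \<open>Moves a chosen direction innermost, where the equation of the system can replace the
  quotient by a field.\<close>

lemma iter_diff_quot_remove1:
  "j \<in> set js \<Longrightarrow> iter_diff_quot h js u = iter_diff_quot h (remove1 j js) (diff_quot h j u)"
proof (induction js)
  case (Cons i js)
  then show ?case
    by (cases "i = j") (auto simp: iter_diff_quot_Cons' simp del: iter_diff_quot.simps(2),
        simp add: diff_quot_commute iter_diff_quot_Cons'[symmetric])
qed simp

text \<open>The vertices at which \<open>iter_diff_quot h js u y\<close> evaluates \<open>u\<close>.
  Solutions satisfy their equations on the grid only, so every rewriting under an iterated quotient
  has to be justified on these points.\<close>

fun diff_box :: "real \<Rightarrow> 'd::finite list \<Rightarrow> real ^ 'd \<Rightarrow> (real ^ 'd) set" where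
  "diff_box h [] y = {y}"
| "diff_box h (i # js) y = diff_box h js y \<union> diff_box h js (y + h *\<^sub>R axis i 1)"

lemma self_in_diff_box: "y \<in> diff_box h js y"
  by (induction js) auto

lemma diff_box_translate: "z \<in> diff_box h js y \<Longrightarrow> z + v \<in> diff_box h js (y + v)"
  by (induction js arbitrary: y) (auto, metis add.assoc add.commute)

lemma iter_diff_quot_cong:
  assumes "\<And>z. z \<in> diff_box h js y \<Longrightarrow> u z = v z"
  shows "iter_diff_quot h js u y = iter_diff_quot h js v y"
  using assms
proof (induction js arbitrary: u v y)
  case (Cons i js)
  have "diff_quot h i u z = diff_quot h i v z" if "z \<in> diff_box h js y" for z
    using Cons.prems that diff_box_translate[OF that, of "h *\<^sub>R axis i 1"] by (simp add: diff_quot_def)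
  then show ?case
    unfolding iter_diff_quot_Cons' by (rule Cons.IH)
qed simp

lemma iter_diff_quot_add:
  "iter_diff_quot h js (\<lambda>z. u z + v z) = (\<lambda>z. iter_diff_quot h js u z + iter_diff_quot h js v z)"
  by (induction js) (auto simp: diff_quot_def algebra_simps)

lemma iter_diff_quot_diff:
  "iter_diff_quot h js (\<lambda>z. u z - v z) = (\<lambda>z. iter_diff_quot h js u z - iter_diff_quot h js v z)"
  by (induction js) (auto simp: diff_quot_def algebra_simps)

lemma iter_diff_quot_scaleR:
  "iter_diff_quot h js (\<lambda>z. c *\<^sub>R u z) = (\<lambda>z. c *\<^sub>R iter_diff_quot h js u z)"
  by (induction js) (auto simp: diff_quot_def algebra_simps)

lemma iter_diff_quot_zero: "iter_diff_quot h js (\<lambda>z. 0) = (\<lambda>z. 0)"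
  by (induction js) (auto simp: diff_quot_def)

lemma iter_diff_quot_translate:
  "iter_diff_quot h js (\<lambda>z. u (z + v)) = (\<lambda>z. iter_diff_quot h js u (z + v))"
proof (induction js)
  case (Cons j js)
  then show ?case by (simp add: diff_quot_def fun_eq_iff add_ac)
qed simp

lemma iter_diff_quot_nth: "iter_diff_quot h js (\<lambda>y. a y $ k) = (\<lambda>y. iter_diff_quot h js a y $ k)"
  by (induction js) (auto simp: diff_quot_def)

lemma iter_diff_quot_in_subspace:
  assumes "subspace P" "\<And>z. z \<in> diff_box h js y \<Longrightarrow> u z \<in> P"
  shows "iter_diff_quot h js u y \<in> P"
  using assms(2)
proof (induction js arbitrary: u y)
  case (Cons i js)
  show ?case
    unfolding iter_diff_quot_Cons'
  proof (rule Cons.IH)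
    fix z assume z: "z \<in> diff_box h js y"
    then have "u z \<in> P" "u (z + h *\<^sub>R axis i 1) \<in> P"
      using Cons.prems diff_box_translate[OF z, of "h *\<^sub>R axis i 1"] by auto
    then show "diff_quot h i u z \<in> P"
      using assms(1) by (simp add: diff_quot_def subspace_diff subspace_scale)
  qed
qed simp

lemma iter_diff_quot_has_vector_derivative:
  assumes "\<And>z. z \<in> diff_box h js y \<Longrightarrow> ((\<lambda>s. \<phi> s z) has_vector_derivative \<phi>' z) F"
  shows "((\<lambda>s. iter_diff_quot h js (\<phi> s) y) has_vector_derivative iter_diff_quot h js \<phi>' y) F"
  using assms
proof (induction js arbitrary: \<phi> \<phi>' y)
  case (Cons i js)
  show ?case
    unfolding iter_diff_quot_Cons'
  proof (rule Cons.IH)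
    fix z assume z: "z \<in> diff_box h js y"
    then have "((\<lambda>s. \<phi> s z) has_vector_derivative \<phi>' z) F"
      "((\<lambda>s. \<phi> s (z + h *\<^sub>R axis i 1)) has_vector_derivative \<phi>' (z + h *\<^sub>R axis i 1)) F"
      using Cons.prems diff_box_translate[OF z, of "h *\<^sub>R axis i 1"] by auto
    then show "((\<lambda>s. diff_quot h i (\<phi> s) z) has_vector_derivative diff_quot h i \<phi>' z) F"
      unfolding diff_quot_def
      by (intro bounded_linear.has_vector_derivative[OF bounded_linear_scaleR_right]
          has_vector_derivative_diff)
  qed
qed simp

text \<open>\<open>diff_bound h U js y u\<close> bounds by \<open>U\<close> the difference quotients of \<open>u\<close> along all sublists
  of \<open>js\<close> at all points of the box spanned by \<open>js\<close> where they only use values in that box;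
  \<open>diff_bound'\<close> omits the quotients of order 0.\<close>

fun diff_bound :: "real \<Rightarrow> real \<Rightarrow> 'd::finite list \<Rightarrow> real ^ 'd \<Rightarrow> (real ^ 'd \<Rightarrow> 'v::real_normed_vector) \<Rightarrow> bool" where
  "diff_bound h U [] y u \<longleftrightarrow> norm (u y) \<le> U"
| "diff_bound h U (i # js) y u \<longleftrightarrow> diff_bound h U js y u \<and>
     diff_bound h U js (y + h *\<^sub>R axis i 1) u \<and> diff_bound h U js y (diff_quot h i u)"

fun diff_bound' :: "real \<Rightarrow> real \<Rightarrow> 'd::finite list \<Rightarrow> real ^ 'd \<Rightarrow> (real ^ 'd \<Rightarrow> 'v::real_normed_vector) \<Rightarrow> bool" where
  "diff_bound' h U [] y u \<longleftrightarrow> True"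
| "diff_bound' h U (i # js) y u \<longleftrightarrow> diff_bound' h U js y u \<and>
     diff_bound' h U js (y + h *\<^sub>R axis i 1) u \<and> diff_bound h U js y (diff_quot h i u)"

section \<open>Bounds on quotients under translation and convex combination\<close>

lemma diff_quot_translate:
  "diff_quot h i (\<lambda>z. u (z + v)) = (\<lambda>z. diff_quot h i u (z + v))"
  by (auto simp: diff_quot_def fun_eq_iff add_ac)

lemma diff_bound_translate: "diff_bound h U js y (\<lambda>z. u (z + v)) \<longleftrightarrow> diff_bound h U js (y + v) u"
  by (induction js arbitrary: u y) (auto simp: diff_quot_translate add_ac)

lemma diff_bound'_translate: "diff_bound' h U js y (\<lambda>z. u (z + v)) \<longleftrightarrow> diff_bound' h U js (y + v) u"
  by (induction js arbitrary: u y) (auto simp: diff_quot_translate diff_bound_translate add_ac)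

lemma diff_quot_combination:
  "diff_quot h i (\<lambda>z. \<alpha> *\<^sub>R u z + \<beta> *\<^sub>R v z) = (\<lambda>z. \<alpha> *\<^sub>R diff_quot h i u z + \<beta> *\<^sub>R diff_quot h i v z)"
  by (auto simp: diff_quot_def fun_eq_iff algebra_simps)

lemma diff_bound_convex:
  assumes "0 \<le> \<alpha>" "0 \<le> \<beta>" "\<alpha> + \<beta> = 1" "diff_bound h U js y u" "diff_bound h U js y v"
  shows "diff_bound h U js y (\<lambda>z. \<alpha> *\<^sub>R u z + \<beta> *\<^sub>R v z)"
  using assms(4,5)
proof (induction js arbitrary: u v y)
  case Nil
  have "norm (\<alpha> *\<^sub>R u y + \<beta> *\<^sub>R v y) \<le> \<alpha> * norm (u y) + \<beta> * norm (v y)"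
    using norm_triangle_ineq[of "\<alpha> *\<^sub>R u y" "\<beta> *\<^sub>R v y"] assms(1,2) by simp
  also have "\<dots> \<le> \<alpha> * U + \<beta> * U"
    using Nil assms(1,2) by (intro add_mono mult_left_mono) auto
  also have "\<dots> = U"
    using assms(3) by (simp add: distrib_right[symmetric])
  finally show ?case by simp
qed (auto simp: diff_quot_combination)

lemma diff_bound'_convex:
  assumes "0 \<le> \<alpha>" "0 \<le> \<beta>" "\<alpha> + \<beta> = 1" "diff_bound' h U js y u" "diff_bound' h U js y v"
  shows "diff_bound' h U js y (\<lambda>z. \<alpha> *\<^sub>R u z + \<beta> *\<^sub>R v z)"
  using assms(4,5)
  by (induction js arbitrary: u v y)
    (auto simp: diff_quot_combination intro: diff_bound_convex[OF assms(1-3)])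

text \<open>Bounds on unit directions extend by homogeneity, one entry at a time. It is stated for
  any \<open>T\<close> homogeneous in each entry, since it is also applied to the remainder of a
  Taylor expansion.\<close>

lemma norm_le_of_unit_lists:
  assumes "subspace P" and hom: "\<And>us h vs c. length us + length vs + 1 = j \<Longrightarrow> set us \<subseteq> P \<Longrightarrow> set vs \<subseteq> P \<Longrightarrow>
      h \<in> P \<Longrightarrow> T (us @ (c *\<^sub>R h) # vs) = c *\<^sub>R T (us @ h # vs)"
    and bd: "\<And>hs. hs \<in> unit_lists P j \<Longrightarrow> norm (T hs) \<le> B"
    and hs: "length hs = j" "set hs \<subseteq> P"
  shows "norm (T hs) \<le> B * prod_list (map norm hs)"
proof -
  have "norm (T (us @ vs)) \<le> B * prod_list (map norm vs)"
    if "length us + length vs = j" "set us \<subseteq> P \<inter> cball 0 1" "set vs \<subseteq> P" for us vs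
    using that
  proof (induction vs arbitrary: us)
    case Nil
    then show ?case using bd[of us] by (simp add: unit_lists_def)
  next
    case (Cons v vs)
    have P: "v \<in> P" "set vs \<subseteq> P" "set us \<subseteq> P" using Cons.prems by auto
    show ?case
    proof (cases "v = 0")
      case True
      have "T (us @ (0 *\<^sub>R v) # vs) = 0 *\<^sub>R T (us @ v # vs)"
        by (rule hom) (use Cons.prems P in auto)
      then show ?thesis using True by simp
    next
      case False
      \<comment> \<open>The head is normalised and moved to the finished part \<open>us\<close>;
        once \<open>vs\<close> is exhausted, the bound on unit lists applies.\<close>
      define v' where "v' = v /\<^sub>R norm v"
      have v': "v' \<in> P" "norm v' = 1"
        using False P(1) \<open>subspace P\<close> by (auto simp: v'_def subspace_scale)
      have "norm (T ((us @ [v']) @ vs)) \<le> B * prod_list (map norm vs)"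
        using Cons.prems v' P by (intro Cons.IH) auto
      moreover have "T (us @ (norm v *\<^sub>R v') # vs) = norm v *\<^sub>R T (us @ v' # vs)"
        by (rule hom) (use Cons.prems P v' in auto)
      moreover have "norm v *\<^sub>R v' = v"
        using False by (simp add: v'_def)
      ultimately show ?thesis
        using mult_left_mono[of "norm (T (us @ v' # vs))" "B * prod_list (map norm vs)" "norm v"]
        by (simp add: mult.left_commute)
    qed
  qed
  from this[of "[]" hs] hs show ?thesis by simp
qed

section \<open>Derivatives as multilinear forms, and their differentiability along lines\<close>

lemma Cm_derivatives_homogeneous:
  assumes "Cm_derivatives P m f D" "a \<in> P" "length us + length vs < m" "set us \<subseteq> P" "set vs \<subseteq> P" "h \<in> P"
  shows "D a (us @ (c *\<^sub>R h) # vs) = c *\<^sub>R D a (us @ h # vs)"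
proof -
  have "bounded_multilinear_on P (length us + length vs + 1) (D a)"
    using assms(1-3) unfolding Cm_derivatives_def by auto
  then show ?thesis
    using assms unfolding bounded_multilinear_on_def by blast
qed

lemma Cm_derivatives_additive:
  assumes "Cm_derivatives P m f D" "a \<in> P" "length us + length vs < m" "set us \<subseteq> P" "set vs \<subseteq> P" "h \<in> P" "h' \<in> P"
  shows "D a (us @ (h + h') # vs) = D a (us @ h # vs) + D a (us @ h' # vs)"
proof -
  have "bounded_multilinear_on P (length us + length vs + 1) (D a)"
    using assms(1-3) unfolding Cm_derivatives_def by auto
  then show ?thesis
    using assms unfolding bounded_multilinear_on_def by blast
qed

text \<open>Differentiability is given uniformly over unit directions; homogeneity transfers it to
  arbitrary \<open>hs\<close>. Restricted to a line it becomes a derivative in one real variable,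
  which is what the mean value inequality needs.\<close>

lemma Cm_derivatives_has_vector_derivative:
  assumes D: "Cm_derivatives P m f D" and P: "subspace P" and "a \<in> P" "v \<in> P" "set hs \<subseteq> P" "length hs < m"
  shows "((\<lambda>s. D (a + s *\<^sub>R v) hs) has_vector_derivative D (a + s0 *\<^sub>R v) (v # hs)) (at s0 within S)"
  unfolding has_vector_derivative_def has_derivative_within_alt
proof (intro conjI allI impI)
  show "bounded_linear (\<lambda>x. x *\<^sub>R D (a + s0 *\<^sub>R v) (v # hs))"
    by (rule bounded_linear_scaleR_left)
  fix e :: real assume "e > 0"
  define p where "p = prod_list (map norm hs)"
  have p: "p \<ge> 0" unfolding p_def by (rule prod_list_nonneg) auto
  define b where "b s = a + s *\<^sub>R v" for s
  have bP: "b s \<in> P" for s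
    using assms by (auto simp: b_def subspace_add subspace_scale)
  \<comment> \<open>The remainder is \<open>e'\<close> times the length of the increment, which is
    proportional to \<open>norm v\<close>, and homogeneity in \<open>hs\<close> adds the factor
    \<open>p\<close>. The summand 1 keeps the denominator positive when \<open>v\<close> or some
    entry of \<open>hs\<close> is zero.\<close>
  define e' where "e' = e / (1 + norm v * p)"
  have np: "1 + norm v * p > 0" using p by (simp add: add_pos_nonneg)
  have "e' > 0" using \<open>e > 0\<close> np by (simp add: e'_def)
  then obtain \<delta> where \<delta>: "\<delta> > 0" and close: "\<And>x hs'. x \<in> P \<Longrightarrow> dist x (b s0) < \<delta> \<Longrightarrow>
      hs' \<in> unit_lists P (length hs) \<Longrightarrow>
      norm (D x hs' - D (b s0) hs' - D (b s0) ((x - b s0) # hs')) \<le> e' * norm (x - b s0)"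
    using D bP[of s0] \<open>length hs < m\<close> unfolding Cm_derivatives_def by meson
  define d where "d = \<delta> / (1 + norm v)"
  have "d > 0" using \<delta> by (simp add: d_def add_pos_nonneg)
  moreover have "norm (D (b s) hs - D (b s0) hs - (s - s0) *\<^sub>R D (b s0) (v # hs)) \<le> e * norm (s - s0)"
    if "norm (s - s0) < d" for s
  proof -
    have diff: "b s - b s0 = (s - s0) *\<^sub>R v"
      by (simp add: b_def algebra_simps)
    have "norm (s - s0) * norm v \<le> norm (s - s0) * (1 + norm v)"
      by (intro mult_left_mono) auto
    also have "\<dots> < \<delta>"
      using that by (simp add: d_def pos_less_divide_eq add_pos_nonneg)
    finally have dist: "dist (b s) (b s0) < \<delta>"
      by (simp add: dist_norm diff)
    have dP: "b s - b s0 \<in> P" using bP P by (simp add: subspace_diff)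
    have "norm ((\<lambda>hs. D (b s) hs - D (b s0) hs - D (b s0) ((b s - b s0) # hs)) hs)
        \<le> (e' * norm (b s - b s0)) * p"
      unfolding p_def
    proof (rule norm_le_of_unit_lists[OF P, where j = "length hs"])
      fix us h vs c
      assume *: "length us + length vs + 1 = length hs" "set us \<subseteq> P" "set vs \<subseteq> P" "h \<in> P"
      have "D (b s0) (((b s - b s0) # us) @ (c *\<^sub>R h) # vs) = c *\<^sub>R D (b s0) (((b s - b s0) # us) @ h # vs)"
        by (rule Cm_derivatives_homogeneous[OF D bP]) (use * dP \<open>length hs < m\<close> in auto)
      moreover have "D (b t) (us @ (c *\<^sub>R h) # vs) = c *\<^sub>R D (b t) (us @ h # vs)" for t
        by (rule Cm_derivatives_homogeneous[OF D bP]) (use * \<open>length hs < m\<close> in auto)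
      ultimately show "D (b s) (us @ c *\<^sub>R h # vs) - D (b s0) (us @ c *\<^sub>R h # vs) -
          D (b s0) ((b s - b s0) # us @ c *\<^sub>R h # vs) =
          c *\<^sub>R (D (b s) (us @ h # vs) - D (b s0) (us @ h # vs) - D (b s0) ((b s - b s0) # us @ h # vs))"
        by (simp add: algebra_simps)
    qed (use close[OF bP dist] \<open>set hs \<subseteq> P\<close> in auto)
    moreover have "D (b s0) ((b s - b s0) # hs) = (s - s0) *\<^sub>R D (b s0) (v # hs)"
      using Cm_derivatives_homogeneous[OF D bP[of s0], of "[]" hs v "s - s0"] assms diff by simp
    ultimately have "norm (D (b s) hs - D (b s0) hs - (s - s0) *\<^sub>R D (b s0) (v # hs))
        \<le> norm (s - s0) * (e' * (norm v * p))"
      by (simp add: diff mult_ac)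
    also have "\<dots> \<le> norm (s - s0) * (e' * (1 + norm v * p))"
      using \<open>e' > 0\<close> by (intro mult_left_mono) auto
    also have "e' * (1 + norm v * p) = e" using np by (simp add: e'_def)
    finally show ?thesis by (simp add: mult.commute)
  qed
  ultimately show "\<exists>d>0. \<forall>y\<in>S. norm (y - s0) < d \<longrightarrow>
      norm (D (a + y *\<^sub>R v) hs - D (a + s0 *\<^sub>R v) hs - (y - s0) *\<^sub>R D (a + s0 *\<^sub>R v) (v # hs)) \<le> e * norm (y - s0)"
    unfolding b_def by blast
qed

text \<open>\<open>p\<close> counts the differences still to be taken, \<open>m\<close> the
  arguments of the multilinear form. A difference either moves the base point, which creates one
  more argument, bounded by \<open>A\<close>, or falls on one of the \<open>m\<close> arguments and
  leaves their number unchanged.\<close>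

fun chain_const :: "real \<Rightarrow> real \<Rightarrow> nat \<Rightarrow> nat \<Rightarrow> real" where
  "chain_const A B 0 m = B"
| "chain_const A B (Suc p) m = A * chain_const A B p (Suc m) + m * chain_const A B p m"

lemma chain_const_nonneg: "0 \<le> A \<Longrightarrow> 0 \<le> B \<Longrightarrow> 0 \<le> chain_const A B p m"
  by (induction p arbitrary: m) auto

text \<open>Convexity of \<open>N\<close> keeps the segments between neighbouring values inside the
  set where the derivatives are bounded by \<open>B\<close>. The constant \<open>A\<close> is meant
  for the quotients of positive order of the inner function.\<close>

locale Cm_bounded =
  fixes P :: "'a::real_normed_vector set" and m :: nat
    and f :: "'a \<Rightarrow> 'b::real_normed_vector" and D N and A B :: real
  assumes P: "subspace P" and D: "Cm_derivatives P m f D"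
    and N: "convex N" "N \<subseteq> P"
    and bd: "\<And>b j hs. b \<in> N \<Longrightarrow> j \<le> m \<Longrightarrow> hs \<in> unit_lists P j \<Longrightarrow> norm (D b hs) \<le> B"
    and A: "0 \<le> A"
begin

lemma D_le:
  assumes "b \<in> N" "set hs \<subseteq> P" "length hs \<le> m"
  shows "norm (D b hs) \<le> B * prod_list (map norm hs)"
proof (rule norm_le_of_unit_lists[OF P])
  fix us h vs c
  assume "length us + length vs + 1 = length hs" "set us \<subseteq> P" "set vs \<subseteq> P" "h \<in> P"
  then show "D b (us @ c *\<^sub>R h # vs) = c *\<^sub>R D b (us @ h # vs)"
    using assms N(2) by (intro Cm_derivatives_homogeneous[OF D]) auto
qed (use assms bd in auto)

text \<open>\<open>c z\<close> is joined to its translate by a segment with parameter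
  \<open>s\<close>. The mean value inequality is applied in \<open>s\<close>, after the remaining
  quotients have been taken in \<open>z\<close>; these commute with differentiation in
  \<open>s\<close>, so the derivative has the same shape with the additional argument
  \<open>diff_quot h i c\<close>.\<close>

lemma homotopy_step:
  fixes c :: "real ^ 'd::finite \<Rightarrow> 'a"
  assumes h: "0 < h" and c: "\<And>z. z \<in> diff_box h (i # js) y \<Longrightarrow> c z \<in> N"
    and w: "\<And>z. z \<in> diff_box h js y \<Longrightarrow> set (w z) \<subseteq> P \<and> length (w z) < m"
    and Z: "\<And>s. 0 \<le> s \<Longrightarrow> s \<le> h \<Longrightarrow>
      norm (iter_diff_quot h js (\<lambda>z. D (c z + s *\<^sub>R diff_quot h i c z) (diff_quot h i c z # w z)) y) \<le> Z"
  shows "norm (iter_diff_quot h js (\<lambda>z. (D (c (z + h *\<^sub>R axis i 1)) (w z) - D (c z) (w z)) /\<^sub>R h) y) \<le> Z"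
proof -
  define v where "v = diff_quot h i c"
  define \<psi> where "\<psi> s = iter_diff_quot h js (\<lambda>z. D (c z + s *\<^sub>R v z) (w z)) y" for s
  define \<psi>' where "\<psi>' s = iter_diff_quot h js (\<lambda>z. D (c z + s *\<^sub>R v z) (v z # w z)) y" for s
  have cP: "c z \<in> P" "v z \<in> P" if "z \<in> diff_box h js y" for z
  proof -
    have "c z \<in> P" "c (z + h *\<^sub>R axis i 1) \<in> P"
      using c N(2) that diff_box_translate[OF that, of "h *\<^sub>R axis i 1"] by auto
    then show "c z \<in> P" "v z \<in> P"
      using P by (auto simp: v_def diff_quot_def subspace_diff subspace_scale)
  qed
  have "(\<psi> has_vector_derivative \<psi>' s) (at s within {0..h})" for s
    unfolding \<psi>_def \<psi>'_def
    using Cm_derivatives_has_vector_derivative[OF D P] cP w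
    by (intro iter_diff_quot_has_vector_derivative) auto
  moreover have "onorm (\<lambda>x. x *\<^sub>R \<psi>' s) \<le> Z" if "s \<in> {0..h}" for s
  proof (rule onorm_le)
    have "norm (\<psi>' s) \<le> Z"
      using Z that by (simp add: \<psi>'_def v_def)
    then show "norm (x *\<^sub>R \<psi>' s) \<le> Z * norm x" for x
      by (simp add: mult.commute[of Z] mult_left_mono)
  qed
  ultimately have "norm (\<psi> h - \<psi> 0) \<le> Z * norm (h - 0)"
    using h unfolding has_vector_derivative_def
    by (intro differentiable_bound[where S = "{0..h}" and f' = "\<lambda>s x. x *\<^sub>R \<psi>' s"]) auto
  then have "norm ((\<psi> h - \<psi> 0) /\<^sub>R h) \<le> Z"
    unfolding norm_scaleR using h by (simp add: field_simps)
  also have "(\<psi> h - \<psi> 0) /\<^sub>R h =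
      iter_diff_quot h js (\<lambda>z. (D (c z + h *\<^sub>R v z) (w z) - D (c z) (w z)) /\<^sub>R h) y"
    by (simp add: \<psi>_def iter_diff_quot_scaleR iter_diff_quot_diff)
  also have "(\<lambda>z. c z + h *\<^sub>R v z) = (\<lambda>z. c (z + h *\<^sub>R axis i 1))"
    using h by (auto simp: v_def diff_quot_def)
  finally show ?thesis by (simp add: fun_eq_iff)
qed

abbreviation bounded_args :: "real \<Rightarrow> 'd::finite list \<Rightarrow> real ^ 'd \<Rightarrow> real list \<Rightarrow> (real ^ 'd \<Rightarrow> 'a) list \<Rightarrow> bool" where
  "bounded_args h js y \<equiv> list_all2 (\<lambda>U u. diff_bound h U js y u \<and> (\<forall>z\<in>diff_box h js y. u z \<in> P))"

lemma convex_path: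
  assumes "0 < h" "0 \<le> s" "s \<le> h"
  shows "c z + s *\<^sub>R diff_quot h i c z = (1 - s / h) *\<^sub>R c z + (s / h) *\<^sub>R c (z + h *\<^sub>R axis i 1)"
  using assms by (simp add: diff_quot_def algebra_simps divide_inverse)

lemma diff_quot_in_P:
  assumes "\<forall>z\<in>diff_box h (i # js) y. u z \<in> P" "z \<in> diff_box h js y"
  shows "diff_quot h i u z \<in> P" "u (z + h *\<^sub>R axis i 1) \<in> P"
proof -
  have "u z \<in> P" "u (z + h *\<^sub>R axis i 1) \<in> P"
    using assms diff_box_translate[OF assms(2), of "h *\<^sub>R axis i 1"] by auto
  then show "diff_quot h i u z \<in> P" "u (z + h *\<^sub>R axis i 1) \<in> P"
    using P by (auto simp: diff_quot_def subspace_diff subspace_scale)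
qed

text \<open>At each parameter \<open>s\<close> the segment is a convex combination of
  \<open>c\<close> and its translate with weights that do not depend on \<open>z\<close>. Bounds on
  quotients therefore pass to it with the same constant.\<close>

lemma path_props:
  fixes c :: "real ^ 'd::finite \<Rightarrow> 'a"
  assumes h: "0 < h" "0 \<le> s" "s \<le> h" and c: "\<And>z. z \<in> diff_box h (i # js) y \<Longrightarrow> c z \<in> N"
    and b: "diff_bound' h A js y c" "diff_bound' h A js (y + h *\<^sub>R axis i 1) c"
  shows "\<And>z. z \<in> diff_box h js y \<Longrightarrow> c z + s *\<^sub>R diff_quot h i c z \<in> N"
    and "diff_bound' h A js y (\<lambda>z. c z + s *\<^sub>R diff_quot h i c z)"
proof -
  have s: "0 \<le> 1 - s / h" "0 \<le> s / h" "1 - s / h + s / h = 1" using h by auto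
  show "c z + s *\<^sub>R diff_quot h i c z \<in> N" if "z \<in> diff_box h js y" for z
    unfolding convex_path[OF h]
    by (rule convexD[OF N(1)])
      (use c that diff_box_translate[OF that, of "h *\<^sub>R axis i 1"] s in auto)
  show "diff_bound' h A js y (\<lambda>z. c z + s *\<^sub>R diff_quot h i c z)"
    unfolding convex_path[OF h]
    by (rule diff_bound'_convex[OF s]) (use b in \<open>auto simp: diff_bound'_translate\<close>)
qed

text \<open>The Leibniz rule at a fixed base point. Translated arguments are exchanged for
  untranslated ones one by one, and each exchange leaves a term with one difference quotient among
  its arguments; \<open>us1\<close> collects the exchanged ones. The bounds for \<open>us2\<close>
  refer to the longer list \<open>i # js\<close> and thus cover both translates and quotients along
  \<open>js\<close>.\<close>

lemma telescope_step:
  fixes c :: "real ^ 'd::finite \<Rightarrow> 'a" and Z :: real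
  assumes h: "0 < h" and c: "\<And>z. z \<in> diff_box h js y \<Longrightarrow> c z \<in> N"
    and Z: "\<And>us Us :: real list. length us = l \<Longrightarrow> bounded_args h js y Us us \<Longrightarrow>
      norm (iter_diff_quot h js (\<lambda>z. D (c z) (map (\<lambda>u. u z) us)) y) \<le> Z * prod_list Us"
    and "l \<le> m" "length us1 + length us2 = l"
    and us: "bounded_args h js y Us1 us1" "bounded_args h (i # js) y Us2 us2"
  shows "norm (iter_diff_quot h js (\<lambda>z. (D (c z) (map (\<lambda>u. u z) us1 @ map (\<lambda>u. u (z + h *\<^sub>R axis i 1)) us2)
        - D (c z) (map (\<lambda>u. u z) us1 @ map (\<lambda>u. u z) us2)) /\<^sub>R h) y)
    \<le> length us2 * (Z * (prod_list Us1 * prod_list Us2))"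
  using assms(5-)
proof (induction us2 arbitrary: us1 Us1 Us2)
  case Nil
  then show ?case by (simp add: iter_diff_quot_scaleR iter_diff_quot_zero)
next
  case (Cons u us2)
  let ?e = "h *\<^sub>R axis i 1 :: real ^ 'd"
  let ?sh = "\<lambda>u z. u (z + ?e)"
  obtain U Us2' where U: "Us2 = U # Us2'" "diff_bound h U (i # js) y u"
    "\<forall>z\<in>diff_box h (i # js) y. u z \<in> P" "bounded_args h (i # js) y Us2' us2"
    using Cons.prems(3) by (auto simp: list_all2_Cons2)
  have sh: "bounded_args h js y Us2' (map ?sh us2)"
    unfolding list.rel_map
    by (rule list_all2_mono[OF U(4)])
      (auto simp: diff_bound_translate dest: diff_box_translate[where v = ?e])
  have 1: "norm (iter_diff_quot h js (\<lambda>z. D (c z) (map (\<lambda>u. u z) (us1 @ diff_quot h i u # map ?sh us2))) y)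
      \<le> Z * prod_list (Us1 @ U # Us2')"
  proof (rule Z)
    show "length (us1 @ diff_quot h i u # map ?sh us2) = l"
      using Cons.prems(1) by simp
    show "bounded_args h js y (Us1 @ U # Us2') (us1 @ diff_quot h i u # map ?sh us2)"
      using Cons.prems(2) sh U diff_quot_in_P(1)[OF U(3)]
      by (intro list_all2_appendI) auto
  qed
  have 2: "norm (iter_diff_quot h js (\<lambda>z. (D (c z) (map (\<lambda>u. u z) (us1 @ [u]) @ map (\<lambda>u. u (z + ?e)) us2)
        - D (c z) (map (\<lambda>u. u z) (us1 @ [u]) @ map (\<lambda>u. u z) us2)) /\<^sub>R h) y)
      \<le> length us2 * (Z * (prod_list (Us1 @ [U]) * prod_list Us2'))"
  proof (rule Cons.IH)
    show "bounded_args h js y (Us1 @ [U]) (us1 @ [u])"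
      using Cons.prems(2) U by (intro list_all2_appendI) auto
  qed (use Cons.prems(1) U in auto)
  have eq: "(D (c z) (map (\<lambda>u. u z) us1 @ map (\<lambda>u. u (z + ?e)) (u # us2))
        - D (c z) (map (\<lambda>u. u z) us1 @ map (\<lambda>u. u z) (u # us2))) /\<^sub>R h
      = D (c z) (map (\<lambda>u. u z) (us1 @ diff_quot h i u # map ?sh us2))
      + (D (c z) (map (\<lambda>u. u z) (us1 @ [u]) @ map (\<lambda>u. u (z + ?e)) us2)
        - D (c z) (map (\<lambda>u. u z) (us1 @ [u]) @ map (\<lambda>u. u z) us2)) /\<^sub>R h"
    if z: "z \<in> diff_box h js y" for z
  proof -
    let ?xs = "map (\<lambda>u. u z) us1" and ?ys = "map (\<lambda>u. u (z + ?e)) us2"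
    have cz: "c z \<in> P" using c[OF z] N(2) by auto
    have len: "length ?xs + length ?ys < m"
      using Cons.prems(1) \<open>l \<le> m\<close> by simp
    have xs: "set ?xs \<subseteq> P"
      using Cons.prems(2) z by (auto simp: list_all2_conv_all_nth in_set_conv_nth)
    have ys: "set ?ys \<subseteq> P"
      using sh z by (auto simp: list_all2_conv_all_nth in_set_conv_nth)
    have uP: "u z \<in> P" "diff_quot h i u z \<in> P"
      using U(3) z diff_quot_in_P(1)[OF U(3) z] by auto
    have "u (z + ?e) = h *\<^sub>R diff_quot h i u z + u z"
      using h by (simp add: diff_quot_def)
    then have "D (c z) (?xs @ u (z + ?e) # ?ys)
        = h *\<^sub>R D (c z) (?xs @ diff_quot h i u z # ?ys) + D (c z) (?xs @ u z # ?ys)"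
      using Cm_derivatives_additive[OF D cz len xs ys]
        Cm_derivatives_homogeneous[OF D cz len xs ys] uP P by (simp add: subspace_scale)
    then show ?thesis using h by (simp add: o_def algebra_simps)
  qed
  have "norm (iter_diff_quot h js (\<lambda>z. (D (c z) (map (\<lambda>u. u z) us1 @ map (\<lambda>u. u (z + ?e)) (u # us2))
        - D (c z) (map (\<lambda>u. u z) us1 @ map (\<lambda>u. u z) (u # us2))) /\<^sub>R h) y)
      \<le> Z * prod_list (Us1 @ U # Us2') + length us2 * (Z * (prod_list (Us1 @ [U]) * prod_list Us2'))"
    by (subst iter_diff_quot_cong[OF eq], assumption, subst iter_diff_quot_add,
        rule order_trans[OF norm_triangle_ineq add_mono[OF 1 2]])
  also have "\<dots> = length (u # us2) * (Z * (prod_list Us1 * prod_list Us2))"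
    by (simp add: U(1) algebra_simps)
  finally show ?case .
qed

text \<open>A difference splits into a change of the base point with the arguments already
  translated, and a change of the arguments at the old base point; these are the two summands of
  \<open>chain_const\<close>. The inner function has to stay arbitrary in the induction, because the
  hypothesis is applied to all intermediate functions of the segment.\<close>

lemma chain_bound:
  fixes c :: "real ^ 'd::finite \<Rightarrow> 'a"
  assumes "0 < h" "length js + length us \<le> m"
    and "\<And>z. z \<in> diff_box h js y \<Longrightarrow> c z \<in> N" "diff_bound' h A js y c"
    and "bounded_args h js y Us us"
  shows "norm (iter_diff_quot h js (\<lambda>z. D (c z) (map (\<lambda>u. u z) us)) y)
    \<le> chain_const A B (length js) (length us) * prod_list Us"
  using assms(2-)
proof (induction js arbitrary: us Us y c)
  case Nil
  have "c y \<in> P" using Nil.prems(2)[of y] N(2) by auto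
  have us: "set (map (\<lambda>u. u y) us) \<subseteq> P"
    using Nil.prems(4) by (auto simp: list_all2_conv_all_nth in_set_conv_nth)
  have "norm (D (c y) (map (\<lambda>u. u y) us)) \<le> B * prod_list (map norm (map (\<lambda>u. u y) us))"
    using Nil.prems by (intro D_le us) auto
  \<comment> \<open>Nonnegativity of the product is carried along, as the induction over the list
    multiplies inequalities.\<close>
  also have "prod_list (map norm (map (\<lambda>u. u y) us)) \<le> prod_list Us \<and> 0 \<le> prod_list Us"
    using Nil.prems(4)
    by (induction Us us rule: list_all2_induct)
      (auto intro!: mult_mono mult_nonneg_nonneg prod_list_nonneg dest: order_trans[OF norm_ge_zero])
  then have "B * prod_list (map norm (map (\<lambda>u. u y) us)) \<le> B * prod_list Us"
    using bd[of "c y" 0 "[]"] Nil.prems(2)[of y]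
    by (intro mult_left_mono) (auto simp: unit_lists_def intro: order_trans[OF norm_ge_zero])
  finally show ?case by simp
next
  case (Cons i js)
  let ?e = "h *\<^sub>R axis i 1 :: real ^ 'd"
  let ?sh = "\<lambda>u z. u (z + ?e)"
  let ?l = "length us"
  have c: "c z \<in> N" if "z \<in> diff_box h (i # js) y" for z using Cons.prems(2) that by blast
  have sh: "bounded_args h js y Us (map ?sh us)"
    unfolding list.rel_map
    by (rule list_all2_mono[OF Cons.prems(4)])
      (auto simp: diff_bound_translate dest: diff_box_translate[where v = ?e])
  have 1: "norm (iter_diff_quot h js (\<lambda>z. (D (c (z + ?e)) (map (\<lambda>u. u z) (map ?sh us))
      - D (c z) (map (\<lambda>u. u z) (map ?sh us))) /\<^sub>R h) y)
    \<le> chain_const A B (length js) (Suc ?l) * (A * prod_list Us)"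
  proof (rule homotopy_step[OF \<open>0 < h\<close> c])
    fix z assume "z \<in> diff_box h js y"
    then show "set (map (\<lambda>u. u z) (map ?sh us)) \<subseteq> P \<and> length (map (\<lambda>u. u z) (map ?sh us)) < m"
      using sh Cons.prems(1) by (auto simp: list_all2_conv_all_nth in_set_conv_nth)
  next
    fix s :: real assume s: "0 \<le> s" "s \<le> h"
    have "norm (iter_diff_quot h js (\<lambda>z. D (c z + s *\<^sub>R diff_quot h i c z)
        (map (\<lambda>u. u z) (diff_quot h i c # map ?sh us))) y)
      \<le> chain_const A B (length js) (length (diff_quot h i c # map ?sh us)) * prod_list (A # Us)"
    proof (rule Cons.IH)
      show "bounded_args h js y (A # Us) (diff_quot h i c # map ?sh us)"
        using sh Cons.prems(3) diff_quot_in_P(1)[of h i js y c] c N(2) by auto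
    qed (use path_props[OF \<open>0 < h\<close> s c] Cons.prems(1,3) in auto)
    then show "norm (iter_diff_quot h js (\<lambda>z. D (c z + s *\<^sub>R diff_quot h i c z)
        (diff_quot h i c z # map (\<lambda>u. u z) (map ?sh us))) y)
      \<le> chain_const A B (length js) (Suc ?l) * (A * prod_list Us)"
      by simp
  qed
  have 2: "norm (iter_diff_quot h js (\<lambda>z. (D (c z) (map (\<lambda>u. u z) [] @ map (\<lambda>u. u (z + ?e)) us)
        - D (c z) (map (\<lambda>u. u z) [] @ map (\<lambda>u. u z) us)) /\<^sub>R h) y)
    \<le> ?l * (chain_const A B (length js) ?l * (prod_list [] * prod_list Us))"
  proof (rule telescope_step[OF \<open>0 < h\<close>, where l = ?l])
    fix us' Us' assume us': "length us' = ?l" "bounded_args h js y Us' us'"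
    have "norm (iter_diff_quot h js (\<lambda>z. D (c z) (map (\<lambda>u. u z) us')) y)
        \<le> chain_const A B (length js) (length us') * prod_list Us'"
      using us' Cons.prems by (intro Cons.IH) auto
    then show "norm (iter_diff_quot h js (\<lambda>z. D (c z) (map (\<lambda>u. u z) us')) y)
        \<le> chain_const A B (length js) ?l * prod_list Us'"
      using us'(1) by simp
  qed (use Cons.prems c in auto)
  have eq: "diff_quot h i (\<lambda>z. D (c z) (map (\<lambda>u. u z) us))
      = (\<lambda>z. (D (c (z + ?e)) (map (\<lambda>u. u z) (map ?sh us)) - D (c z) (map (\<lambda>u. u z) (map ?sh us))) /\<^sub>R h
      + (D (c z) (map (\<lambda>u. u z) [] @ map (\<lambda>u. u (z + ?e)) us)
        - D (c z) (map (\<lambda>u. u z) [] @ map (\<lambda>u. u z) us)) /\<^sub>R h)"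
    by (simp add: fun_eq_iff diff_quot_def o_def algebra_simps)
  have "norm (iter_diff_quot h (i # js) (\<lambda>z. D (c z) (map (\<lambda>u. u z) us)) y)
    \<le> chain_const A B (length js) (Suc ?l) * (A * prod_list Us)
      + ?l * (chain_const A B (length js) ?l * (prod_list [] * prod_list Us))"
    unfolding iter_diff_quot_Cons' eq iter_diff_quot_add
    by (rule order_trans[OF norm_triangle_ineq add_mono[OF 1 2]])
  then show ?case by (simp add: algebra_simps)
qed

text \<open>Only the top order difference quotient of \<open>c\<close> at \<open>y\<close> enters the last hypothesis but not
  the first one on \<open>A\<close>, so the bound is affine in the top order quotient.\<close>

lemma chain_bound_top:
  fixes c :: "real ^ 'd::finite \<Rightarrow> 'a"
  assumes "0 < h" "length (i # js) \<le> m"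
    and c: "\<And>z. z \<in> diff_box h (i # js) y \<Longrightarrow> c z \<in> N"
    and b: "diff_bound' h A js y c" "diff_bound' h A js (y + h *\<^sub>R axis i 1) c"
    and U: "diff_bound h U js y (diff_quot h i c)"
  shows "norm (iter_diff_quot h (i # js) (\<lambda>z. D (c z) []) y) \<le> chain_const A B (length js) 1 * U"
proof -
  have "norm (iter_diff_quot h js (\<lambda>z. (D (c (z + h *\<^sub>R axis i 1)) [] - D (c z) []) /\<^sub>R h) y)
      \<le> chain_const A B (length js) 1 * U"
  proof (rule homotopy_step[OF \<open>0 < h\<close> c])
    fix s :: real assume s: "0 \<le> s" "s \<le> h"
    have "norm (iter_diff_quot h js (\<lambda>z. D (c z + s *\<^sub>R diff_quot h i c z)
        (map (\<lambda>u. u z) [diff_quot h i c])) y)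
      \<le> chain_const A B (length js) (length [diff_quot h i c]) * prod_list [U]"
    proof (rule chain_bound[OF \<open>0 < h\<close>])
      show "bounded_args h js y [U] [diff_quot h i c]"
        using U diff_quot_in_P(1)[of h i js y c] c N(2) by auto
    qed (use path_props[OF \<open>0 < h\<close> s c b] assms(2) in auto)
    then show "norm (iter_diff_quot h js (\<lambda>z. D (c z + s *\<^sub>R diff_quot h i c z) [diff_quot h i c z]) y)
      \<le> chain_const A B (length js) 1 * U"
      by simp
  qed (use assms(2) in auto)
  moreover have "diff_quot h i (\<lambda>z. D (c z) []) = (\<lambda>z. (D (c (z + h *\<^sub>R axis i 1)) [] - D (c z) []) /\<^sub>R h)"
    by (simp add: fun_eq_iff diff_quot_def)
  ultimately show ?thesis
    unfolding iter_diff_quot_Cons' by simp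
qed

end

section \<open>Grids\<close>

text \<open>A time function on the grid: a step in any direction raises it by the mesh of that
  direction.\<close>

definition coord_sum :: "real ^ 'd::finite \<Rightarrow> real" where
  "coord_sum x = (\<Sum>i\<in>UNIV. x $ i)"

text \<open>Used in two roles: applied to the side lengths it gives the box of side \<open>c\<close>
  in the directions \<open>J\<close>, and \<open>set_coords J x 0\<close> projects a point to the
  base point of its slab.\<close>

definition set_coords :: "'d set \<Rightarrow> real ^ 'd::finite \<Rightarrow> real \<Rightarrow> real ^ 'd" where
  "set_coords J r c = (\<chi> i. if i \<in> J then c else r $ i)"

definition grid_floor :: "'d set \<Rightarrow> real \<Rightarrow> real ^ 'd::finite \<Rightarrow> real ^ 'd" where
  "grid_floor J \<epsilon> x = (\<chi> i. if i \<in> J then \<epsilon> * of_int \<lfloor>x $ i / \<epsilon>\<rfloor> else x $ i)"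

lemma axis_step_nth: "(x + h *\<^sub>R axis i 1) $ j = x $ j + (if i = j then h else (0::real))"
  by (simp add: axis_def)

lemma axis_back_nth: "(x - h *\<^sub>R axis i 1) $ j = x $ j - (if i = j then h else (0::real))"
  by (simp add: axis_def)

lemma coord_sum_add_axis: "coord_sum (x + h *\<^sub>R axis i 1) = coord_sum x + h"
  by (simp add: coord_sum_def axis_step_nth sum.distrib del: vector_add_component)

lemma coord_sum_diff_axis: "coord_sum (x - h *\<^sub>R axis i 1) = coord_sum x - h"
  by (simp add: coord_sum_def axis_back_nth sum_subtractf del: vector_minus_component)

lemma mesh_pos: "0 < \<epsilon> \<Longrightarrow> 0 < mesh J \<epsilon> i"
  by (simp add: mesh_def)

lemma finite_Omega_disc:
  assumes "0 < \<epsilon>"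
  shows "finite (Omega_disc J \<epsilon> r)"
proof -
  define F where "F i = (\<lambda>m::int. mesh J \<epsilon> i * of_int m) ` {0..\<lceil>r $ i / mesh J \<epsilon> i\<rceil>}" for i
  have "Omega_disc J \<epsilon> r \<subseteq> vec_lambda ` (PiE UNIV F)"
  proof
    fix x assume x: "x \<in> Omega_disc J \<epsilon> r"
    have "x $ i \<in> F i" for i
    proof -
      from x obtain m :: int where m: "x $ i = mesh J \<epsilon> i * of_int m" "0 \<le> x $ i" "x $ i \<le> r $ i"
        unfolding Omega_disc_def by blast
      have "real_of_int m \<le> r $ i / mesh J \<epsilon> i"
        using m mesh_pos[OF assms, of J i] by (simp add: pos_le_divide_eq mult.commute)
      moreover have "0 \<le> m"
        using m(1,2) mesh_pos[OF assms, of J i] by (simp add: zero_le_mult_iff)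
      ultimately have "m \<in> {0..\<lceil>r $ i / mesh J \<epsilon> i\<rceil>}"
        by (simp add: le_ceiling_iff)
      then show ?thesis unfolding F_def m(1) by blast
    qed
    then have "vec_nth x \<in> PiE UNIV F" by auto
    moreover have "x = vec_lambda (vec_nth x)" by simp
    ultimately show "x \<in> vec_lambda ` (PiE UNIV F)" by blast
  qed
  moreover have "finite (PiE UNIV F)"
    by (intro finite_PiE) (auto simp: F_def)
  ultimately show ?thesis by (meson finite_imageI finite_subset)
qed

lemma Omega_disc_nonneg: "x \<in> Omega_disc J \<epsilon> r \<Longrightarrow> 0 \<le> x $ i"
  and Omega_disc_le: "x \<in> Omega_disc J \<epsilon> r \<Longrightarrow> x $ i \<le> r $ i"
  by (simp_all add: Omega_disc_def)

lemma Omega_disc_coord_sum_nonneg: "x \<in> Omega_disc J \<epsilon> r \<Longrightarrow> 0 \<le> coord_sum x"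
  unfolding coord_sum_def by (intro sum_nonneg Omega_disc_nonneg)

lemma Omega_disc_coord_sum_le: "x \<in> Omega_disc J \<epsilon> r \<Longrightarrow> coord_sum x \<le> coord_sum r"
  unfolding coord_sum_def by (intro sum_mono Omega_disc_le)

lemma Omega_disc_step:
  assumes "0 < \<epsilon>" "x \<in> Omega_disc J \<epsilon> r" "x $ i + mesh J \<epsilon> i \<le> r $ i"
  shows "x + mesh J \<epsilon> i *\<^sub>R axis i 1 \<in> Omega_disc J \<epsilon> r"
  unfolding Omega_disc_def mem_Collect_eq axis_step_nth
proof
  fix j
  obtain m :: int where "x $ j = mesh J \<epsilon> j * of_int m"
    using assms(2) unfolding Omega_disc_def by blast
  then have "\<exists>m::int. x $ j + (if i = j then mesh J \<epsilon> i else 0) = mesh J \<epsilon> j * of_int m"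
    by (intro exI[of _ "if i = j then m + 1 else m"]) (auto simp: algebra_simps)
  then show "0 \<le> x $ j + (if i = j then mesh J \<epsilon> i else 0) \<and>
      x $ j + (if i = j then mesh J \<epsilon> i else 0) \<le> r $ j \<and>
      (\<exists>m::int. x $ j + (if i = j then mesh J \<epsilon> i else 0) = mesh J \<epsilon> j * of_int m)"
    using assms(2,3) mesh_pos[OF assms(1), of J i] Omega_disc_nonneg[OF assms(2), of j]
      Omega_disc_le[OF assms(2), of j]
    by (auto simp del: of_int_add)
qed

lemma Omega_disc_diff:
  assumes "0 < \<epsilon>" "x \<in> Omega_disc J \<epsilon> r" "y \<in> Omega_disc J \<epsilon> r'" "y $ i < x $ i"
  shows "y $ i + mesh J \<epsilon> i \<le> x $ i"
proof -
  obtain m n :: int where mn: "x $ i = mesh J \<epsilon> i * of_int m" "y $ i = mesh J \<epsilon> i * of_int n"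
    using assms(2,3) unfolding Omega_disc_def by blast
  then have "n < m"
    using assms(4) mesh_pos[OF assms(1), of J i] by simp
  then have "real_of_int n + 1 \<le> of_int m" by linarith
  then have "mesh J \<epsilon> i * (of_int n + 1) \<le> mesh J \<epsilon> i * of_int m"
    using mesh_pos[OF assms(1), of J i] by (intro mult_left_mono) auto
  then show ?thesis unfolding mn by (simp add: algebra_simps)
qed

lemma Omega_disc_back:
  assumes "0 < \<epsilon>" "x \<in> Omega_disc J \<epsilon> r" "0 < x $ i"
  shows "x - mesh J \<epsilon> i *\<^sub>R axis i 1 \<in> Omega_disc J \<epsilon> r"
  unfolding Omega_disc_def mem_Collect_eq axis_back_nth
proof
  fix j
  obtain m :: int where m: "x $ j = mesh J \<epsilon> j * of_int m"
    using assms(2) unfolding Omega_disc_def by blast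
  then have "\<exists>m::int. x $ j - (if i = j then mesh J \<epsilon> i else 0) = mesh J \<epsilon> j * of_int m"
    by (intro exI[of _ "if i = j then m - 1 else m"]) (auto simp: algebra_simps)
  moreover have "mesh J \<epsilon> j \<le> x $ j" if "i = j"
  proof -
    have "m > 0"
      using m that assms(3) mesh_pos[OF assms(1), of J j] by (simp add: zero_less_mult_iff)
    then have "1 \<le> real_of_int m" by simp
    then show ?thesis
      using mult_left_mono[of 1 "real_of_int m" "mesh J \<epsilon> j"] mesh_pos[OF assms(1), of J j] m by simp
  qed
  ultimately show "0 \<le> x $ j - (if i = j then mesh J \<epsilon> i else 0) \<and>
      x $ j - (if i = j then mesh J \<epsilon> i else 0) \<le> r $ j \<and>
      (\<exists>m::int. x $ j - (if i = j then mesh J \<epsilon> i else 0) = mesh J \<epsilon> j * of_int m)"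
    using mesh_pos[OF assms(1), of J i] Omega_disc_nonneg[OF assms(2), of j]
      Omega_disc_le[OF assms(2), of j]
    by (auto simp del: of_int_diff)
qed

lemma Omega_disc_mono:
  "(\<And>i. r $ i \<le> r' $ i) \<Longrightarrow> Omega_disc J \<epsilon> r \<subseteq> Omega_disc J \<epsilon> r'"
  unfolding Omega_disc_def by (auto intro: order_trans)

lemma Omega_lim_mono:
  "(\<And>i. r $ i \<le> r' $ i) \<Longrightarrow> Omega_lim J r \<subseteq> Omega_lim J r'"
  unfolding Omega_lim_def by (auto intro: order_trans)

lemma Omega_disc_refine: "Omega_disc J \<epsilon> r \<subseteq> Omega_disc J (\<epsilon> / 2) r"
proof
  fix x assume x: "x \<in> Omega_disc J \<epsilon> r"
  have "\<exists>m::int. x $ i = mesh J (\<epsilon> / 2) i * of_int m" for i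
  proof -
    obtain m :: int where "x $ i = mesh J \<epsilon> i * of_int m"
      using x unfolding Omega_disc_def by blast
    then show ?thesis
      by (intro exI[of _ "if i \<in> J then 2 * m else m"]) (auto simp: mesh_def)
  qed
  with x show "x \<in> Omega_disc J (\<epsilon> / 2) r"
    unfolding Omega_disc_def by blast
qed

lemma Omega_disc_subset_lim: "Omega_disc J \<epsilon> r \<subseteq> Omega_lim J r"
  unfolding Omega_disc_def Omega_lim_def mesh_def
  by (auto simp: Ints_def)

lemma grid_floor_nth_le: "0 < \<epsilon> \<Longrightarrow> grid_floor J \<epsilon> x $ i \<le> x $ i"
  using mult_left_mono[OF of_int_floor_le[of "x $ i / \<epsilon>"], of \<epsilon>] by (simp add: grid_floor_def)

lemma grid_floor_nth_ge: "0 < \<epsilon> \<Longrightarrow> x $ i - \<epsilon> \<le> grid_floor J \<epsilon> x $ i"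
proof -
  assume \<epsilon>: "0 < \<epsilon>"
  have "x $ i / \<epsilon> - 1 \<le> of_int \<lfloor>x $ i / \<epsilon>\<rfloor>" by linarith
  from mult_left_mono[OF this, of \<epsilon>] \<epsilon> show ?thesis
    by (simp add: grid_floor_def algebra_simps)
qed

lemma grid_floor_in_disc:
  assumes "0 < \<epsilon>" "x \<in> Omega_lim J r"
  shows "grid_floor J \<epsilon> x \<in> Omega_disc J \<epsilon> r"
  unfolding Omega_disc_def mem_Collect_eq
proof (intro allI conjI)
  fix i
  have x: "0 \<le> x $ i" "x $ i \<le> r $ i" "i \<notin> J \<Longrightarrow> x $ i \<in> \<int>"
    using assms(2) by (auto simp: Omega_lim_def)
  show "0 \<le> grid_floor J \<epsilon> x $ i"
    using assms(1) x(1) by (simp add: grid_floor_def)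
  show "grid_floor J \<epsilon> x $ i \<le> r $ i"
    using grid_floor_nth_le[OF assms(1), of J x i] x(2) by linarith
  show "\<exists>m::int. grid_floor J \<epsilon> x $ i = mesh J \<epsilon> i * of_int m"
    using x(3) by (auto simp: grid_floor_def mesh_def Ints_def)
qed

lemma grid_floor_id:
  assumes "0 < \<epsilon>" "x \<in> Omega_disc J \<epsilon> r"
  shows "grid_floor J \<epsilon> x = x"
  unfolding vec_eq_iff
proof
  fix i
  obtain m :: int where "x $ i = mesh J \<epsilon> i * of_int m"
    using assms(2) unfolding Omega_disc_def by blast
  then show "grid_floor J \<epsilon> x $ i = x $ i"
    using assms(1) by (auto simp: grid_floor_def mesh_def)
qed

lemma grid_floor_set_coords: "set_coords J (grid_floor J \<epsilon> x) 0 = set_coords J x 0"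
  by (simp add: set_coords_def grid_floor_def vec_eq_iff)

lemma set_coords_eq_iff: "set_coords J x 0 = set_coords J y 0 \<longleftrightarrow> (\<forall>i. i \<notin> J \<longrightarrow> x $ i = y $ i)"
  by (auto simp: set_coords_def vec_eq_iff)

lemma set_coords_add_axis: "i \<in> J \<Longrightarrow> set_coords J (x + h *\<^sub>R axis i 1) 0 = set_coords J x 0"
  unfolding set_coords_eq_iff axis_step_nth by auto

lemma set_coords_diff_axis: "i \<in> J \<Longrightarrow> set_coords J (x - h *\<^sub>R axis i 1) 0 = set_coords J x 0"
  unfolding set_coords_eq_iff axis_back_nth by auto

text \<open>Both points are joined to their componentwise minimum, which is again a grid point. The
  two paths are monotone and stay in the box, and their lengths add up to the l1 distance.\<close>

lemma grid_lipschitz: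
  fixes u :: "real ^ 'd::finite \<Rightarrow> 'v::real_normed_vector"
  assumes "0 < \<epsilon>"
    and step: "\<And>i x. i \<in> J \<Longrightarrow> x \<in> Omega_disc J \<epsilon> R \<Longrightarrow> x + \<epsilon> *\<^sub>R axis i 1 \<in> Omega_disc J \<epsilon> R \<Longrightarrow>
      norm (u (x + \<epsilon> *\<^sub>R axis i 1) - u x) \<le> M * \<epsilon>"
    and x: "x \<in> Omega_disc J \<epsilon> R" and y: "y \<in> Omega_disc J \<epsilon> R" and "set_coords J x 0 = set_coords J y 0"
  shows "norm (u x - u y) \<le> M * (\<Sum>i\<in>UNIV. \<bar>x $ i - y $ i\<bar>)"
proof -
  have mono: "norm (u y - u x) \<le> M * (\<Sum>i\<in>UNIV. y $ i - x $ i)"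
    if x: "x \<in> Omega_disc J \<epsilon> R" and "y \<in> Omega_disc J \<epsilon> R" "set_coords J x 0 = set_coords J y 0" "\<forall>i. x $ i \<le> y $ i" for x y
  proof -
    have "set_coords J x 0 = set_coords J y 0 \<longrightarrow> (\<forall>i. x $ i \<le> y $ i) \<longrightarrow> norm (u y - u x) \<le> M * (\<Sum>i\<in>UNIV. y $ i - x $ i)"
    proof (rule finite_measure_induct[where m = coord_sum, OF finite_Omega_disc[OF assms(1)] _ that(2)], goal_cases)
    case (1 y)
    note IH = 1(2) and y = 1(1)
    show ?case
    proof (intro impI)
      assume cut: "set_coords J x 0 = set_coords J y 0" and le: "\<forall>i. x $ i \<le> y $ i"
      show "norm (u y - u x) \<le> M * (\<Sum>i\<in>UNIV. y $ i - x $ i)"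
      proof (cases "x = y")
        case False
        then obtain i where i: "x $ i < y $ i"
          using le by (metis vec_eq_iff order_le_less)
        then have iJ: "i \<in> J" using cut unfolding set_coords_eq_iff by force
        define y' where "y' = y - \<epsilon> *\<^sub>R axis i 1"
        have yi: "0 < y $ i" using i Omega_disc_nonneg[OF x, of i] by simp
        have y': "y' \<in> Omega_disc J \<epsilon> R"
          using Omega_disc_back[OF assms(1) y yi] iJ by (simp add: y'_def mesh_def)
        have yy: "y' + \<epsilon> *\<^sub>R axis i 1 = y" by (simp add: y'_def)
        have "x $ i + \<epsilon> \<le> y $ i"
          using Omega_disc_diff[OF assms(1) y x i] iJ by (simp add: mesh_def)
        then have le': "\<forall>j. x $ j \<le> y' $ j"
          using le unfolding y'_def axis_back_nth by auto
        have "norm (u y' - u x) \<le> M * (\<Sum>i\<in>UNIV. y' $ i - x $ i)"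
          using IH[OF y'] le' cut iJ assms(1)
          by (simp add: y'_def coord_sum_diff_axis set_coords_diff_axis)
        moreover have "norm (u y - u y') \<le> M * \<epsilon>"
          using step[OF iJ y'] y by (simp add: yy)
        moreover have "(\<Sum>i\<in>UNIV. y $ i - x $ i) = (\<Sum>i\<in>UNIV. y' $ i - x $ i) + \<epsilon>"
          using coord_sum_diff_axis[of y \<epsilon> i] by (simp add: sum_subtractf coord_sum_def y'_def)
        ultimately show ?thesis
          using norm_triangle_ineq[of "u y - u y'" "u y' - u x"] by (simp add: distrib_left)
      qed simp
    qed
    qed
    with that show ?thesis by blast
  qed
  define z where "z = (\<chi> i. min (x $ i) (y $ i))"
  have z: "z \<in> Omega_disc J \<epsilon> R"
    unfolding Omega_disc_def mem_Collect_eq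
  proof
    fix i
    have "z $ i = x $ i \<or> z $ i = y $ i" by (auto simp: z_def min_def)
    then show "0 \<le> z $ i \<and> z $ i \<le> R $ i \<and> (\<exists>m::int. z $ i = mesh J \<epsilon> i * of_int m)"
    proof
      assume "z $ i = x $ i"
      then show ?thesis using x unfolding Omega_disc_def by simp
    next
      assume "z $ i = y $ i"
      then show ?thesis using y unfolding Omega_disc_def by simp
    qed
  qed
  have cut: "set_coords J z 0 = set_coords J x 0" "set_coords J z 0 = set_coords J y 0"
    using assms(5) by (auto simp: set_coords_eq_iff z_def)
  have "norm (u x - u y) \<le> norm (u x - u z) + norm (u y - u z)"
    using norm_triangle_ineq4[of "u x - u z" "u y - u z"] by simp
  also have "\<dots> \<le> M * (\<Sum>i\<in>UNIV. x $ i - z $ i) + M * (\<Sum>i\<in>UNIV. y $ i - z $ i)"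
    by (intro add_mono mono z x y cut) (auto simp: z_def)
  also have "\<dots> = M * (\<Sum>i\<in>UNIV. (x $ i - z $ i) + (y $ i - z $ i))"
    by (simp only: sum.distrib distrib_left)
  also have "(\<Sum>i\<in>UNIV. (x $ i - z $ i) + (y $ i - z $ i)) = (\<Sum>i\<in>UNIV. \<bar>x $ i - y $ i\<bar>)"
    by (rule sum.cong) (auto simp: z_def min_def)
  finally show ?thesis .
qed

text \<open>Each step contributes its local error \<sigma> and the drift of \<open>w\<close> from
  its initial value, at most \<Lambda> times the length covered so far. The discrete scheme
  (\<sigma> of order \<open>h\<close>), exact difference quotients (\<sigma> = 0) and plain
  Lipschitz bounds (\<open>w\<close> = 0) are all instances.\<close>

lemma grid_taylor:
  fixes u w :: "real ^ 'd::finite \<Rightarrow> 'v::real_normed_vector"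
  assumes "0 \<le> h" "0 \<le> \<Lambda>"
    and u: "\<And>l. l < m \<Longrightarrow> norm (u (x + (real l * h) *\<^sub>R axis i 1 + h *\<^sub>R axis i 1)
        - u (x + (real l * h) *\<^sub>R axis i 1) - h *\<^sub>R w (x + (real l * h) *\<^sub>R axis i 1)) \<le> h * \<sigma>"
    and w: "\<And>l. l < m \<Longrightarrow> norm (w (x + (real l * h) *\<^sub>R axis i 1) - w x) \<le> \<Lambda> * (real l * h)"
  shows "norm (u (x + (real m * h) *\<^sub>R axis i 1) - u x - (real m * h) *\<^sub>R w x)
    \<le> (real m * h) * (\<sigma> + \<Lambda> * (real m * h))"
  using u w
proof (induction m)
  case (Suc m)
  let ?x = "x + (real m * h) *\<^sub>R axis i 1"
  have "u (x + (real (Suc m) * h) *\<^sub>R axis i 1) - u x - (real (Suc m) * h) *\<^sub>R w x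
     = (u ?x - u x - (real m * h) *\<^sub>R w x) + (u (?x + h *\<^sub>R axis i 1) - u ?x - h *\<^sub>R w ?x) + h *\<^sub>R (w ?x - w x)"
    by (simp add: algebra_simps)
  also have "norm \<dots> \<le> norm (u ?x - u x - (real m * h) *\<^sub>R w x)
      + norm (u (?x + h *\<^sub>R axis i 1) - u ?x - h *\<^sub>R w ?x) + h * norm (w ?x - w x)"
    using assms(1) by (intro norm_triangle_le add_mono order_refl) (auto simp: norm_triangle_ineq)
  also have "\<dots> \<le> (real m * h) * (\<sigma> + \<Lambda> * (real m * h)) + h * \<sigma> + h * (\<Lambda> * (real m * h))"
    using Suc assms(1) by (intro add_mono mult_left_mono) auto
  also have "\<dots> \<le> (real (Suc m) * h) * (\<sigma> + \<Lambda> * (real (Suc m) * h))"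
    using assms(1,2) by (simp add: algebra_simps)
  finally show ?case .
qed simp

text \<open>Only forward expansions are available from the grid. A backward increment from
  \<open>x\<close> is a forward increment from the other end, and the Lipschitz bound moves
  \<open>w\<close> back to \<open>x\<close>, at the price of a factor 2 in the remainder.\<close>

lemma has_vector_derivative_of_forward_taylor:
  fixes v w :: "real ^ 'd::finite \<Rightarrow> 'v::real_normed_vector"
  assumes "0 < t1" "0 \<le> C"
    and fw: "\<And>x t. x \<in> S \<Longrightarrow> 0 \<le> t \<Longrightarrow> t \<le> t1 \<Longrightarrow> x + t *\<^sub>R axis i 1 \<in> S \<Longrightarrow>
      norm (v (x + t *\<^sub>R axis i 1) - v x - t *\<^sub>R w x) \<le> C * t\<^sup>2"
    and lip: "\<And>x t. x \<in> S \<Longrightarrow> 0 \<le> t \<Longrightarrow> t \<le> t1 \<Longrightarrow> x + t *\<^sub>R axis i 1 \<in> S \<Longrightarrow>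
      norm (w (x + t *\<^sub>R axis i 1) - w x) \<le> C * t"
    and "x \<in> S"
  shows "((\<lambda>t. v (x + t *\<^sub>R axis i 1)) has_vector_derivative w x) (line_filter S i x)"
  unfolding line_filter_def has_vector_derivative_def has_derivative_within_alt
proof (intro conjI allI impI)
  show "bounded_linear (\<lambda>t. t *\<^sub>R w x)" by (rule bounded_linear_scaleR_left)
  fix e :: real assume "e > 0"
  define d where "d = min t1 (e / (2 * C + 1))"
  have "d > 0" using \<open>e > 0\<close> assms(1,2) by (simp add: d_def)
  moreover have "norm (v (x + t *\<^sub>R axis i 1) - v x - t *\<^sub>R w x) \<le> e * \<bar>t\<bar>"
    if "x + t *\<^sub>R axis i 1 \<in> S" "\<bar>t\<bar> < d" for t
  proof -
    have "norm (v (x + t *\<^sub>R axis i 1) - v x - t *\<^sub>R w x) \<le> 2 * C * t\<^sup>2"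
    proof (cases "t \<ge> 0")
      case True
      then have "norm (v (x + t *\<^sub>R axis i 1) - v x - t *\<^sub>R w x) \<le> C * t\<^sup>2"
        using that \<open>x \<in> S\<close> by (intro fw) (auto simp: d_def)
      also have "\<dots> \<le> 2 * C * t\<^sup>2" using assms(2) by simp
      finally show ?thesis .
    next
      case False
      \<comment> \<open>The other endpoint, from which \<open>x\<close> is reached by the forward
        increment \<open>- t\<close>.\<close>
      define x' where "x' = x + t *\<^sub>R axis i 1"
      have x: "x = x' + (- t) *\<^sub>R axis i 1" by (simp add: x'_def)
      have "norm (v (x' + (- t) *\<^sub>R axis i 1) - v x' - (- t) *\<^sub>R w x') \<le> C * (- t)\<^sup>2"
        using that \<open>x \<in> S\<close> x False by (intro fw) (auto simp: d_def x'_def[symmetric])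
      then have 1: "norm (v x - v x' + t *\<^sub>R w x') \<le> C * t\<^sup>2"
        unfolding x[symmetric] by simp
      have "norm (w (x' + (- t) *\<^sub>R axis i 1) - w x') \<le> C * (- t)"
        using that \<open>x \<in> S\<close> x False by (intro lip) (auto simp: d_def x'_def[symmetric])
      then have "\<bar>t\<bar> * norm (w x - w x') \<le> \<bar>t\<bar> * (C * (- t))"
        unfolding x[symmetric] by (intro mult_left_mono) auto
      also have "\<dots> = C * t\<^sup>2"
        using False by (simp add: power2_eq_square)
      finally have 2: "norm (t *\<^sub>R (w x - w x')) \<le> C * t\<^sup>2" by simp
      have "v x' - v x - t *\<^sub>R w x = - (v x - v x' + t *\<^sub>R w x') - t *\<^sub>R (w x - w x')"
        by (simp add: algebra_simps)
      then have "norm (v x' - v x - t *\<^sub>R w x) \<le> norm (v x - v x' + t *\<^sub>R w x') + norm (t *\<^sub>R (w x - w x'))"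
        by (metis norm_minus_cancel norm_triangle_ineq4)
      then show ?thesis using 1 2 by (simp add: x'_def)
    qed
    also have "\<dots> = (2 * C * \<bar>t\<bar>) * \<bar>t\<bar>" by (simp add: power2_eq_square)
    also have "\<dots> \<le> e * \<bar>t\<bar>"
    proof (rule mult_right_mono)
      have "2 * C * \<bar>t\<bar> \<le> (2 * C + 1) * \<bar>t\<bar>" by (intro mult_right_mono) auto
      also have "\<dots> \<le> e"
        using that(2) assms(2) by (simp add: d_def pos_less_divide_eq mult.commute)
      finally show "2 * C * \<bar>t\<bar> \<le> e" .
    qed simp
    finally show ?thesis .
  qed
  ultimately show "\<exists>d>0. \<forall>y\<in>{t. x + t *\<^sub>R axis i 1 \<in> S}. norm (y - 0) < d \<longrightarrow>
      norm (v (x + y *\<^sub>R axis i 1) - v (x + 0 *\<^sub>R axis i 1) - (y - 0) *\<^sub>R w x) \<le> e * norm (y - 0)"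
    by auto
qed

section \<open>Derivatives along the lines of a box\<close>

lemma line_in_Omega_lim:
  assumes "i \<in> J" "x \<in> Omega_lim J R"
  shows "x + t *\<^sub>R axis i 1 \<in> Omega_lim J R \<longleftrightarrow> - x $ i \<le> t \<and> t \<le> R $ i - x $ i"
  using assms unfolding Omega_lim_def mem_Collect_eq axis_step_nth
  by (auto split: if_splits)

text \<open>A positive side makes the line inside the box a nondegenerate interval. Derivatives
  along the box are then unique, even at its faces, and any derivative that is found determines
  \<open>partial_on\<close>.\<close>

lemma line_filter_not_bot:
  assumes "i \<in> J" "x \<in> Omega_lim J R" "0 < R $ i"
  shows "line_filter (Omega_lim J R) i x \<noteq> bot"
proof -
  have x: "0 \<le> x $ i" "x $ i \<le> R $ i" using assms(2) by (auto simp: Omega_lim_def)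
  have "0 islimpt {- x $ i..R $ i - x $ i}"
  proof (rule connected_imp_perfect)
    show "{- x $ i..R $ i - x $ i} \<noteq> {a}" for a
    proof
      assume eq: "{- x $ i..R $ i - x $ i} = {a}"
      have "- x $ i \<in> {- x $ i..R $ i - x $ i}" "R $ i - x $ i \<in> {- x $ i..R $ i - x $ i}"
        using assms(3) by auto
      then show False unfolding eq using assms(3) by simp
    qed
  qed (use x in auto)
  moreover have "{t. x + t *\<^sub>R axis i 1 \<in> Omega_lim J R} = {- x $ i..R $ i - x $ i}"
    unfolding line_in_Omega_lim[OF assms(1,2)] by auto
  ultimately show ?thesis
    by (simp add: line_filter_def trivial_limit_within)
qed

lemma partial_on_eq:
  assumes "i \<in> J" "x \<in> Omega_lim J R" "0 < R $ i"
    and "((\<lambda>t. u (x + t *\<^sub>R axis i 1)) has_vector_derivative D) (line_filter (Omega_lim J R) i x)"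
  shows "partial_on (Omega_lim J R) i u x = D"
proof -
  have "((\<lambda>t. u (x + t *\<^sub>R axis i 1)) has_vector_derivative partial_on (Omega_lim J R) i u x)
      (line_filter (Omega_lim J R) i x)"
    unfolding partial_on_def vector_derivative_def by (rule someI[of _ D]) (rule assms(4))
  from line_filter_not_bot[OF assms(1-3)] this assms(4) show ?thesis
    unfolding line_filter_def by (rule vector_derivative_unique_within)
qed

lemma compact_Omega_lim:
  fixes J :: "'d::finite set"
  shows "compact (Omega_lim J r)"
proof (subst compact_eq_bounded_closed, intro conjI)
  show "bounded (Omega_lim J r)"
    by (rule bounded_subset[OF bounded_cbox[of 0 r]]) (auto simp: Omega_lim_def mem_box_cart)
  have "Omega_lim J r = (\<Inter>i. {x. 0 \<le> x $ i} \<inter> {x. x $ i \<le> r $ i} \<inter> {x. i \<in> J \<or> x $ i \<in> \<int>})"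
    by (auto simp: Omega_lim_def)
  moreover have "closed {x::real ^ 'd. i \<in> J \<or> x $ i \<in> \<int>}" for i
  proof (cases "i \<in> J")
    case False
    have "closed ((\<lambda>x::real ^ 'd. x $ i) -` \<int>)"
      by (intro closed_vimage closed_Ints continuous_intros)
    then show ?thesis using False by (simp add: vimage_def)
  qed simp
  ultimately show "closed (Omega_lim J r)"
    by (auto intro!: closed_INT closed_Int closed_halfspace_component_le_cart closed_halfspace_component_ge_cart)
qed

section \<open>Convergence at the base points\<close>

lemma norm_vec_le:
  fixes v :: "'v::real_normed_vector ^ 'k::finite" and B :: real
  assumes "\<And>k. norm (v $ k) \<le> B"
  shows "norm v \<le> CARD('k) * B"
proof -
  have "norm v \<le> (\<Sum>k\<in>UNIV. norm (v $ k))"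
    unfolding norm_vec_def by (rule L2_set_le_sum) simp
  also have "\<dots> \<le> (\<Sum>k\<in>(UNIV :: 'k set). B)"
    by (rule sum_mono) (rule assms)
  finally show ?thesis by simp
qed

section \<open>The dyadic scales\<close>

lemma scales_pos: "\<epsilon> \<in> scales \<epsilon>0 \<Longrightarrow> 0 < \<epsilon>"
  and scales_le_half: "\<epsilon> \<in> scales \<epsilon>0 \<Longrightarrow> \<epsilon> \<le> 1/2"
proof -
  assume "\<epsilon> \<in> scales \<epsilon>0"
  then obtain j where j: "1 \<le> j" "\<epsilon> = (1/2)^j" unfolding scales_def by blast
  then show "0 < \<epsilon>" by simp
  have "(1/2)^j \<le> (1/2 :: real)^1" using j(1) by (intro power_decreasing) auto
  then show "\<epsilon> \<le> 1/2" using j(2) by simp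
qed

lemma scales_half: "\<epsilon> \<in> scales \<epsilon>0 \<Longrightarrow> \<epsilon> / 2 \<in> scales \<epsilon>0"
proof -
  assume *: "\<epsilon> \<in> scales \<epsilon>0"
  then obtain j where j: "\<epsilon> \<le> \<epsilon>0" "\<epsilon> = (1/2)^j" unfolding scales_def by blast
  have "\<epsilon> / 2 \<le> \<epsilon>0" using scales_pos[OF *] j(1) by simp
  then show "\<epsilon> / 2 \<in> scales \<epsilon>0"
    unfolding scales_def using j(2) by (auto intro!: exI[of _ "Suc j"])
qed

lemma eventually_scales:
  assumes "0 < \<epsilon>0" "0 < \<eta>"
  shows "\<exists>n0. \<forall>n\<ge>n0. (1/2::real)^n \<in> scales \<epsilon>0 \<and> (1/2::real)^n < \<eta>"
proof -
  have "(\<lambda>n. (1/2::real)^n) \<longlonglongrightarrow> 0" by (rule LIMSEQ_realpow_zero) auto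
  then obtain N where N: "\<And>n. n \<ge> N \<Longrightarrow> (1/2::real)^n < min \<epsilon>0 \<eta>"
    using order_tendstoD(2)[of _ "0::real" sequentially "min \<epsilon>0 \<eta>"] assms
    unfolding eventually_sequentially by auto
  show ?thesis
    using N by (intro exI[of _ "max N 1"]) (auto simp: scales_def intro: less_imp_le)
qed

lemma scales_index:
  assumes "\<epsilon> \<in> scales \<epsilon>0" "\<epsilon> < (1/2)^n0"
  shows "\<exists>n\<ge>n0. \<epsilon> = (1/2)^n"
proof -
  obtain j where j: "\<epsilon> = (1/2)^j" using assms(1) unfolding scales_def by blast
  have "j \<ge> n0"
  proof (rule ccontr)
    assume "\<not> n0 \<le> j"
    then have "(1/2::real)^n0 \<le> (1/2)^j" by (intro power_decreasing) auto
    then show False using assms(2) j by simp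
  qed
  with j show ?thesis by blast
qed

text \<open>Lets an estimate for small scales be extended to all scales by enlarging its
  constant.\<close>

lemma finite_scales_ge:
  assumes "0 < \<eta>"
  shows "finite {\<epsilon> \<in> scales \<epsilon>0. \<eta> \<le> \<epsilon>}"
proof -
  obtain n0 where n0: "(1/2::real)^n0 < \<eta>"
    using real_arch_pow_inv[OF assms, of "1/2"] by auto
  have "{\<epsilon> \<in> scales \<epsilon>0. \<eta> \<le> \<epsilon>} \<subseteq> (\<lambda>n. (1/2)^n) ` {..n0}"
  proof
    fix \<epsilon> assume "\<epsilon> \<in> {\<epsilon> \<in> scales \<epsilon>0. \<eta> \<le> \<epsilon>}"
    then obtain j where j: "\<epsilon> = (1/2)^j" "\<eta> \<le> \<epsilon>" unfolding scales_def by blast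
    have "j \<le> n0"
    proof (rule ccontr)
      assume "\<not> j \<le> n0"
      then have "(1/2::real)^j \<le> (1/2)^n0" by (intro power_decreasing) auto
      then show False using n0 j by linarith
    qed
    then show "\<epsilon> \<in> (\<lambda>n. (1/2)^n) ` {..n0}" using j by blast
  qed
  then show ?thesis by (rule finite_subset) simp
qed

locale goursat_family =
  fixes X :: "'k::finite \<Rightarrow> 'v::real_normed_vector set"
    and E :: "'k \<Rightarrow> 'd::finite set"
    and J :: "'d set"
    and r :: "real ^ 'd"
    and \<epsilon>0 :: real
    and f :: "real \<Rightarrow> 'k \<Rightarrow> 'd \<Rightarrow> 'v ^ 'k \<Rightarrow> 'v"
    and g :: "real \<Rightarrow> 'k \<Rightarrow> real ^ 'd \<Rightarrow> 'v"
    and g0 :: "'k \<Rightarrow> real ^ 'd \<Rightarrow> 'v"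
    and a :: "real \<Rightarrow> real ^ 'd \<Rightarrow> 'v ^ 'k"
  assumes X_subspace: "\<And>k. subspace (X k)"
    and X_complete: "\<And>k. complete (X k)"
    and r_pos: "\<And>i. 0 < r $ i"
    and eps0_pos: "0 < \<epsilon>0"
    and f_range: "\<And>k i. i \<in> E k \<Longrightarrow> f 0 k i ` state_space X \<subseteq> X k"
    and f0_loc_lipschitz: "\<And>k i. i \<in> E k \<Longrightarrow>
          local_lipschitz {0} (state_space X) (\<lambda>\<epsilon>. f \<epsilon> k i)"
    and sol: "\<And>\<epsilon>. \<epsilon> \<in> scales \<epsilon>0 \<Longrightarrow> discrete_goursat_solution X E J \<epsilon> r (f \<epsilon>) (g \<epsilon>) (a \<epsilon>)"
    and f_conv: "\<And>k i Q. i \<in> E k \<Longrightarrow> compact Q \<Longrightarrow> Q \<subseteq> state_space X \<Longrightarrow>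
          \<exists>C. \<forall>\<epsilon>\<in>scales \<epsilon>0. \<forall>b\<in>Q. norm (f \<epsilon> k i b - f 0 k i b) \<le> C * \<epsilon>"
    and g0_range: "\<And>k. g0 k ` goursat_set (Omega_lim J r) (E k) \<subseteq> X k"
    and g0_lipschitz: "\<And>k. \<exists>L. L-lipschitz_on (goursat_set (Omega_lim J r) (E k)) (g0 k)"
    and g_conv: "\<And>k. \<exists>C. \<forall>\<epsilon>\<in>scales \<epsilon>0. \<forall>x\<in>goursat_set (Omega_disc J \<epsilon> r) (E k).
          norm (g \<epsilon> k x - g0 k x) \<le> C * \<epsilon>"
begin

abbreviation "P \<equiv> state_space X"

lemma P_subspace: "subspace P"
  using X_subspace unfolding state_space_def subspace_def by simp

lemma P_complete: "complete P"
  unfolding complete_def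
proof (intro allI impI)
  fix s :: "nat \<Rightarrow> 'v ^ 'k" assume s: "(\<forall>n. s n \<in> P) \<and> Cauchy s"
  have "\<exists>l\<in>X k. (\<lambda>n. s n $ k) \<longlonglongrightarrow> l" for k
  proof -
    have "Cauchy (\<lambda>n. s n $ k)"
      using s by (auto intro: Cauchy_vec_nth)
    moreover have "\<forall>n. s n $ k \<in> X k" using s by (auto simp: state_space_def)
    ultimately show ?thesis
      using X_complete[of k, unfolded complete_def, rule_format, of "\<lambda>n. s n $ k"] by auto
  qed
  then obtain l where l: "\<And>k. l k \<in> X k" "\<And>k. (\<lambda>n. s n $ k) \<longlonglongrightarrow> l k" by metis
  have "s \<longlonglongrightarrow> (\<chi> k. l k)"
    by (rule vec_tendstoI) (simp add: l)
  moreover have "(\<chi> k. l k) \<in> P" using l by (simp add: state_space_def)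
  ultimately show "\<exists>l\<in>P. s \<longlonglongrightarrow> l" by blast
qed

lemma a_in_P: "\<epsilon> \<in> scales \<epsilon>0 \<Longrightarrow> x \<in> Omega_disc J \<epsilon> r \<Longrightarrow> a \<epsilon> x \<in> P"
  using sol unfolding discrete_goursat_solution_def by blast

lemma a_step:
  assumes "\<epsilon> \<in> scales \<epsilon>0" "i \<in> E k" "x \<in> Omega_disc J \<epsilon> r" "x + mesh J \<epsilon> i *\<^sub>R axis i 1 \<in> Omega_disc J \<epsilon> r"
  shows "a \<epsilon> (x + mesh J \<epsilon> i *\<^sub>R axis i 1) $ k = a \<epsilon> x $ k + mesh J \<epsilon> i *\<^sub>R f \<epsilon> k i (a \<epsilon> x)"
proof -
  have "diff_quot (mesh J \<epsilon> i) i (\<lambda>y. a \<epsilon> y $ k) x = f \<epsilon> k i (a \<epsilon> x)"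
    using sol[OF assms(1)] assms unfolding discrete_goursat_solution_def by blast
  then have "mesh J \<epsilon> i *\<^sub>R diff_quot (mesh J \<epsilon> i) i (\<lambda>y. a \<epsilon> y $ k) x = mesh J \<epsilon> i *\<^sub>R f \<epsilon> k i (a \<epsilon> x)"
    by simp
  then show ?thesis
    using mesh_pos[OF scales_pos[OF assms(1)], of J i] by (simp add: diff_quot_def algebra_simps)
qed

lemma a_data:
  "\<epsilon> \<in> scales \<epsilon>0 \<Longrightarrow> x \<in> goursat_set (Omega_disc J \<epsilon> r) (E k) \<Longrightarrow> a \<epsilon> x $ k = g \<epsilon> k x"
  using sol unfolding discrete_goursat_solution_def by blast

lemma data_constants:
  "\<exists>Cg\<ge>0. \<forall>k. (\<forall>\<epsilon>\<in>scales \<epsilon>0. \<forall>x\<in>goursat_set (Omega_disc J \<epsilon> r) (E k). norm (g \<epsilon> k x - g0 k x) \<le> Cg * \<epsilon>)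
      \<and> Cg-lipschitz_on (goursat_set (Omega_lim J r) (E k)) (g0 k)"
proof -
  \<comment> \<open>The argument \<delta> is a dummy that fits the format of
    \<open>finite_uniform_constants\<close>.\<close>
  define \<Phi> where "\<Phi> k \<delta> C \<longleftrightarrow> (\<forall>\<epsilon>\<in>scales \<epsilon>0. \<forall>x\<in>goursat_set (Omega_disc J \<epsilon> r) (E k).
      norm (g \<epsilon> k x - g0 k x) \<le> C * \<epsilon>) \<and> C-lipschitz_on (goursat_set (Omega_lim J r) (E k)) (g0 k)"
    for k and \<delta> C :: real
  have "\<exists>\<delta>>0. \<exists>C\<ge>0. \<forall>k\<in>UNIV. \<Phi> k \<delta> C"
  proof (rule finite_uniform_constants, simp, unfold \<Phi>_def, goal_cases)
    case (1 k)
    obtain C L where CL: "\<forall>\<epsilon>\<in>scales \<epsilon>0. \<forall>x\<in>goursat_set (Omega_disc J \<epsilon> r) (E k). norm (g \<epsilon> k x - g0 k x) \<le> C * \<epsilon>"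
      "L-lipschitz_on (goursat_set (Omega_lim J r) (E k)) (g0 k)"
      using g_conv[of k] g0_lipschitz[of k] by blast
    have "norm (g \<epsilon> k x - g0 k x) \<le> max C L * \<epsilon>"
      if "\<epsilon> \<in> scales \<epsilon>0" "x \<in> goursat_set (Omega_disc J \<epsilon> r) (E k)" for \<epsilon> x
      using CL(1) that scales_pos[OF that(1)]
      by (meson max.cobounded1 mult_right_mono less_imp_le order_trans)
    then show ?case
      using lipschitz_on_mono[OF CL(2), of _ "max C L"]
      by (intro exI[of _ 1] conjI exI[of _ "max C L"]) auto
  next
    case (2 k \<delta> C \<delta>' C')
    show ?case
    proof (intro conjI ballI)
      fix \<epsilon> x assume *: "\<epsilon> \<in> scales \<epsilon>0" "x \<in> goursat_set (Omega_disc J \<epsilon> r) (E k)"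
      then have "norm (g \<epsilon> k x - g0 k x) \<le> C * \<epsilon>" using 2(2) by blast
      also have "\<dots> \<le> C' * \<epsilon>" using 2(5) scales_pos[OF *(1)] by (intro mult_right_mono) auto
      finally show "norm (g \<epsilon> k x - g0 k x) \<le> C' * \<epsilon>" .
    qed (use 2 in \<open>blast intro: lipschitz_on_mono\<close>)
  qed
  then obtain C where "C \<ge> 0" "\<forall>k. \<Phi> k 1 C" unfolding \<Phi>_def by blast
  then show ?thesis unfolding \<Phi>_def by blast
qed

text \<open>One constant for three tasks on the ball: size of the limit field, rate of convergence,
  Lipschitz constant of the limit field. For \<epsilon> > 0 the fields are controlled through their
  distance from \<open>f 0\<close> only.\<close>

definition near_const :: "'v ^ 'k \<Rightarrow> real \<Rightarrow> real \<Rightarrow> bool" where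
  "near_const q \<delta> L \<longleftrightarrow> (\<forall>k. \<forall>i\<in>E k. \<forall>b\<in>P. dist b q \<le> \<delta> \<longrightarrow>
     norm (f 0 k i b) \<le> L \<and> (\<forall>\<epsilon>\<in>scales \<epsilon>0. norm (f \<epsilon> k i b - f 0 k i b) \<le> L * \<epsilon>) \<and>
     (\<forall>b'\<in>P. dist b' q \<le> \<delta> \<longrightarrow> norm (f 0 k i b - f 0 k i b') \<le> L * norm (b - b')))"

lemma near_constD:
  assumes "near_const q \<delta> L" "i \<in> E k" "b \<in> P" "dist b q \<le> \<delta>"
  shows "norm (f 0 k i b) \<le> L"
    and "\<epsilon> \<in> scales \<epsilon>0 \<Longrightarrow> norm (f \<epsilon> k i b - f 0 k i b) \<le> L * \<epsilon>"
    and "b' \<in> P \<Longrightarrow> dist b' q \<le> \<delta> \<Longrightarrow> norm (f 0 k i b - f 0 k i b') \<le> L * norm (b - b')"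
  using assms unfolding near_const_def by blast+

lemma near_const_mono:
  assumes "near_const q \<delta> L" "\<delta>' \<le> \<delta>" "L \<le> L'"
  shows "near_const q \<delta>' L'"
  unfolding near_const_def
proof (intro allI ballI impI conjI)
  fix k i b assume *: "i \<in> E k" "b \<in> P" "dist b q \<le> \<delta>'"
  note D = near_constD[OF assms(1) *(1,2) order_trans[OF *(3) assms(2)]]
  show "norm (f 0 k i b) \<le> L'" using D(1) assms(3) by linarith
  show "norm (f \<epsilon> k i b - f 0 k i b) \<le> L' * \<epsilon>" if "\<epsilon> \<in> scales \<epsilon>0" for \<epsilon>
    using D(2)[OF that] mult_right_mono[OF assms(3), of \<epsilon>] scales_pos[OF that] by linarith
  show "norm (f 0 k i b - f 0 k i b') \<le> L' * norm (b - b')" if "b' \<in> P" "dist b' q \<le> \<delta>'" for b'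
    using D(3)[OF that(1) order_trans[OF that(2) assms(2)]] mult_right_mono[OF assms(3), of "norm (b - b')"]
    by simp
qed

text \<open>Local Lipschitz continuity gives the size and the Lipschitz bound. The rate is known on
  compact sets and spreads to a ball by \<open>uniform_near_compact\<close>, applied to the
  one-point set of \<open>q\<close>.\<close>

lemma near_const_exists:
  assumes "q \<in> P"
  shows "\<exists>\<delta>>0. \<exists>L\<ge>0. near_const q \<delta> L"
proof -
  have ex: "\<exists>\<delta>>0. \<exists>L. \<forall>b\<in>P. dist b q \<le> \<delta> \<longrightarrow>
     norm (f 0 k i b) \<le> L \<and> (\<forall>\<epsilon>\<in>scales \<epsilon>0. norm (f \<epsilon> k i b - f 0 k i b) \<le> L * \<epsilon>) \<and>
     (\<forall>b'\<in>P. dist b' q \<le> \<delta> \<longrightarrow> norm (f 0 k i b - f 0 k i b') \<le> L * norm (b - b'))"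
    if i: "i \<in> E k" for k i
  proof -
    obtain u L where u: "u > 0" "L-lipschitz_on (cball q u \<inter> P) (f 0 k i)"
      using f0_loc_lipschitz[OF i] assms unfolding local_lipschitz_def by force
    have L: "L \<ge> 0" using u(2) by (rule lipschitz_on_nonneg)
    \<comment> \<open>Failure at \<open>b\<close> of the rate with constant \<open>n\<close> for
      some scale; a compact set with rate constant \<open>C\<close> excludes it from the integer
      above \<open>C\<close> on.\<close>
    define R where "R n b \<longleftrightarrow> (\<exists>\<epsilon>\<in>scales \<epsilon>0. norm (f \<epsilon> k i b - f 0 k i b) > real n * \<epsilon>)" for n b
    have "\<exists>\<delta>>0. \<exists>n. \<forall>q\<in>{q}. \<forall>b\<in>P. dist b q < \<delta> \<longrightarrow> \<not> R n b"
    proof (rule uniform_near_compact)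
      fix Q assume "compact Q" "Q \<subseteq> P"
      then obtain C where C: "\<forall>\<epsilon>\<in>scales \<epsilon>0. \<forall>b\<in>Q. norm (f \<epsilon> k i b - f 0 k i b) \<le> C * \<epsilon>"
        using f_conv[OF i] by blast
      have "\<not> R (nat \<lceil>C\<rceil>) b" if "b \<in> Q" for b
      proof -
        have "norm (f \<epsilon> k i b - f 0 k i b) \<le> real (nat \<lceil>C\<rceil>) * \<epsilon>" if "\<epsilon> \<in> scales \<epsilon>0" for \<epsilon>
        proof -
          have "norm (f \<epsilon> k i b - f 0 k i b) \<le> C * \<epsilon>" using C that \<open>b \<in> Q\<close> by blast
          also have "\<dots> \<le> real (nat \<lceil>C\<rceil>) * \<epsilon>"
            using scales_pos[OF that] real_nat_ceiling_ge[of C] by (intro mult_right_mono) auto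
          finally show ?thesis .
        qed
        then show ?thesis unfolding R_def by (auto simp: not_less)
      qed
      then show "\<exists>n. \<forall>b\<in>Q. \<not> R n b" by blast
    next
      fix m n b assume "R n b" "m \<le> n"
      then show "R m b"
        unfolding R_def using scales_pos
        by (meson le_less_trans less_imp_le mult_right_mono of_nat_le_iff)
    qed (use assms in auto)
    then obtain \<delta> n where \<delta>: "\<delta> > 0" "\<And>b. b \<in> P \<Longrightarrow> dist b q < \<delta> \<Longrightarrow> \<not> R n b" by auto
    \<comment> \<open>Half of \<delta>, because the exclusion holds on an open ball and a closed one
      is wanted.\<close>
    define \<delta>' where "\<delta>' = min u (\<delta> / 2)"
    define L' where "L' = max (norm (f 0 k i q) + L * u) (max n L)"
    have "\<delta>' > 0" using u \<delta> by (simp add: \<delta>'_def)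
    moreover have "norm (f 0 k i b) \<le> L'" "\<And>\<epsilon>. \<epsilon> \<in> scales \<epsilon>0 \<Longrightarrow> norm (f \<epsilon> k i b - f 0 k i b) \<le> L' * \<epsilon>"
      "\<And>b'. b' \<in> P \<Longrightarrow> dist b' q \<le> \<delta>' \<Longrightarrow> norm (f 0 k i b - f 0 k i b') \<le> L' * norm (b - b')"
      if b: "b \<in> P" "dist b q \<le> \<delta>'" for b
    proof -
      have lip: "norm (f 0 k i b - f 0 k i b') \<le> L * norm (b - b')" if "b' \<in> P" "dist b' q \<le> \<delta>'" for b'
        using lipschitz_onD[OF u(2), of b b'] b that by (simp add: \<delta>'_def dist_norm norm_minus_commute)
      have "norm (f 0 k i b - f 0 k i q) \<le> L * norm (b - q)"
        using assms \<open>\<delta>' > 0\<close> by (intro lip) auto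
      also have "\<dots> \<le> L * u"
        using b(2) L by (intro mult_left_mono) (auto simp: \<delta>'_def dist_norm)
      finally have "norm (f 0 k i b) \<le> norm (f 0 k i q) + L * u"
        using norm_triangle_sub[of "f 0 k i b" "f 0 k i q"] by linarith
      then show "norm (f 0 k i b) \<le> L'" by (simp add: L'_def)
      show "norm (f \<epsilon> k i b - f 0 k i b) \<le> L' * \<epsilon>" if "\<epsilon> \<in> scales \<epsilon>0" for \<epsilon>
      proof -
        have "dist b q < \<delta>" using b(2) \<open>\<delta> > 0\<close> by (simp add: \<delta>'_def)
        then have "norm (f \<epsilon> k i b - f 0 k i b) \<le> n * \<epsilon>"
          using \<delta>(2)[OF b(1)] that unfolding R_def by (auto simp: not_less)
        also have "\<dots> \<le> L' * \<epsilon>"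
          using scales_pos[OF that] by (intro mult_right_mono) (auto simp: L'_def)
        finally show ?thesis .
      qed
      show "norm (f 0 k i b - f 0 k i b') \<le> L' * norm (b - b')" if "b' \<in> P" "dist b' q \<le> \<delta>'" for b'
      proof -
        have "L * norm (b - b') \<le> L' * norm (b - b')"
          by (rule mult_right_mono) (auto simp: L'_def)
        with lip[OF that] show ?thesis by (rule order_trans)
      qed
    qed
    ultimately show ?thesis by blast
  qed
  define \<Phi> where "\<Phi> = (\<lambda>(k, i) \<delta> L. \<forall>b\<in>P. dist b q \<le> \<delta> \<longrightarrow>
     norm (f 0 k i b) \<le> L \<and> (\<forall>\<epsilon>\<in>scales \<epsilon>0. norm (f \<epsilon> k i b - f 0 k i b) \<le> L * \<epsilon>) \<and>
     (\<forall>b'\<in>P. dist b' q \<le> \<delta> \<longrightarrow> norm (f 0 k i b - f 0 k i b') \<le> L * norm (b - b')))"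
  have "\<exists>\<delta>>0. \<exists>L\<ge>0. \<forall>z\<in>{(k, i). i \<in> E k}. \<Phi> z \<delta> L"
  proof (rule finite_uniform_constants)
    show "\<exists>\<delta>>0. \<exists>L. \<Phi> z \<delta> L" if "z \<in> {(k, i). i \<in> E k}" for z
      using that ex unfolding \<Phi>_def by (cases z) simp
    fix z \<delta> L \<delta>' L'
    assume z: "z \<in> {(k, i). i \<in> E k}" and *: "\<Phi> z \<delta> L" "\<delta>' \<le> \<delta>" "L \<le> (L' :: real)"
    obtain k i where zk: "z = (k, i)" "i \<in> E k" using z by auto
    have m: "x \<le> L * y \<Longrightarrow> 0 \<le> y \<Longrightarrow> x \<le> L' * y" for x y
      using mult_right_mono[OF *(3), of y] by linarith
    show "\<Phi> z \<delta>' L'"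
      unfolding zk \<Phi>_def prod.case
    proof (intro ballI impI conjI)
      fix b assume b: "b \<in> P" "dist b q \<le> \<delta>'"
      note D = *(1)[unfolded zk \<Phi>_def prod.case, rule_format, OF b(1) order_trans[OF b(2) *(2)]]
      show "norm (f 0 k i b) \<le> L'" using D *(3) by linarith
      show "norm (f \<epsilon> k i b - f 0 k i b) \<le> L' * \<epsilon>" if "\<epsilon> \<in> scales \<epsilon>0" for \<epsilon>
        using D that scales_pos[OF that] by (intro m) auto
      show "norm (f 0 k i b - f 0 k i b') \<le> L' * norm (b - b')" if "b' \<in> P" "dist b' q \<le> \<delta>'" for b'
        using D that *(2) by (intro m) auto
    qed
  qed simp
  then obtain \<delta> L where "\<delta> > 0" "L \<ge> 0" and *: "\<forall>z\<in>{(k, i). i \<in> E k}. \<Phi> z \<delta> L"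
    by (elim exE conjE)
  have \<Phi>: "\<Phi> (k, i) \<delta> L" if "i \<in> E k" for k i
    by (rule bspec[OF *]) (use that in simp)
  have "near_const q \<delta> L"
    unfolding near_const_def
    by (intro allI ballI) (rule bspec[OF \<Phi>[unfolded \<Phi>_def prod.case]])
  with \<open>\<delta> > 0\<close> \<open>L \<ge> 0\<close> show ?thesis
    by (intro exI[of _ \<delta>] conjI exI[of _ L])
qed

text \<open>The mesh 1 is arbitrary: with vanishing coordinates in \<open>J\<close>, the same
  finitely many points belong to every grid.\<close>

definition "base = Omega_disc J 1 (set_coords J r 0)"

lemma finite_base: "finite base"
  unfolding base_def by (rule finite_Omega_disc) simp

lemma base_nth_zero: "z \<in> base \<Longrightarrow> i \<in> J \<Longrightarrow> z $ i = 0"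
  using Omega_disc_nonneg[of z J 1 "set_coords J r 0" i] Omega_disc_le[of z J 1 "set_coords J r 0" i]
  by (simp add: base_def set_coords_def)

lemma base_in_disc:
  assumes "z \<in> base" "\<And>i. set_coords J r 0 $ i \<le> R $ i"
  shows "z \<in> Omega_disc J \<epsilon> R"
  unfolding Omega_disc_def mem_Collect_eq
proof
  fix i
  obtain m :: int where "z $ i = mesh J 1 i * of_int m"
    using assms(1) unfolding base_def Omega_disc_def by blast
  then have "\<exists>m::int. z $ i = mesh J \<epsilon> i * of_int m"
    using base_nth_zero[OF assms(1), of i] by (cases "i \<in> J") (auto simp: mesh_def)
  then show "0 \<le> z $ i \<and> z $ i \<le> R $ i \<and> (\<exists>m::int. z $ i = mesh J \<epsilon> i * of_int m)"
    using assms unfolding base_def by (auto intro: Omega_disc_nonneg order_trans[OF Omega_disc_le])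
qed

lemma base_in_disc_r: "z \<in> base \<Longrightarrow> z \<in> Omega_disc J \<epsilon> r"
  using r_pos by (intro base_in_disc) (auto simp: set_coords_def less_imp_le)

lemma set_coords_in_base:
  assumes "x \<in> Omega_lim J R" "\<And>i. R $ i \<le> r $ i"
  shows "set_coords J x 0 \<in> base"
  unfolding base_def Omega_disc_def mem_Collect_eq
proof
  fix i
  show "0 \<le> set_coords J x 0 $ i \<and> set_coords J x 0 $ i \<le> set_coords J r 0 $ i \<and>
      (\<exists>m::int. set_coords J x 0 $ i = mesh J 1 i * of_int m)"
    using assms(1) order_trans[OF _ assms(2)[of i], of "x $ i"] unfolding Omega_lim_def
    by (auto simp: set_coords_def mesh_def Ints_def)
qed

lemma goursat_set_cases:
  assumes "\<epsilon> \<in> scales \<epsilon>0" "x \<in> Omega_disc J \<epsilon> R" "x \<notin> goursat_set (Omega_disc J \<epsilon> R) (E k)"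
  obtains j w where "j \<in> E k" "0 < x $ j" "w = x - mesh J \<epsilon> j *\<^sub>R axis j 1" "w \<in> Omega_disc J \<epsilon> R"
    "x = w + mesh J \<epsilon> j *\<^sub>R axis j 1" "coord_sum w = coord_sum x - mesh J \<epsilon> j"
proof -
  obtain j where j: "j \<in> E k" "x $ j \<noteq> 0"
    using assms(2,3) unfolding goursat_set_def by blast
  then have xj: "0 < x $ j" using Omega_disc_nonneg[OF assms(2), of j] by linarith
  show thesis
    by (rule that[OF j(1) xj refl Omega_disc_back[OF scales_pos[OF assms(1)] assms(2) xj] _ coord_sum_diff_axis])
      simp
qed

text \<open>A base point is reached from the data by finitely many unit steps whose number does not
  depend on \<epsilon>. Along them the error is propagated by \<open>f 0\<close>, which is Lipschitz
  near the limit state \<open>q\<close> of the previous point, so an error of order \<epsilon>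
  remains one.\<close>

lemma base_limit:
  assumes "z \<in> base"
  shows "\<exists>q\<in>P. \<exists>C\<ge>0. \<exists>\<eta>>0. \<forall>\<epsilon>\<in>scales \<epsilon>0. \<epsilon> < \<eta> \<longrightarrow> norm (a \<epsilon> z - q) \<le> C * \<epsilon>"
proof (rule finite_measure_induct[where m = coord_sum, OF finite_base _ assms], goal_cases)
  case (1 z)
  note z = 1(1) and IH = 1(2)
  obtain Cg where Cg: "Cg \<ge> 0" "\<And>k \<epsilon> x. \<epsilon> \<in> scales \<epsilon>0 \<Longrightarrow> x \<in> goursat_set (Omega_disc J \<epsilon> r) (E k) \<Longrightarrow>
      norm (g \<epsilon> k x - g0 k x) \<le> Cg * \<epsilon>"
    using data_constants by blast
  have comp: "\<exists>q\<in>X k. \<exists>\<eta>>0. \<exists>C. \<forall>\<epsilon>\<in>scales \<epsilon>0. \<epsilon> < \<eta> \<longrightarrow> norm (a \<epsilon> z $ k - q) \<le> C * \<epsilon>" for k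
  proof (cases "\<forall>i\<in>E k. z $ i = 0")
    case True
    have G: "z \<in> goursat_set (Omega_disc J \<epsilon> r) (E k)" for \<epsilon>
      using True base_in_disc_r[OF z] by (simp add: goursat_set_def)
    have "g0 k z \<in> X k"
      using g0_range[of k] G[of 1] Omega_disc_subset_lim[of J 1 r] by (auto simp: goursat_set_def)
    moreover have "norm (a \<epsilon> z $ k - g0 k z) \<le> Cg * \<epsilon>" if "\<epsilon> \<in> scales \<epsilon>0" for \<epsilon>
      using Cg(2)[OF that G] a_data[OF that G] by simp
    ultimately show ?thesis
      by (intro bexI[of _ "g0 k z"] exI[of _ 1] conjI exI[of _ Cg]) auto
  next
    case False
    then obtain i where i: "i \<in> E k" "z $ i \<noteq> 0" by blast
    \<comment> \<open>Hence the mesh in direction \<open>i\<close> is 1 at all scales.\<close>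
    then have iJ: "i \<notin> J" using base_nth_zero[OF z] by blast
    have zi: "0 < z $ i"
      using Omega_disc_nonneg[OF base_in_disc_r[OF z], of i] i(2) by linarith
    define w where "w = z - axis i 1"
    have w: "w \<in> base"
      using Omega_disc_back[of 1 z J "set_coords J r 0" i] z zi iJ
      by (simp add: base_def mesh_def w_def)
    have "coord_sum w < coord_sum z" using coord_sum_diff_axis[of z 1 i] by (simp add: w_def)
    then obtain q C \<eta> where q: "q \<in> P" "C \<ge> 0" "\<eta> > 0"
      "\<And>\<epsilon>. \<epsilon> \<in> scales \<epsilon>0 \<Longrightarrow> \<epsilon> < \<eta> \<Longrightarrow> norm (a \<epsilon> w - q) \<le> C * \<epsilon>"
      using IH[OF w] by blast
    obtain \<delta> L where \<delta>: "\<delta> > 0" "L \<ge> 0" "near_const q \<delta> L"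
      using near_const_exists[OF q(1)] by blast
    \<comment> \<open>Ensures \<open>C * \<epsilon> \<le> \<delta>\<close>, so that
      \<open>a \<epsilon> w\<close> lies in the ball where the constant \<open>L\<close> is
      valid.\<close>
    define \<eta>' where "\<eta>' = min \<eta> (\<delta> / (C + 1))"
    have "\<eta>' > 0" using q(2,3) \<delta>(1) by (simp add: \<eta>'_def)
    have "q $ k + f 0 k i q \<in> X k"
      using q(1) f_range[OF i(1)] X_subspace[of k] by (auto simp: state_space_def intro!: subspace_add)
    moreover have "norm (a \<epsilon> z $ k - (q $ k + f 0 k i q)) \<le> (C + L + L * C) * \<epsilon>"
      if \<epsilon>: "\<epsilon> \<in> scales \<epsilon>0" "\<epsilon> < \<eta>'" for \<epsilon>
    proof -
      have ew: "norm (a \<epsilon> w - q) \<le> C * \<epsilon>" using q(4) \<epsilon> by (simp add: \<eta>'_def)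
      also have "\<dots> \<le> \<delta>"
      proof -
        have "C * \<epsilon> \<le> (C + 1) * \<epsilon>" using scales_pos[OF \<epsilon>(1)] by simp
        also have "\<dots> \<le> \<delta>" using \<epsilon>(2) q(2) by (simp add: \<eta>'_def pos_less_divide_eq mult.commute)
        finally show ?thesis .
      qed
      finally have d: "dist (a \<epsilon> w) q \<le> \<delta>" by (simp add: dist_norm)
      have aw: "a \<epsilon> w \<in> P" using a_in_P[OF \<epsilon>(1) base_in_disc_r[OF w]] .
      have zw: "z = w + mesh J \<epsilon> i *\<^sub>R axis i 1" using iJ by (simp add: w_def mesh_def)
      have "a \<epsilon> z $ k = a \<epsilon> w $ k + f \<epsilon> k i (a \<epsilon> w)"
        using a_step[OF \<epsilon>(1) i(1) base_in_disc_r[OF w]] base_in_disc_r[OF z, of \<epsilon>] iJ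
        unfolding zw by (simp add: mesh_def)
      \<comment> \<open>Inherited error, error of the field at the discrete state, and change of the
        limit field between the two states.\<close>
      then have "a \<epsilon> z $ k - (q $ k + f 0 k i q) = (a \<epsilon> w - q) $ k
          + (f \<epsilon> k i (a \<epsilon> w) - f 0 k i (a \<epsilon> w)) + (f 0 k i (a \<epsilon> w) - f 0 k i q)"
        by (simp add: algebra_simps)
      also have "norm \<dots> \<le> norm ((a \<epsilon> w - q) $ k) + norm (f \<epsilon> k i (a \<epsilon> w) - f 0 k i (a \<epsilon> w))
          + norm (f 0 k i (a \<epsilon> w) - f 0 k i q)"
        by (intro norm_triangle_le add_mono order_refl norm_triangle_ineq)
      also have "\<dots> \<le> C * \<epsilon> + L * \<epsilon> + L * (C * \<epsilon>)"
      proof (intro add_mono)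
        show "norm ((a \<epsilon> w - q) $ k) \<le> C * \<epsilon>" using Finite_Cartesian_Product.norm_nth_le ew by (rule order_trans)
        show "norm (f \<epsilon> k i (a \<epsilon> w) - f 0 k i (a \<epsilon> w)) \<le> L * \<epsilon>"
          using near_constD(2)[OF \<delta>(3) i(1) aw d \<epsilon>(1)] .
        have "norm (f 0 k i (a \<epsilon> w) - f 0 k i q) \<le> L * norm (a \<epsilon> w - q)"
          using near_constD(3)[OF \<delta>(3) i(1) aw d q(1)] \<delta>(1) by simp
        also have "\<dots> \<le> L * (C * \<epsilon>)" using ew \<delta>(2) by (rule mult_left_mono)
        finally show "norm (f 0 k i (a \<epsilon> w) - f 0 k i q) \<le> L * (C * \<epsilon>)" .
      qed
      finally show ?thesis by (simp add: algebra_simps)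
    qed
    ultimately show ?thesis using \<open>\<eta>' > 0\<close> by blast
  qed
  then obtain q where q: "\<And>k. q k \<in> X k"
    "\<And>k. \<exists>\<eta>>0. \<exists>C. \<forall>\<epsilon>\<in>scales \<epsilon>0. \<epsilon> < \<eta> \<longrightarrow> norm (a \<epsilon> z $ k - q k) \<le> C * \<epsilon>"
    by metis
  have "\<exists>\<eta>>0. \<exists>C\<ge>0. \<forall>k\<in>UNIV. \<forall>\<epsilon>\<in>scales \<epsilon>0. \<epsilon> < \<eta> \<longrightarrow> norm (a \<epsilon> z $ k - q k) \<le> C * \<epsilon>"
  proof (rule finite_uniform_constants[where \<Phi> = "\<lambda>k \<eta> C. \<forall>\<epsilon>\<in>scales \<epsilon>0. \<epsilon> < \<eta> \<longrightarrow> norm (a \<epsilon> z $ k - q k) \<le> C * \<epsilon>"],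
      simp, rule q(2), intro ballI impI)
    fix k \<eta> C \<eta>' C' \<epsilon>
    assume "\<forall>\<epsilon>\<in>scales \<epsilon>0. \<epsilon> < \<eta> \<longrightarrow> norm (a \<epsilon> z $ k - q k) \<le> C * \<epsilon>" "\<eta>' \<le> \<eta>" "C \<le> (C' :: real)"
      and \<epsilon>: "\<epsilon> \<in> scales \<epsilon>0" "\<epsilon> < \<eta>'"
    then have "norm (a \<epsilon> z $ k - q k) \<le> C * \<epsilon>" by simp
    also have "\<dots> \<le> C' * \<epsilon>"
      using \<open>C \<le> C'\<close> scales_pos[OF \<epsilon>(1)] by (intro mult_right_mono) auto
    finally show "norm (a \<epsilon> z $ k - q k) \<le> C' * \<epsilon>" .
  qed
  then obtain \<eta> C where C: "\<eta> > 0" "C \<ge> 0"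
    "\<And>k \<epsilon>. \<epsilon> \<in> scales \<epsilon>0 \<Longrightarrow> \<epsilon> < \<eta> \<Longrightarrow> norm (a \<epsilon> z $ k - q k) \<le> C * \<epsilon>" by blast
  have "norm (a \<epsilon> z - (\<chi> k. q k)) \<le> (CARD('k) * C) * \<epsilon>" if "\<epsilon> \<in> scales \<epsilon>0" "\<epsilon> < \<eta>" for \<epsilon>
    using norm_vec_le[of "a \<epsilon> z - (\<chi> k. q k)" "C * \<epsilon>"] C(3)[OF that] by simp
  moreover have "(\<chi> k. q k) \<in> P" using q(1) by (simp add: state_space_def)
  ultimately show ?case using C(1,2)
    by (intro bexI[of _ "\<chi> k. q k"] exI[of _ "CARD('k) * C"] conjI exI[of _ \<eta>]) auto
qed

section \<open>A uniform region of existence\<close>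

text \<open>Passing through \<open>f 0\<close> at both states gives Lipschitz continuity up to
  errors of the order of the two scales, even between fields of different scales.\<close>

lemma near_diff:
  assumes "near_const q \<delta> L" "i \<in> E k" "b \<in> P" "dist b q \<le> \<delta>" "b' \<in> P" "dist b' q \<le> \<delta>"
    "\<epsilon> \<in> scales \<epsilon>0" "\<epsilon>' \<in> scales \<epsilon>0"
  shows "norm (f \<epsilon> k i b - f \<epsilon>' k i b') \<le> L * norm (b - b') + L * \<epsilon> + L * \<epsilon>'"
proof -
  have "f \<epsilon> k i b - f \<epsilon>' k i b' = (f 0 k i b - f 0 k i b') + (f \<epsilon> k i b - f 0 k i b) - (f \<epsilon>' k i b' - f 0 k i b')"
    by simp
  also have "norm \<dots> \<le> norm (f 0 k i b - f 0 k i b') + norm (f \<epsilon> k i b - f 0 k i b) + norm (f \<epsilon>' k i b' - f 0 k i b')"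
    by (intro norm_triangle_le_diff add_mono order_refl norm_triangle_ineq)
  also have "\<dots> \<le> L * norm (b - b') + L * \<epsilon> + L * \<epsilon>'"
    by (intro add_mono near_constD[OF assms(1,2)] assms)
  finally show ?thesis .
qed

lemma near_bound:
  assumes "near_const q \<delta> L" "i \<in> E k" "b \<in> P" "dist b q \<le> \<delta>" "\<epsilon> \<in> scales \<epsilon>0" "0 \<le> L"
  shows "norm (f \<epsilon> k i b) \<le> 2 * L"
proof -
  have "norm (f \<epsilon> k i b) \<le> norm (f 0 k i b) + norm (f \<epsilon> k i b - f 0 k i b)"
    by (rule norm_triangle_sub)
  also have "\<dots> \<le> L + L * \<epsilon>"
    using near_constD[OF assms(1-4)] assms(5) by (intro add_mono) auto
  also have "\<dots> \<le> L + L * 1"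
    using scales_le_half[OF assms(5)] assms(6) by (intro add_mono mult_left_mono) auto
  finally show ?thesis by simp
qed

lemma mesh_le_1: "\<epsilon> \<in> scales \<epsilon>0 \<Longrightarrow> \<epsilon> \<le> mesh J \<epsilon> j"
  using scales_le_half[of \<epsilon> \<epsilon>0] by (auto simp: mesh_def)

text \<open>The set \<open>S\<close> is closed under steps back, which leaves room for quantities
  that also evaluate the solution at translated points. The alternative
  \<open>u \<le> \<alpha>\<close> serves components that the equations bound directly. The exponent
  refers to \<open>r\<close> rather than \<open>R\<close>, so the constant survives a later choice
  of a smaller box.\<close>

lemma grid_gronwall:
  fixes u :: "'k \<Rightarrow> real ^ 'd \<Rightarrow> real"
  assumes \<epsilon>: "\<epsilon> \<in> scales \<epsilon>0" and S: "S \<subseteq> Omega_disc J \<epsilon> R" and R: "\<And>i. R $ i \<le> r $ i"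
    and nn: "0 \<le> \<alpha>" "0 \<le> \<beta>" "0 \<le> L"
    and closed: "\<And>x j. x \<in> S \<Longrightarrow> 0 < x $ j \<Longrightarrow> x - mesh J \<epsilon> j *\<^sub>R axis j 1 \<in> S"
    and data: "\<And>k x. x \<in> S \<Longrightarrow> x \<in> goursat_set (Omega_disc J \<epsilon> R) (E k) \<Longrightarrow> u k x \<le> \<alpha>"
    and step: "\<And>k j w B. w \<in> S \<Longrightarrow> w + mesh J \<epsilon> j *\<^sub>R axis j 1 \<in> S \<Longrightarrow> j \<in> E k \<Longrightarrow> 0 \<le> B \<Longrightarrow>
      (\<And>l. u l w \<le> B) \<Longrightarrow> u k (w + mesh J \<epsilon> j *\<^sub>R axis j 1) \<le> \<alpha> \<or>
        u k (w + mesh J \<epsilon> j *\<^sub>R axis j 1) \<le> B + mesh J \<epsilon> j * (L * B + \<beta>)"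
    and x: "x \<in> S"
  shows "u k x \<le> (\<alpha> + \<beta>) * exp ((L + 1) * coord_sum r)"
proof -
  have "u k x \<le> (\<alpha> + \<beta>) * exp ((L + 1) * coord_sum x)"
  proof (rule discrete_gronwall[where m = coord_sum and u = u, OF _ nn _ _ x])
    show "finite S"
      using finite_subset[OF S finite_Omega_disc[OF scales_pos[OF \<epsilon>]]] .
    show "0 \<le> coord_sum y" if "y \<in> S" for y
      using Omega_disc_coord_sum_nonneg S that by blast
    fix k x assume x: "x \<in> S"
    show "u k x \<le> \<alpha> \<or> (\<exists>h>0. \<exists>w\<in>S. coord_sum w = coord_sum x - h \<and>
        (\<forall>B\<ge>0. (\<forall>l. u l w \<le> B) \<longrightarrow> u k x \<le> B + h * (L * B + \<beta>)))"
    proof (cases "x \<in> goursat_set (Omega_disc J \<epsilon> R) (E k) \<or> u k x \<le> \<alpha>")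
      case True
      then show ?thesis using data x by blast
    next
      case False
      then obtain j w where j: "j \<in> E k" "0 < x $ j" "w = x - mesh J \<epsilon> j *\<^sub>R axis j 1"
        "x = w + mesh J \<epsilon> j *\<^sub>R axis j 1" "coord_sum w = coord_sum x - mesh J \<epsilon> j"
        using goursat_set_cases[OF \<epsilon>, of x R k] x S by blast
      have w: "w \<in> S" using closed[OF x j(2)] j(3) by simp
      have "u k x \<le> B + mesh J \<epsilon> j * (L * B + \<beta>)" if "B \<ge> 0" "\<forall>l. u l w \<le> B" for B
        using step[OF w, of j k B] x False that j(1) unfolding j(4)[symmetric] by blast
      then show ?thesis
        using w j(5) mesh_pos[OF scales_pos[OF \<epsilon>], of J j] by blast
    qed
  qed
  also have "\<dots> \<le> (\<alpha> + \<beta>) * exp ((L + 1) * coord_sum r)"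
  proof (rule mult_left_mono)
    have "coord_sum x \<le> coord_sum R" using S x Omega_disc_coord_sum_le by blast
    also have "\<dots> \<le> coord_sum r" unfolding coord_sum_def by (intro sum_mono R)
    finally show "exp ((L + 1) * coord_sum x) \<le> exp ((L + 1) * coord_sum r)"
      using nn by (simp add: mult_left_mono)
  qed (use nn in simp)
  finally show ?thesis .
qed

lemma goursat_set_mono: "S \<subseteq> T \<Longrightarrow> goursat_set S Ek \<subseteq> goursat_set T Ek"
  by (auto simp: goursat_set_def)

text \<open>If \<open>i\<close> is in \<open>E k\<close>, the equation itself bounds the step.
  Otherwise the step is transported from the data set along a direction \<open>j\<close> of
  \<open>E k\<close>, where \<open>f \<epsilon>\<close> is Lipschitz up to an error of order
  \<epsilon>. The level \<open>s\<close> makes the estimate usable inside an induction: nearness is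
  assumed strictly below \<open>s\<close> only.\<close>

lemma step_bound_local:
  fixes L Cg \<delta> s :: real
  assumes \<epsilon>: "\<epsilon> \<in> scales \<epsilon>0" and i: "i \<in> J" and R: "\<And>i. R $ i \<le> r $ i"
    and near: "\<And>z. z \<in> base \<Longrightarrow> near_const (A z) \<delta> L" and L: "0 \<le> L"
    and Cg: "0 \<le> Cg" "\<And>k \<epsilon> x. \<epsilon> \<in> scales \<epsilon>0 \<Longrightarrow> x \<in> goursat_set (Omega_disc J \<epsilon> r) (E k) \<Longrightarrow>
      norm (g \<epsilon> k x - g0 k x) \<le> Cg * \<epsilon>"
      "\<And>k. Cg-lipschitz_on (goursat_set (Omega_lim J r) (E k)) (g0 k)"
    and good: "\<And>y. y \<in> Omega_disc J \<epsilon> R \<Longrightarrow> coord_sum y < s \<Longrightarrow> dist (a \<epsilon> y) (A (set_coords J y 0)) \<le> \<delta>"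
    and y: "y \<in> Omega_disc J \<epsilon> R" "y + \<epsilon> *\<^sub>R axis i 1 \<in> Omega_disc J \<epsilon> R" "coord_sum y + \<epsilon> \<le> s"
  shows "norm (a \<epsilon> (y + \<epsilon> *\<^sub>R axis i 1) - a \<epsilon> y)
    \<le> CARD('k) * ((4 * L + 3 * Cg) * exp ((L * CARD('k) + 1) * coord_sum r)) * \<epsilon>"
proof -
  have \<epsilon>0: "0 < \<epsilon>" using scales_pos[OF \<epsilon>] .
  let ?e = "\<epsilon> *\<^sub>R axis i 1 :: real ^ 'd"
  \<comment> \<open>Points whose step in direction \<open>i\<close> ends at level at most
    \<open>s\<close>. A predecessor lies lower by a positive mesh, so both it and its translate are
    strictly below \<open>s\<close>.\<close>
  define S where "S = {y \<in> Omega_disc J \<epsilon> R. y + ?e \<in> Omega_disc J \<epsilon> R \<and> coord_sum y + \<epsilon> \<le> s}"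
  define u where "u k y = norm (a \<epsilon> (y + ?e) $ k - a \<epsilon> y $ k)" for k y
  have sub: "Omega_disc J \<epsilon> R \<subseteq> Omega_disc J \<epsilon> r" by (rule Omega_disc_mono[OF R])
  have base: "set_coords J y 0 \<in> base" if "y \<in> Omega_disc J \<epsilon> R" for y
    using set_coords_in_base[OF _ R] that Omega_disc_subset_lim by blast
  have mi: "mesh J \<epsilon> i = \<epsilon>" using i by (simp add: mesh_def)
  have E: "u k y \<le> (2 * L + 3 * Cg) * \<epsilon>" if y: "y \<in> S" and k: "i \<in> E k" for y k
  proof -
    have y': "y \<in> Omega_disc J \<epsilon> R" "coord_sum y < s" using y \<epsilon>0 by (auto simp: S_def)
    have "u k y = norm (\<epsilon> *\<^sub>R f \<epsilon> k i (a \<epsilon> y))"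
      using a_step[OF \<epsilon> k, of y] y subsetD[OF sub] unfolding S_def u_def mi by simp
    also have "\<dots> \<le> \<epsilon> * (2 * L)"
      using near_bound[OF near[OF base[OF y'(1)]] k a_in_P[OF \<epsilon>] good[OF y'] \<epsilon> L] y'(1) sub \<epsilon>0
      by (auto intro: mult_left_mono)
    also have "\<dots> \<le> (2 * L + 3 * Cg) * \<epsilon>" using Cg(1) \<epsilon>0 by (simp add: algebra_simps)
    finally show ?thesis .
  qed
  \<comment> \<open>The first \<open>2 * L\<close> is the size of the field, for components with
    \<open>i\<close> in \<open>E k\<close>; the second comes from \<open>near_diff\<close> with the
    same scale twice. The \<open>3 * Cg\<close> collects two data errors and the Lipschitz bound of
    \<open>g0\<close>.\<close>
  have "u k y \<le> ((2 * L + 3 * Cg) * \<epsilon> + (2 * L) * \<epsilon>) * exp ((L * CARD('k) + 1) * coord_sum r)" for k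
  proof (rule grid_gronwall[OF \<epsilon>, where S = S and u = u and R = R])
    show "y \<in> S" using y by (simp add: S_def)
    show "S \<subseteq> Omega_disc J \<epsilon> R" by (auto simp: S_def)
  next
    fix x j assume x: "x \<in> S" "0 < x $ j"
    have eq: "x - mesh J \<epsilon> j *\<^sub>R axis j 1 + ?e = (x + ?e) - mesh J \<epsilon> j *\<^sub>R axis j 1"
      by (simp add: algebra_simps)
    have bk: "(x + ?e) - mesh J \<epsilon> j *\<^sub>R axis j 1 \<in> Omega_disc J \<epsilon> R"
      using x \<epsilon>0 unfolding S_def by (intro Omega_disc_back[OF \<epsilon>0]) (auto simp: axis_def)
    show "x - mesh J \<epsilon> j *\<^sub>R axis j 1 \<in> S"
      unfolding S_def mem_Collect_eq eq
      using bk Omega_disc_back[OF \<epsilon>0, of x J R j] x mesh_pos[OF \<epsilon>0, of J j]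
      by (simp add: S_def coord_sum_diff_axis)
  next
    fix k x assume x: "x \<in> S" and G: "x \<in> goursat_set (Omega_disc J \<epsilon> R) (E k)"
    show "u k x \<le> (2 * L + 3 * Cg) * \<epsilon>"
    proof (cases "i \<in> E k")
      case False
      have G1: "x \<in> goursat_set (Omega_disc J \<epsilon> r) (E k)"
        using G goursat_set_mono[OF sub] by blast
      \<comment> \<open>A step in a direction outside \<open>E k\<close> does not leave the data
        set.\<close>
      have "(x + ?e) $ j = 0" if "j \<in> E k" for j
        using G that False by (auto simp: goursat_set_def axis_def)
      then have G2: "x + ?e \<in> goursat_set (Omega_disc J \<epsilon> r) (E k)"
        using x sub by (auto simp: goursat_set_def S_def)
      have lim: "goursat_set (Omega_disc J \<epsilon> r) (E k) \<subseteq> goursat_set (Omega_lim J r) (E k)"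
        by (intro goursat_set_mono Omega_disc_subset_lim)
      have "u k x = norm ((g \<epsilon> k (x + ?e) - g0 k (x + ?e)) + (g0 k (x + ?e) - g0 k x) - (g \<epsilon> k x - g0 k x))"
        using a_data[OF \<epsilon> G1] a_data[OF \<epsilon> G2] by (simp add: u_def)
      also have "\<dots> \<le> norm (g \<epsilon> k (x + ?e) - g0 k (x + ?e)) + norm (g0 k (x + ?e) - g0 k x) + norm (g \<epsilon> k x - g0 k x)"
        by (intro norm_triangle_le_diff add_mono order_refl norm_triangle_ineq)
      also have "\<dots> \<le> Cg * \<epsilon> + Cg * \<epsilon> + Cg * \<epsilon>"
      proof (intro add_mono Cg(2)[OF \<epsilon>] G1 G2)
        have "norm (g0 k (x + ?e) - g0 k x) \<le> Cg * norm (x + ?e - x)"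
          using lipschitz_on_normD[OF Cg(3)] G1 G2 lim by blast
        then show "norm (g0 k (x + ?e) - g0 k x) \<le> Cg * \<epsilon>"
          using \<epsilon>0 by (simp add: norm_axis_1)
      qed
      also have "\<dots> \<le> (2 * L + 3 * Cg) * \<epsilon>" using L \<epsilon>0 by (simp add: algebra_simps)
      finally show ?thesis .
    qed (use E x in blast)
  next
    fix k j w B
    assume w: "w \<in> S" and x: "w + mesh J \<epsilon> j *\<^sub>R axis j 1 \<in> S" and j: "j \<in> E k" and B: "0 \<le> B" "\<And>l. u l w \<le> B"
    let ?h = "mesh J \<epsilon> j"
    let ?x = "w + ?h *\<^sub>R axis j 1"
    show "u k ?x \<le> (2 * L + 3 * Cg) * \<epsilon> \<or> u k ?x \<le> B + ?h * (L * CARD('k) * B + (2 * L) * \<epsilon>)"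
    proof (cases "i \<in> E k")
      case False
      have hpos: "0 < ?h" by (rule mesh_pos[OF \<epsilon>0])
      have xe: "?x + ?e = (w + ?e) + ?h *\<^sub>R axis j 1" by (simp add: algebra_simps)
      have w': "w \<in> Omega_disc J \<epsilon> R" "w + ?e \<in> Omega_disc J \<epsilon> R" "coord_sum w < s" "coord_sum (w + ?e) < s"
        using w x \<epsilon>0 hpos mesh_le_1[OF \<epsilon>, of j] by (auto simp: S_def coord_sum_add_axis)
      have d: "dist (a \<epsilon> w) (A (set_coords J w 0)) \<le> \<delta>" "dist (a \<epsilon> (w + ?e)) (A (set_coords J w 0)) \<le> \<delta>"
        using good[OF w'(1,3)] good[OF w'(2,4)] set_coords_add_axis[OF i, of w \<epsilon>] by simp_all
      have aP: "a \<epsilon> w \<in> P" "a \<epsilon> (w + ?e) \<in> P" using a_in_P[OF \<epsilon>] w' sub by auto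
      have "norm (a \<epsilon> (w + ?e) - a \<epsilon> w) \<le> CARD('k) * B"
        by (rule norm_vec_le) (use B(2) in \<open>simp add: u_def\<close>)
      then have "L * norm (a \<epsilon> (w + ?e) - a \<epsilon> w) \<le> L * (CARD('k) * B)"
        using L by (rule mult_left_mono)
      then have fd: "norm (f \<epsilon> k j (a \<epsilon> (w + ?e)) - f \<epsilon> k j (a \<epsilon> w)) \<le> L * CARD('k) * B + 2 * L * \<epsilon>"
        using near_diff[OF near[OF base[OF w'(1)]] j aP(2) d(2) aP(1) d(1) \<epsilon> \<epsilon>] by simp
      have 1: "a \<epsilon> ?x $ k = a \<epsilon> w $ k + ?h *\<^sub>R f \<epsilon> k j (a \<epsilon> w)"
        using a_step[OF \<epsilon> j, of w] w x sub unfolding S_def by blast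
      have 2: "a \<epsilon> (?x + ?e) $ k = a \<epsilon> (w + ?e) $ k + ?h *\<^sub>R f \<epsilon> k j (a \<epsilon> (w + ?e))"
      proof -
        have "?x + ?e \<in> Omega_disc J \<epsilon> R"
          using x unfolding S_def by blast
        then have "(w + ?e) + ?h *\<^sub>R axis j 1 \<in> Omega_disc J \<epsilon> R"
          by (simp only: xe)
        then show ?thesis
          unfolding xe using w'(2) subsetD[OF sub] by (intro a_step[OF \<epsilon> j])
      qed
      have "u k ?x = norm ((a \<epsilon> (w + ?e) $ k - a \<epsilon> w $ k) + ?h *\<^sub>R (f \<epsilon> k j (a \<epsilon> (w + ?e)) - f \<epsilon> k j (a \<epsilon> w)))"
        unfolding u_def 1 2 by (simp add: algebra_simps)
      also have "\<dots> \<le> u k w + ?h * norm (f \<epsilon> k j (a \<epsilon> (w + ?e)) - f \<epsilon> k j (a \<epsilon> w))"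
        unfolding u_def using hpos by (intro norm_triangle_le) simp
      also have "\<dots> \<le> B + ?h * (L * CARD('k) * B + 2 * L * \<epsilon>)"
        using B(2) fd hpos by (intro add_mono mult_left_mono) auto
      finally show ?thesis by simp
    qed (use E x in blast)
  qed (use R L Cg \<epsilon>0 in auto)
  then have "norm ((a \<epsilon> (y + ?e) - a \<epsilon> y) $ k) \<le> (4 * L + 3 * Cg) * exp ((L * CARD('k) + 1) * coord_sum r) * \<epsilon>" for k
    by (simp add: u_def algebra_simps)
  then have "norm (a \<epsilon> (y + ?e) - a \<epsilon> y) \<le> CARD('k) * ((4 * L + 3 * Cg) * exp ((L * CARD('k) + 1) * coord_sum r) * \<epsilon>)"
    by (rule norm_vec_le)
  then show ?thesis by (simp add: mult.assoc)
qed

text \<open>Induction over the coordinate sum alternates between two conclusions: nearness at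
  earlier points bounds the step into \<open>x\<close>, and adding this step to the deviation of the
  previous point gives the deviation at \<open>x\<close>. The deviation accumulates at rate
  \<Lambda> from the base point of the slab, so it stays below \<delta> on a short box.\<close>

lemma region_exists:
  "\<exists>\<rho> A \<delta> L \<Lambda> \<eta>. 0 < \<rho> \<and> (\<forall>i\<in>J. 2 * \<rho> \<le> r $ i) \<and> 0 < \<delta> \<and> 0 \<le> L \<and> 0 \<le> \<Lambda> \<and> 0 < \<eta> \<and>
    (\<forall>z\<in>base. near_const (A z) \<delta> L) \<and>
    (\<forall>\<epsilon>\<in>scales \<epsilon>0. \<epsilon> < \<eta> \<longrightarrow> (\<forall>x\<in>Omega_disc J \<epsilon> (set_coords J r (2 * \<rho>)).
       dist (a \<epsilon> x) (A (set_coords J x 0)) \<le> \<delta> \<and>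
       (\<forall>i\<in>J. x + \<epsilon> *\<^sub>R axis i 1 \<in> Omega_disc J \<epsilon> (set_coords J r (2 * \<rho>)) \<longrightarrow>
         norm (a \<epsilon> (x + \<epsilon> *\<^sub>R axis i 1) - a \<epsilon> x) \<le> \<Lambda> * \<epsilon>)))"
proof -
  obtain Cg where Cg: "0 \<le> Cg" "\<And>k \<epsilon> x. \<epsilon> \<in> scales \<epsilon>0 \<Longrightarrow> x \<in> goursat_set (Omega_disc J \<epsilon> r) (E k) \<Longrightarrow>
      norm (g \<epsilon> k x - g0 k x) \<le> Cg * \<epsilon>"
    "\<And>k. Cg-lipschitz_on (goursat_set (Omega_lim J r) (E k)) (g0 k)"
    using data_constants by blast
  have "\<forall>z\<in>base. \<exists>q. q \<in> P \<and> (\<exists>\<eta>>0. \<exists>C. \<forall>\<epsilon>\<in>scales \<epsilon>0. \<epsilon> < \<eta> \<longrightarrow> norm (a \<epsilon> z - q) \<le> C * \<epsilon>)"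
    using base_limit by blast
  then obtain A where A: "\<And>z. z \<in> base \<Longrightarrow> A z \<in> P"
    "\<And>z. z \<in> base \<Longrightarrow> \<exists>\<eta>>0. \<exists>C. \<forall>\<epsilon>\<in>scales \<epsilon>0. \<epsilon> < \<eta> \<longrightarrow> norm (a \<epsilon> z - A z) \<le> C * \<epsilon>"
    by metis
  have "\<exists>\<eta>>0. \<exists>C\<ge>0. \<forall>z\<in>base. \<forall>\<epsilon>\<in>scales \<epsilon>0. \<epsilon> < \<eta> \<longrightarrow> norm (a \<epsilon> z - A z) \<le> C * \<epsilon>"
  proof (rule finite_uniform_constants[where \<Phi> = "\<lambda>z \<eta> C. \<forall>\<epsilon>\<in>scales \<epsilon>0. \<epsilon> < \<eta> \<longrightarrow> norm (a \<epsilon> z - A z) \<le> C * \<epsilon>",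
        OF finite_base A(2)], assumption, intro ballI impI)
    fix z \<eta> C \<eta>' C' \<epsilon>
    assume "\<forall>\<epsilon>\<in>scales \<epsilon>0. \<epsilon> < \<eta> \<longrightarrow> norm (a \<epsilon> z - A z) \<le> C * \<epsilon>" "\<eta>' \<le> \<eta>" "C \<le> (C' :: real)"
      and \<epsilon>: "\<epsilon> \<in> scales \<epsilon>0" "\<epsilon> < \<eta>'"
    then have "norm (a \<epsilon> z - A z) \<le> C * \<epsilon>" by simp
    also have "\<dots> \<le> C' * \<epsilon>"
      using \<open>C \<le> C'\<close> scales_pos[OF \<epsilon>(1)] by (intro mult_right_mono) auto
    finally show "norm (a \<epsilon> z - A z) \<le> C' * \<epsilon>" .
  qed
  then obtain \<eta>1 c where c: "0 < \<eta>1" "0 \<le> c"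
    "\<And>z \<epsilon>. z \<in> base \<Longrightarrow> \<epsilon> \<in> scales \<epsilon>0 \<Longrightarrow> \<epsilon> < \<eta>1 \<Longrightarrow> norm (a \<epsilon> z - A z) \<le> c * \<epsilon>" by blast
  have "\<exists>\<delta>>0. \<exists>L\<ge>0. \<forall>z\<in>base. near_const (A z) \<delta> L"
  proof (rule finite_uniform_constants[OF finite_base])
    show "\<exists>\<delta>>0. \<exists>L. near_const (A z) \<delta> L" if "z \<in> base" for z
      using near_const_exists[OF A(1)[OF that]] by blast
  qed (rule near_const_mono)
  then obtain \<delta> L where \<delta>: "0 < \<delta>" "0 \<le> L" and near: "\<And>z. z \<in> base \<Longrightarrow> near_const (A z) \<delta> L" by blast
  \<comment> \<open>The constant of \<open>step_bound_local\<close>; it involves neither \<rho> nor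
    the smaller box.\<close>
  define \<Lambda> where "\<Lambda> = CARD('k) * ((4 * L + 3 * Cg) * exp ((L * CARD('k) + 1) * coord_sum r))"
  have \<Lambda>: "0 \<le> \<Lambda>" using \<delta> Cg(1) by (simp add: \<Lambda>_def)
  \<comment> \<open>Makes the accumulated steps over a box of side \<open>2 * \<rho>\<close> cost at
    most half of \<delta>; the other half is kept for the error \<open>c * \<epsilon>\<close> at the
    base point. The remaining entries keep the box inside \<open>r\<close>.\<close>
  define \<rho> where "\<rho> = Min (insert (\<delta> / (4 * (\<Lambda> * CARD('d) + 1))) ((\<lambda>i. r $ i / 2) ` J))"
  have \<rho>: "0 < \<rho>" "\<forall>i\<in>J. 2 * \<rho> \<le> r $ i" "\<rho> \<le> \<delta> / (4 * (\<Lambda> * CARD('d) + 1))"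
  proof -
    have "0 < \<delta> / (4 * (\<Lambda> * CARD('d) + 1))" using \<delta>(1) \<Lambda> by (simp add: add_nonneg_pos)
    then show "0 < \<rho>" unfolding \<rho>_def using r_pos by (subst Min_gr_iff) auto
    show "\<rho> \<le> \<delta> / (4 * (\<Lambda> * CARD('d) + 1))" unfolding \<rho>_def by (rule Min_le) auto
    have "\<rho> \<le> r $ i / 2" if "i \<in> J" for i unfolding \<rho>_def by (rule Min_le) (use that in auto)
    then show "\<forall>i\<in>J. 2 * \<rho> \<le> r $ i" by fastforce
  qed
  have small: "\<Lambda> * (CARD('d) * (2 * \<rho>)) \<le> \<delta> / 2"
  proof -
    have pos: "0 < \<Lambda> * CARD('d) + 1" using \<Lambda> by (simp add: add_nonneg_pos)
    have "\<Lambda> * (CARD('d) * (2 * \<rho>)) = 2 * \<rho> * (\<Lambda> * CARD('d))" by simp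
    also have "\<dots> \<le> 2 * \<rho> * (\<Lambda> * CARD('d) + 1)" using \<rho>(1) by (intro mult_left_mono) auto
    also have "\<dots> \<le> \<delta> / 2" using \<rho>(3) pos by (simp add: field_simps)
    finally show ?thesis .
  qed
  define R where "R = set_coords J r (2 * \<rho>)"
  have R: "R $ i \<le> r $ i" for i using \<rho>(2) by (simp add: R_def set_coords_def)
  define \<eta> where "\<eta> = min \<eta>1 (\<delta> / (2 * (c + 1)))"
  have \<eta>: "0 < \<eta>" using c \<delta> by (simp add: \<eta>_def)
  have main: "norm (a \<epsilon> x - A (set_coords J x 0)) \<le> c * \<epsilon> + \<Lambda> * (\<Sum>i\<in>J. x $ i)"
    and dist: "dist (a \<epsilon> x) (A (set_coords J x 0)) \<le> \<delta>"
    if \<epsilon>: "\<epsilon> \<in> scales \<epsilon>0" "\<epsilon> < \<eta>" and x: "x \<in> Omega_disc J \<epsilon> R" for \<epsilon> x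
  proof -
    have \<epsilon>0: "0 < \<epsilon>" using scales_pos[OF \<epsilon>(1)] .
    \<comment> \<open>Converts the quantitative deviation into nearness. It is stated for every grid
      point, as the induction needs it at all earlier ones.\<close>
    have imp: "dist (a \<epsilon> x) (A (set_coords J x 0)) \<le> \<delta>"
      if x: "x \<in> Omega_disc J \<epsilon> R" and *: "norm (a \<epsilon> x - A (set_coords J x 0)) \<le> c * \<epsilon> + \<Lambda> * (\<Sum>i\<in>J. x $ i)" for x
    proof -
      have "(\<Sum>i\<in>J. x $ i) \<le> (\<Sum>i\<in>J. 2 * \<rho>)"
      proof (rule sum_mono)
        fix i assume "i \<in> J"
        then show "x $ i \<le> 2 * \<rho>"
          using Omega_disc_le[OF x, of i] by (simp add: R_def set_coords_def)
      qed
      also have "\<dots> \<le> CARD('d) * (2 * \<rho>)"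
        using \<rho>(1) by (simp add: card_mono)
      finally have "\<Lambda> * (\<Sum>i\<in>J. x $ i) \<le> \<delta> / 2"
        using small mult_left_mono[OF _ \<Lambda>] by fastforce
      moreover have "c * \<epsilon> \<le> \<delta> / 2"
      proof -
        have "c * \<epsilon> \<le> (c + 1) * \<epsilon>" using \<epsilon>0 by simp
        also have "\<dots> \<le> \<delta> / 2" using \<epsilon>(2) c(2) by (simp add: \<eta>_def field_simps)
        finally show ?thesis .
      qed
      ultimately show ?thesis using * by (simp add: dist_norm)
    qed
    show main: "norm (a \<epsilon> x - A (set_coords J x 0)) \<le> c * \<epsilon> + \<Lambda> * (\<Sum>i\<in>J. x $ i)"
    proof (rule finite_measure_induct[where m = coord_sum, OF finite_Omega_disc[OF \<epsilon>0] _ x], goal_cases)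
      case (1 x)
      note x = 1(1) and IH = 1(2)
      show ?case
      proof (cases "\<exists>i\<in>J. 0 < x $ i")
        case False
        have 0: "\<forall>i\<in>J. x $ i = 0"
        proof
          fix i assume "i \<in> J"
          with False have "\<not> 0 < x $ i" by blast
          then show "x $ i = 0" using Omega_disc_nonneg[OF x, of i] by linarith
        qed
        then have "set_coords J x 0 = x" by (auto simp: set_coords_def vec_eq_iff)
        moreover have "x \<in> base"
          using calculation set_coords_in_base[OF subsetD[OF Omega_disc_subset_lim x] R] by simp
        ultimately show ?thesis using c(3)[of x \<epsilon>] \<epsilon> 0 by (simp add: \<eta>_def)
      next
        case True
        then obtain i where i: "i \<in> J" "0 < x $ i" by blast
        define y where "y = x - \<epsilon> *\<^sub>R axis i 1"
        have y: "y \<in> Omega_disc J \<epsilon> R"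
          using Omega_disc_back[OF \<epsilon>0 x i(2)] i(1) by (simp add: y_def mesh_def)
        have xy: "x = y + \<epsilon> *\<^sub>R axis i 1" by (simp add: y_def)
        have ty: "coord_sum y < coord_sum x" "coord_sum y + \<epsilon> \<le> coord_sum x"
          using \<epsilon>0 by (simp_all add: y_def coord_sum_diff_axis)
        have "norm (a \<epsilon> x - a \<epsilon> y) \<le> \<Lambda> * \<epsilon>"
          unfolding xy \<Lambda>_def
          by (rule step_bound_local[OF \<epsilon>(1) i(1) R near \<delta>(2) Cg, where s = "coord_sum x"])
            (use imp IH y x ty xy in auto)
        moreover have "norm (a \<epsilon> y - A (set_coords J x 0)) \<le> c * \<epsilon> + \<Lambda> * (\<Sum>i\<in>J. y $ i)"
          using IH[OF y ty(1)] set_coords_diff_axis[OF i(1), of x \<epsilon>] by (simp add: y_def)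
        moreover have "(\<Sum>i\<in>J. x $ i) = (\<Sum>i\<in>J. y $ i) + \<epsilon>"
          unfolding xy axis_step_nth using i(1) by (simp add: sum.distrib)
        ultimately show ?thesis
          using norm_triangle_ineq[of "a \<epsilon> x - a \<epsilon> y" "a \<epsilon> y - A (set_coords J x 0)"]
          by (simp add: distrib_left)
      qed
    qed
    show "dist (a \<epsilon> x) (A (set_coords J x 0)) \<le> \<delta>" by (rule imp[OF x main])
  qed
  have step: "norm (a \<epsilon> (x + \<epsilon> *\<^sub>R axis i 1) - a \<epsilon> x) \<le> \<Lambda> * \<epsilon>"
    if \<epsilon>: "\<epsilon> \<in> scales \<epsilon>0" "\<epsilon> < \<eta>" and x: "x \<in> Omega_disc J \<epsilon> R" and i: "i \<in> J"
      and x': "x + \<epsilon> *\<^sub>R axis i 1 \<in> Omega_disc J \<epsilon> R" for \<epsilon> x i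
    unfolding \<Lambda>_def
    by (rule step_bound_local[OF \<epsilon>(1) i R near \<delta>(2) Cg _ x x' order_refl]) (use dist[OF \<epsilon>] in auto)
  show ?thesis
    using \<rho>(1,2) \<delta> \<Lambda> \<eta> near dist step unfolding R_def
    by (intro exI[of _ \<rho>] exI[of _ A] exI[of _ \<delta>] exI[of _ L] exI[of _ \<Lambda>] exI[of _ \<eta>]) blast
qed

end

section \<open>The limit function\<close>

text \<open>Names the quantities supplied by \<open>region_exists\<close>, so that the limit
  function can be a global definition instead of an obtained witness.\<close>

locale goursat_region = goursat_family X E J r \<epsilon>0 f g g0 a
  for X :: "'k::finite \<Rightarrow> 'v::real_normed_vector set"
    and E :: "'k \<Rightarrow> 'd::finite set"
    and J :: "'d set"
    and r :: "real ^ 'd"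
    and \<epsilon>0 :: real
    and f :: "real \<Rightarrow> 'k \<Rightarrow> 'd \<Rightarrow> 'v ^ 'k \<Rightarrow> 'v"
    and g :: "real \<Rightarrow> 'k \<Rightarrow> real ^ 'd \<Rightarrow> 'v"
    and g0 :: "'k \<Rightarrow> real ^ 'd \<Rightarrow> 'v"
    and a :: "real \<Rightarrow> real ^ 'd \<Rightarrow> 'v ^ 'k" +
  fixes \<rho> :: real and A :: "real ^ 'd \<Rightarrow> 'v ^ 'k" and \<delta> L \<Lambda> \<eta> :: real
  assumes \<rho>_pos: "0 < \<rho>" and \<rho>_le: "\<And>i. i \<in> J \<Longrightarrow> 2 * \<rho> \<le> r $ i"
    and \<delta>_pos: "0 < \<delta>" and L_nonneg: "0 \<le> L" and \<Lambda>_nonneg: "0 \<le> \<Lambda>" and \<eta>_pos: "0 < \<eta>"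
    and A_near: "\<And>z. z \<in> base \<Longrightarrow> near_const (A z) \<delta> L"
    and a_near: "\<And>\<epsilon> x. \<epsilon> \<in> scales \<epsilon>0 \<Longrightarrow> \<epsilon> < \<eta> \<Longrightarrow> x \<in> Omega_disc J \<epsilon> (set_coords J r (2 * \<rho>)) \<Longrightarrow>
      dist (a \<epsilon> x) (A (set_coords J x 0)) \<le> \<delta>"
    and a_step_bound: "\<And>\<epsilon> x i. \<epsilon> \<in> scales \<epsilon>0 \<Longrightarrow> \<epsilon> < \<eta> \<Longrightarrow> x \<in> Omega_disc J \<epsilon> (set_coords J r (2 * \<rho>)) \<Longrightarrow>
      i \<in> J \<Longrightarrow> x + \<epsilon> *\<^sub>R axis i 1 \<in> Omega_disc J \<epsilon> (set_coords J r (2 * \<rho>)) \<Longrightarrow>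
      norm (a \<epsilon> (x + \<epsilon> *\<^sub>R axis i 1) - a \<epsilon> x) \<le> \<Lambda> * \<epsilon>"
begin

definition "R2 = set_coords J r (2 * \<rho>)"

abbreviation "\<Omega> \<epsilon> \<equiv> Omega_disc J \<epsilon> R2"
abbreviation "\<Omega>0 \<equiv> Omega_lim J R2"

lemma R2_le: "R2 $ i \<le> r $ i"
  using \<rho>_le by (simp add: R2_def set_coords_def)

lemma \<Omega>_sub: "\<Omega> \<epsilon> \<subseteq> Omega_disc J \<epsilon> r"
  by (rule Omega_disc_mono[OF R2_le])

lemma \<Omega>0_sub: "\<Omega>0 \<subseteq> Omega_lim J r"
  by (rule Omega_lim_mono[OF R2_le])

lemma base_\<Omega>0: "x \<in> \<Omega>0 \<Longrightarrow> set_coords J x 0 \<in> base"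
  by (rule set_coords_in_base[OF _ R2_le])

lemma base_\<Omega>: "x \<in> \<Omega> \<epsilon> \<Longrightarrow> set_coords J x 0 \<in> base"
  using base_\<Omega>0 Omega_disc_subset_lim by blast

lemma a_P: "\<epsilon> \<in> scales \<epsilon>0 \<Longrightarrow> x \<in> \<Omega> \<epsilon> \<Longrightarrow> a \<epsilon> x \<in> P"
  using a_in_P \<Omega>_sub by blast

lemma a_lipschitz:
  assumes "\<epsilon> \<in> scales \<epsilon>0" "\<epsilon> < \<eta>" "x \<in> \<Omega> \<epsilon>" "y \<in> \<Omega> \<epsilon>" "set_coords J x 0 = set_coords J y 0"
  shows "norm (a \<epsilon> x - a \<epsilon> y) \<le> \<Lambda> * (\<Sum>i\<in>UNIV. \<bar>x $ i - y $ i\<bar>)"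
  by (rule grid_lipschitz[OF scales_pos[OF assms(1)] _ assms(3-5)])
    (use a_step_bound[OF assms(1,2)] in \<open>simp add: R2_def\<close>)

text \<open>On the coarse grid, a coarse step in a direction of \<open>J\<close> is compared with
  two half steps of the fine solution; the field at the midpoint differs from that at the start by
  order \<epsilon>, because the fine solution has bounded steps. In the other directions single unit
  steps are compared. Gronwall then sums these consistency errors.\<close>

lemma refinement_bound:
  "\<exists>C\<ge>0. \<forall>\<epsilon>\<in>scales \<epsilon>0. \<epsilon> < \<eta> \<longrightarrow> (\<forall>x\<in>\<Omega> \<epsilon>. norm (a \<epsilon> x - a (\<epsilon> / 2) x) \<le> C * \<epsilon>)"
proof -
  obtain Cg where Cg: "0 \<le> Cg" "\<And>k \<epsilon> x. \<epsilon> \<in> scales \<epsilon>0 \<Longrightarrow> x \<in> goursat_set (Omega_disc J \<epsilon> r) (E k) \<Longrightarrow>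
      norm (g \<epsilon> k x - g0 k x) \<le> Cg * \<epsilon>"
    using data_constants by blast
  \<comment> \<open>\<open>2 * Cg\<close> bounds the data errors at the two scales,
    \<open>2 * L\<close> the two field errors, and \<open>L * \<Lambda>\<close> the displacement to
    the midpoint.\<close>
  define C where "C = CARD('k) * ((2 * Cg + (2 * L + L * \<Lambda>)) * exp ((L * CARD('k) + 1) * coord_sum r))"
  have "norm (a \<epsilon> x - a (\<epsilon> / 2) x) \<le> C * \<epsilon>"
    if \<epsilon>: "\<epsilon> \<in> scales \<epsilon>0" "\<epsilon> < \<eta>" and x: "x \<in> \<Omega> \<epsilon>" for \<epsilon> x
  proof -
    define \<epsilon>' where "\<epsilon>' = \<epsilon> / 2"
    have pos: "0 < \<epsilon>" using scales_pos[OF \<epsilon>(1)] .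
    have \<epsilon>': "\<epsilon>' \<in> scales \<epsilon>0" "\<epsilon>' < \<eta>" "0 < \<epsilon>'" using scales_half[OF \<epsilon>(1)] \<epsilon>(2) pos by (auto simp: \<epsilon>'_def)
    have sub: "\<Omega> \<epsilon> \<subseteq> \<Omega> \<epsilon>'" unfolding \<epsilon>'_def by (rule Omega_disc_refine)
    define u where "u k x = norm (a \<epsilon> x $ k - a \<epsilon>' x $ k)" for k x
    have "u k x \<le> (2 * Cg * \<epsilon> + (2 * L + L * \<Lambda>) * \<epsilon>) * exp ((L * CARD('k) + 1) * coord_sum r)" for k
    proof (rule grid_gronwall[OF \<epsilon>(1), where S = "\<Omega> \<epsilon>" and u = u and R = R2])
      fix x j assume "x \<in> \<Omega> \<epsilon>" "0 < x $ j"
      then show "x - mesh J \<epsilon> j *\<^sub>R axis j 1 \<in> \<Omega> \<epsilon>" by (rule Omega_disc_back[OF pos])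
    next
      fix k x assume x: "x \<in> \<Omega> \<epsilon>" and G: "x \<in> goursat_set (\<Omega> \<epsilon>) (E k)"
      have G1: "x \<in> goursat_set (Omega_disc J \<epsilon> r) (E k)" using G \<Omega>_sub[of \<epsilon>] by (auto simp: goursat_set_def)
      have G2: "x \<in> goursat_set (Omega_disc J \<epsilon>' r) (E k)" using G \<Omega>_sub[of \<epsilon>'] sub by (auto simp: goursat_set_def)
      have "u k x = norm ((g \<epsilon> k x - g0 k x) - (g \<epsilon>' k x - g0 k x))"
        by (simp add: u_def a_data[OF \<epsilon>(1) G1] a_data[OF \<epsilon>'(1) G2])
      also have "\<dots> \<le> Cg * \<epsilon> + Cg * \<epsilon>'"
        by (intro norm_triangle_le_diff add_mono Cg(2) \<epsilon>(1) \<epsilon>'(1) G1 G2)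
      also have "\<dots> \<le> 2 * Cg * \<epsilon>" using Cg(1) pos by (simp add: \<epsilon>'_def)
      finally show "u k x \<le> 2 * Cg * \<epsilon>" .
    next
      fix k j B and w :: "real ^ 'd"
      let ?h = "mesh J \<epsilon> j" and ?x = "w + mesh J \<epsilon> j *\<^sub>R axis j 1"
      assume w: "w \<in> \<Omega> \<epsilon>" and x: "?x \<in> \<Omega> \<epsilon>" and j: "j \<in> E k" and B: "0 \<le> B" "\<And>l. u l w \<le> B"
      have w': "w \<in> \<Omega> \<epsilon>'" "?x \<in> \<Omega> \<epsilon>'" using w x sub by auto
      have nb: "norm (a \<epsilon> w - a \<epsilon>' w) \<le> CARD('k) * B"
        by (rule norm_vec_le) (use B(2) in \<open>simp add: u_def\<close>)
      have base: "set_coords J w 0 \<in> base" using base_\<Omega>[OF w] .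
      have near: "dist (a \<epsilon> w) (A (set_coords J w 0)) \<le> \<delta>" "dist (a \<epsilon>' w) (A (set_coords J w 0)) \<le> \<delta>"
        using a_near[OF \<epsilon>, of w] a_near[OF \<epsilon>'(1,2), of w] w w'(1) by (simp_all add: R2_def)
      \<comment> \<open>The state \<open>b\<close> is the fine solution at \<open>w\<close> or at
        the midpoint; one bound serves both half steps.\<close>
      have fd: "norm (f \<epsilon> k j (a \<epsilon> w) - f \<epsilon>' k j b) \<le> L * CARD('k) * B + (2 * L + L * \<Lambda>) * \<epsilon>"
        if "b \<in> P" "dist b (A (set_coords J w 0)) \<le> \<delta>" "norm (b - a \<epsilon>' w) \<le> \<Lambda> * \<epsilon>'" for b
      proof -
        have "norm (f \<epsilon> k j (a \<epsilon> w) - f \<epsilon>' k j b) \<le> L * norm (a \<epsilon> w - b) + L * \<epsilon> + L * \<epsilon>'"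
          by (rule near_diff[OF A_near[OF base] j a_P[OF \<epsilon>(1) w] near(1) that(1,2) \<epsilon>(1) \<epsilon>'(1)])
        also have "norm (a \<epsilon> w - b) \<le> CARD('k) * B + \<Lambda> * \<epsilon>'"
          using norm_triangle_le_diff[OF add_mono[OF nb that(3)]] by simp
        also have "L * (CARD('k) * B + \<Lambda> * \<epsilon>') + L * \<epsilon> + L * \<epsilon>' \<le> L * CARD('k) * B + (2 * L + L * \<Lambda>) * \<epsilon>"
          using mult_nonneg_nonneg[OF L_nonneg, of "\<Lambda> * \<epsilon>"] mult_nonneg_nonneg[OF L_nonneg, of \<epsilon>] \<Lambda>_nonneg pos
          by (simp add: \<epsilon>'_def algebra_simps)
        finally show ?thesis using L_nonneg by (simp add: mult_left_mono)
      qed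
      have 1: "a \<epsilon> ?x $ k = a \<epsilon> w $ k + ?h *\<^sub>R f \<epsilon> k j (a \<epsilon> w)"
        using a_step[OF \<epsilon>(1) j] w x \<Omega>_sub[of \<epsilon>] by blast
      have fd1: "norm (f \<epsilon> k j (a \<epsilon> w) - f \<epsilon>' k j (a \<epsilon>' w)) \<le> L * CARD('k) * B + (2 * L + L * \<Lambda>) * \<epsilon>"
        by (rule fd[OF a_P[OF \<epsilon>'(1) w'(1)] near(2)]) (use \<Lambda>_nonneg \<epsilon>'(3) in simp)
      show "u k ?x \<le> 2 * Cg * \<epsilon> \<or> u k ?x \<le> B + ?h * (L * CARD('k) * B + (2 * L + L * \<Lambda>) * \<epsilon>)"
      proof (cases "j \<in> J")
        case False
        then have h: "?h = 1" "mesh J \<epsilon>' j = 1" by (auto simp: mesh_def)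
        have 2: "a \<epsilon>' ?x $ k = a \<epsilon>' w $ k + f \<epsilon>' k j (a \<epsilon>' w)"
          using a_step[OF \<epsilon>'(1) j, of w] w' \<Omega>_sub[of \<epsilon>'] unfolding h by auto
        have "u k ?x = norm ((a \<epsilon> w $ k - a \<epsilon>' w $ k) + (f \<epsilon> k j (a \<epsilon> w) - f \<epsilon>' k j (a \<epsilon>' w)))"
          unfolding u_def 1 2 by (simp add: h algebra_simps)
        also have "\<dots> \<le> B + (L * CARD('k) * B + (2 * L + L * \<Lambda>) * \<epsilon>)"
          using B(2)[of k] fd1 by (intro norm_triangle_le add_mono) (auto simp: u_def)
        finally show ?thesis by (simp add: h)
      next
        case True
        then have h: "?h = \<epsilon>" "mesh J \<epsilon>' j = \<epsilon>'" by (auto simp: mesh_def)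
        define y where "y = w + \<epsilon>' *\<^sub>R axis j 1"
        have y: "y \<in> \<Omega> \<epsilon>'"
          using Omega_disc_step[OF \<epsilon>'(3) w'(1), of j] Omega_disc_le[OF x, of j] pos
          unfolding h y_def by (simp add: \<epsilon>'_def axis_def)
        have xy: "?x = y + \<epsilon>' *\<^sub>R axis j 1"
          unfolding h y_def by (simp add: \<epsilon>'_def vec_eq_iff axis_def)
        have y': "y \<in> Omega_disc J \<epsilon>' r" "w \<in> Omega_disc J \<epsilon>' r" "?x \<in> Omega_disc J \<epsilon>' r"
          using y w' \<Omega>_sub[of \<epsilon>'] by auto
        have 2: "a \<epsilon>' y $ k = a \<epsilon>' w $ k + \<epsilon>' *\<^sub>R f \<epsilon>' k j (a \<epsilon>' w)"
          using a_step[OF \<epsilon>'(1) j y'(2)] y'(1) unfolding h y_def by simp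
        have 3: "a \<epsilon>' ?x $ k = a \<epsilon>' y $ k + \<epsilon>' *\<^sub>R f \<epsilon>' k j (a \<epsilon>' y)"
          using a_step[OF \<epsilon>'(1) j y'(1)] y'(3) xy unfolding h by simp
        have fd2: "norm (f \<epsilon> k j (a \<epsilon> w) - f \<epsilon>' k j (a \<epsilon>' y)) \<le> L * CARD('k) * B + (2 * L + L * \<Lambda>) * \<epsilon>"
        proof (rule fd[OF a_P[OF \<epsilon>'(1) y]])
          show "dist (a \<epsilon>' y) (A (set_coords J w 0)) \<le> \<delta>"
            using a_near[OF \<epsilon>'(1,2), of y] y set_coords_add_axis[OF True, of w \<epsilon>'] by (simp add: R2_def y_def)
          show "norm (a \<epsilon>' y - a \<epsilon>' w) \<le> \<Lambda> * \<epsilon>'"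
            using a_step_bound[OF \<epsilon>'(1,2) _ True, of w] w'(1) y unfolding y_def R2_def by simp
        qed
        have e2: "\<epsilon> *\<^sub>R v = \<epsilon>' *\<^sub>R v + \<epsilon>' *\<^sub>R v" for v :: 'v
          by (simp add: \<epsilon>'_def scaleR_left_distrib[symmetric])
        have one: "a \<epsilon> ?x $ k = a \<epsilon> w $ k + (\<epsilon>' *\<^sub>R f \<epsilon> k j (a \<epsilon> w) + \<epsilon>' *\<^sub>R f \<epsilon> k j (a \<epsilon> w))"
          unfolding 1 unfolding h(1) e2 ..
        have "u k ?x = norm ((a \<epsilon> w $ k - a \<epsilon>' w $ k)
            + (\<epsilon>' *\<^sub>R (f \<epsilon> k j (a \<epsilon> w) - f \<epsilon>' k j (a \<epsilon>' w)) + \<epsilon>' *\<^sub>R (f \<epsilon> k j (a \<epsilon> w) - f \<epsilon>' k j (a \<epsilon>' y))))"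
          unfolding u_def one 3 2 by (simp add: algebra_simps)
        also have "\<dots> \<le> B + (\<epsilon>' * (L * CARD('k) * B + (2 * L + L * \<Lambda>) * \<epsilon>)
            + \<epsilon>' * (L * CARD('k) * B + (2 * L + L * \<Lambda>) * \<epsilon>))"
          using B(2)[of k] fd1 fd2 \<epsilon>'(3)
          by (intro norm_triangle_le add_mono) (auto simp: u_def intro: mult_left_mono)
        also have "\<dots> = B + ?h * (L * CARD('k) * B + (2 * L + L * \<Lambda>) * \<epsilon>)"
          unfolding h by (simp add: \<epsilon>'_def)
        finally show ?thesis by simp
      qed
    qed (use R2_le L_nonneg \<Lambda>_nonneg Cg(1) pos x in auto)
    then have "norm ((a \<epsilon> x - a \<epsilon>' x) $ k) \<le> (2 * Cg + (2 * L + L * \<Lambda>)) * exp ((L * CARD('k) + 1) * coord_sum r) * \<epsilon>" for k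
      by (simp add: u_def algebra_simps)
    then have "norm (a \<epsilon> x - a \<epsilon>' x) \<le> CARD('k) * ((2 * Cg + (2 * L + L * \<Lambda>)) * exp ((L * CARD('k) + 1) * coord_sum r) * \<epsilon>)"
      by (rule norm_vec_le)
    then show ?thesis by (simp add: C_def \<epsilon>'_def mult.assoc)
  qed
  moreover have "0 \<le> C" using Cg(1) L_nonneg \<Lambda>_nonneg by (simp add: C_def)
  ultimately show ?thesis by blast
qed

text \<open>\<open>SOME\<close> merely names an index whose existence is
  \<open>eventually_scales\<close>, so that it is available throughout the locale.\<close>

definition N0 :: nat where
  "N0 = (SOME n0. \<forall>n\<ge>n0. (1/2::real)^n \<in> scales \<epsilon>0 \<and> (1/2::real)^n < \<eta>)"

abbreviation e :: "nat \<Rightarrow> real" where "e n \<equiv> (1/2)^n"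
abbreviation fl :: "nat \<Rightarrow> real ^ 'd \<Rightarrow> real ^ 'd" where "fl n \<equiv> grid_floor J (e n)"

lemma e_scale: "n \<ge> N0 \<Longrightarrow> e n \<in> scales \<epsilon>0" and e_less: "n \<ge> N0 \<Longrightarrow> e n < \<eta>"
  using someI_ex[OF eventually_scales[OF eps0_pos \<eta>_pos]] unfolding N0_def by blast+

lemma e_lim: "e \<longlonglongrightarrow> 0"
  by (rule LIMSEQ_realpow_zero) auto

lemma fl_in: "x \<in> Omega_lim J R \<Longrightarrow> fl n x \<in> Omega_disc J (e n) R"
  by (rule grid_floor_in_disc) auto

lemma fl_lim: "(\<lambda>n. fl n x $ i) \<longlonglongrightarrow> x $ i"
proof -
  have "(\<lambda>n. x $ i - e n) \<longlonglongrightarrow> x $ i - 0"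
    by (intro tendsto_intros e_lim)
  then have lim: "(\<lambda>n. x $ i - e n) \<longlonglongrightarrow> x $ i" by simp
  show ?thesis
    by (rule tendsto_sandwich[OF _ _ lim tendsto_const]; rule always_eventually)
      (simp_all add: grid_floor_nth_ge grid_floor_nth_le)
qed

lemma fl_lim_vec: "(\<lambda>n. fl n x) \<longlonglongrightarrow> x"
  by (rule vec_tendstoI) (rule fl_lim)

text \<open>Rounding down assigns a discrete value to every point of the box. A point that belongs
  to some grid is fixed from then on, so there the sequence consists of the solution values
  themselves.\<close>

definition a0 :: "real ^ 'd \<Rightarrow> 'v ^ 'k" where
  "a0 x = lim (\<lambda>n. a (e n) (fl n x))"

text \<open>From one index to the next, both the solution and the rounded point change; refinement
  at the coarse point and the step bound of the finer solution control the two changes, each by a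
  multiple of \<open>e n\<close>. Geometric summation gives limit and rate together.\<close>

lemma a0_limit:
  "\<exists>C\<ge>0. \<forall>x\<in>\<Omega>0. a0 x \<in> P \<and> (\<lambda>n. a (e n) (fl n x)) \<longlonglongrightarrow> a0 x \<and>
    (\<forall>n\<ge>N0. norm (a (e n) (fl n x) - a0 x) \<le> C * e n)"
proof -
  obtain C where C: "C \<ge> 0" "\<And>\<epsilon> x. \<epsilon> \<in> scales \<epsilon>0 \<Longrightarrow> \<epsilon> < \<eta> \<Longrightarrow> x \<in> \<Omega> \<epsilon> \<Longrightarrow> norm (a \<epsilon> x - a (\<epsilon> / 2) x) \<le> C * \<epsilon>"
    using refinement_bound by blast
  define C' where "C' = C + \<Lambda> * CARD('d)"
  have "0 \<le> C'" using C(1) \<Lambda>_nonneg by (simp add: C'_def)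
  have "a0 x \<in> P \<and> (\<lambda>n. a (e n) (fl n x)) \<longlonglongrightarrow> a0 x \<and> (\<forall>n\<ge>N0. norm (a (e n) (fl n x) - a0 x) \<le> 2 * C' * e n)"
    if x: "x \<in> \<Omega>0" for x
  proof -
    have "\<exists>l\<in>P. (\<lambda>n. a (e n) (fl n x)) \<longlonglongrightarrow> l \<and> (\<forall>n\<ge>N0. dist (a (e n) (fl n x)) l \<le> 2 * C' * (1/2)^n)"
    proof (rule geometric_Cauchy_limit[OF P_complete])
      fix n assume n: "n \<ge> N0"
      show "a (e n) (fl n x) \<in> P" by (rule a_P[OF e_scale[OF n] fl_in[OF x]])
      have n': "Suc n \<ge> N0" using n by simp
      \<comment> \<open>The grids are nested, so the finer solution may be evaluated at the coarse
        floor.\<close>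
      have fx: "fl n x \<in> \<Omega> (e (Suc n))"
        using Omega_disc_refine fl_in[OF x, of n] by fastforce
      have "norm (a (e (Suc n)) (fl (Suc n) x) - a (e (Suc n)) (fl n x))
          \<le> \<Lambda> * (\<Sum>i\<in>UNIV. \<bar>fl (Suc n) x $ i - fl n x $ i\<bar>)"
        by (rule a_lipschitz[OF e_scale[OF n'] e_less[OF n'] fl_in[OF x] fx]) (simp only: grid_floor_set_coords)
      also have "\<dots> \<le> \<Lambda> * (\<Sum>i\<in>(UNIV :: 'd set). e n)"
      proof (intro mult_left_mono sum_mono \<Lambda>_nonneg)
        fix i
        have "e (Suc n) \<le> e n" "0 < e n" by simp_all
        then show "\<bar>fl (Suc n) x $ i - fl n x $ i\<bar> \<le> e n"
          using grid_floor_nth_le[of "e n" J x i] grid_floor_nth_ge[of "e n" x i J]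
            grid_floor_nth_le[of "e (Suc n)" J x i] grid_floor_nth_ge[of "e (Suc n)" x i J]
          by (intro abs_leI) simp_all
      qed
      finally have 1: "norm (a (e (Suc n)) (fl (Suc n) x) - a (e (Suc n)) (fl n x)) \<le> \<Lambda> * CARD('d) * e n"
        by simp
      have 2: "norm (a (e n) (fl n x) - a (e (Suc n)) (fl n x)) \<le> C * e n"
        using C(2)[OF e_scale[OF n] e_less[OF n] fl_in[OF x]] by simp
      show "dist (a (e (Suc n)) (fl (Suc n) x)) (a (e n) (fl n x)) \<le> C' * (1/2)^n"
        using norm_triangle_le_diff[OF add_mono[OF 1 2]] by (simp add: dist_norm C'_def algebra_simps)
    qed
    then obtain l where l: "l \<in> P" "(\<lambda>n. a (e n) (fl n x)) \<longlonglongrightarrow> l"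
      "\<forall>n\<ge>N0. dist (a (e n) (fl n x)) l \<le> 2 * C' * (1/2)^n" by blast
    moreover have "a0 x = l" unfolding a0_def by (rule limI[OF l(2)])
    ultimately show ?thesis by (simp add: dist_norm)
  qed
  then show ?thesis using \<open>0 \<le> C'\<close> by (intro exI[of _ "2 * C'"]) auto
qed

lemma a0_P: "x \<in> \<Omega>0 \<Longrightarrow> a0 x \<in> P" and a0_lim: "x \<in> \<Omega>0 \<Longrightarrow> (\<lambda>n. a (e n) (fl n x)) \<longlonglongrightarrow> a0 x"
  using a0_limit by blast+

lemma a0_near:
  assumes x: "x \<in> \<Omega>0"
  shows "dist (a0 x) (A (set_coords J x 0)) \<le> \<delta>"
proof (rule LIMSEQ_le_const2)
  show "(\<lambda>n. dist (a (e n) (fl n x)) (A (set_coords J x 0))) \<longlonglongrightarrow> dist (a0 x) (A (set_coords J x 0))"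
    by (intro tendsto_intros a0_lim[OF x])
  show "\<exists>N. \<forall>n\<ge>N. dist (a (e n) (fl n x)) (A (set_coords J x 0)) \<le> \<delta>"
  proof (intro exI[of _ N0] allI impI)
    fix n assume n: "n \<ge> N0"
    show "dist (a (e n) (fl n x)) (A (set_coords J x 0)) \<le> \<delta>"
      using a_near[OF e_scale[OF n] e_less[OF n], of "fl n x"] fl_in[OF x, of n]
      by (simp add: R2_def grid_floor_set_coords)
  qed
qed

lemma a0_lipschitz_slab:
  assumes x: "x \<in> \<Omega>0" and y: "y \<in> \<Omega>0" and "set_coords J x 0 = set_coords J y 0"
  shows "norm (a0 x - a0 y) \<le> \<Lambda> * (\<Sum>i\<in>UNIV. \<bar>x $ i - y $ i\<bar>)"
proof (rule LIMSEQ_le)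
  show "(\<lambda>n. norm (a (e n) (fl n x) - a (e n) (fl n y))) \<longlonglongrightarrow> norm (a0 x - a0 y)"
    by (intro tendsto_intros a0_lim x y)
  show "(\<lambda>n. \<Lambda> * (\<Sum>i\<in>UNIV. \<bar>fl n x $ i - fl n y $ i\<bar>)) \<longlonglongrightarrow> \<Lambda> * (\<Sum>i\<in>UNIV. \<bar>x $ i - y $ i\<bar>)"
    by (intro tendsto_intros fl_lim)
  show "\<exists>N. \<forall>n\<ge>N. norm (a (e n) (fl n x) - a (e n) (fl n y)) \<le> \<Lambda> * (\<Sum>i\<in>UNIV. \<bar>fl n x $ i - fl n y $ i\<bar>)"
    by (intro exI[of _ N0] allI impI a_lipschitz e_scale e_less fl_in x y)
      (simp_all add: grid_floor_set_coords assms(3))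
qed

text \<open>Within one slab the step bound passes to the limit. Points of different slabs differ by
  at least 1 in an integer coordinate, so boundedness of \<open>a0\<close> suffices for
  them.\<close>

lemma a0_lipschitz: "\<exists>L. L-lipschitz_on \<Omega>0 a0"
proof -
  define M where "M = (\<Sum>z\<in>base. norm (A z)) + \<delta>"
  have bd: "norm (a0 x) \<le> M" if x: "x \<in> \<Omega>0" for x
  proof -
    have "norm (a0 x) \<le> norm (A (set_coords J x 0)) + norm (a0 x - A (set_coords J x 0))"
      by (rule norm_triangle_sub)
    also have "\<dots> \<le> M"
      unfolding M_def using a0_near[OF x] base_\<Omega>0[OF x] finite_base
      by (intro add_mono member_le_sum) (auto simp: dist_norm)
    finally show ?thesis .
  qed
  have "0 \<le> M" unfolding M_def using \<delta>_pos by (intro add_nonneg_nonneg sum_nonneg) auto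
  have "(\<Lambda> * CARD('d) + 2 * M)-lipschitz_on \<Omega>0 a0"
  proof (rule lipschitz_onI)
    fix x y assume x: "x \<in> \<Omega>0" and y: "y \<in> \<Omega>0"
    show "dist (a0 x) (a0 y) \<le> (\<Lambda> * CARD('d) + 2 * M) * dist x y"
    proof (cases "set_coords J x 0 = set_coords J y 0")
      case True
      have "(\<Sum>i\<in>UNIV. \<bar>x $ i - y $ i\<bar>) \<le> (\<Sum>i\<in>(UNIV::'d set). norm (x - y))"
        using component_le_norm_cart[of "x - y"] by (intro sum_mono) simp
      then have "\<Lambda> * (\<Sum>i\<in>UNIV. \<bar>x $ i - y $ i\<bar>) \<le> \<Lambda> * (CARD('d) * norm (x - y))"
        using \<Lambda>_nonneg by (intro mult_left_mono) auto
      also have "\<dots> \<le> (\<Lambda> * CARD('d) + 2 * M) * norm (x - y)"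
        using \<open>0 \<le> M\<close> by (simp add: algebra_simps)
      finally show ?thesis using a0_lipschitz_slab[OF x y True] by (simp add: dist_norm)
    next
      case False
      then obtain i where i: "i \<notin> J" "x $ i \<noteq> y $ i" unfolding set_coords_eq_iff by blast
      then have "x $ i \<in> \<int>" "y $ i \<in> \<int>" using x y unfolding Omega_lim_def by auto
      then obtain p q :: int where pq: "x $ i = of_int p" "y $ i = of_int q"
        by (elim Ints_cases)
      have "1 \<le> \<bar>p - q\<bar>" using i(2) pq by auto
      then have "1 \<le> real_of_int \<bar>p - q\<bar>" by linarith
      then have "1 \<le> \<bar>x $ i - y $ i\<bar>" by (simp add: pq)
      also have "\<dots> \<le> norm (x - y)" using component_le_norm_cart[of "x - y" i] by simp
      finally have 1: "1 \<le> norm (x - y)" .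
      have "norm (a0 x - a0 y) \<le> M + M" by (intro norm_triangle_le_diff add_mono bd x y)
      also have "\<dots> \<le> (\<Lambda> * CARD('d) + 2 * M) * 1" using \<Lambda>_nonneg by simp
      also have "\<dots> \<le> (\<Lambda> * CARD('d) + 2 * M) * norm (x - y)"
        using 1 \<Lambda>_nonneg \<open>0 \<le> M\<close> by (intro mult_left_mono) auto
      finally show ?thesis by (simp add: dist_norm)
    qed
  qed (use \<Lambda>_nonneg \<open>0 \<le> M\<close> in simp)
  then show ?thesis by blast
qed

lemma f0_a0_lipschitz:
  assumes "i \<in> E k" "x \<in> \<Omega>0" "y \<in> \<Omega>0" "set_coords J x 0 = set_coords J y 0"
  shows "norm (f 0 k i (a0 x) - f 0 k i (a0 y)) \<le> L * norm (a0 x - a0 y)"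
  using near_constD(3)[OF A_near[OF base_\<Omega>0[OF assms(2)]] assms(1) a0_P[OF assms(2)] a0_near[OF assms(2)]
      a0_P[OF assms(3)]] a0_near[OF assms(3)] assms(4) by simp

text \<open>All states involved lie in one ball around \<open>A\<close> at the base point: the
  Lipschitz constant there handles the moving argument, and the rate handles the moving
  field.\<close>

lemma f0_a_lim:
  assumes i: "i \<in> E k" and x: "x \<in> \<Omega>0"
  shows "(\<lambda>n. f 0 k i (a (e n) (fl n x))) \<longlonglongrightarrow> f 0 k i (a0 x)"
    and "(\<lambda>n. f (e n) k i (a (e n) (fl n x))) \<longlonglongrightarrow> f 0 k i (a0 x)"
proof -
  have lim: "(\<lambda>n. norm (a (e n) (fl n x) - a0 x)) \<longlonglongrightarrow> 0"
    using tendsto_norm[OF tendsto_diff[OF a0_lim[OF x] tendsto_const[of "a0 x"]]] by simp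
  have near: "dist (a (e n) (fl n x)) (A (set_coords J x 0)) \<le> \<delta>" "a (e n) (fl n x) \<in> P" if n: "n \<ge> N0" for n
    using a_near[OF e_scale[OF n] e_less[OF n], of "fl n x"] a_P[OF e_scale[OF n]] fl_in[OF x, of n]
    by (auto simp: R2_def grid_floor_set_coords)
  note nc = near_constD[OF A_near[OF base_\<Omega>0[OF x]] i]
  have "(\<lambda>n. f 0 k i (a (e n) (fl n x)) - f 0 k i (a0 x)) \<longlonglongrightarrow> 0"
  proof (rule Lim_null_comparison)
    show "\<forall>\<^sub>F n in sequentially. norm (f 0 k i (a (e n) (fl n x)) - f 0 k i (a0 x)) \<le> L * norm (a (e n) (fl n x) - a0 x)"
      using nc(3)[OF near(2,1) a0_P[OF x] a0_near[OF x]] by (auto simp: eventually_sequentially)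
    show "(\<lambda>n. L * norm (a (e n) (fl n x) - a0 x)) \<longlonglongrightarrow> 0"
      using lim by (rule tendsto_mult_right_zero)
  qed
  then show 1: "(\<lambda>n. f 0 k i (a (e n) (fl n x))) \<longlonglongrightarrow> f 0 k i (a0 x)"
    by (simp add: LIM_zero_iff)
  have "(\<lambda>n. f (e n) k i (a (e n) (fl n x)) - f 0 k i (a (e n) (fl n x))) \<longlonglongrightarrow> 0"
  proof (rule Lim_null_comparison)
    show "\<forall>\<^sub>F n in sequentially. norm (f (e n) k i (a (e n) (fl n x)) - f 0 k i (a (e n) (fl n x))) \<le> L * e n"
      using nc(2)[OF near(2,1) e_scale] by (auto simp: eventually_sequentially)
    show "(\<lambda>n. L * e n) \<longlonglongrightarrow> 0"
      using e_lim by (rule tendsto_mult_right_zero)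
  qed
  from tendsto_add[OF this 1] show "(\<lambda>n. f (e n) k i (a (e n) (fl n x))) \<longlonglongrightarrow> f 0 k i (a0 x)"
    by simp
qed

section \<open>The limiting Goursat problem\<close>

lemma grid_segment:
  assumes "i \<in> J" "0 < h" "y \<in> Omega_disc J h R" "y + (real m * h) *\<^sub>R axis i 1 \<in> Omega_disc J h R" "l \<le> m"
  shows "y + (real l * h) *\<^sub>R axis i 1 \<in> Omega_disc J h R"
  using \<open>l \<le> m\<close>
proof (induction l)
  case (Suc l)
  have "y $ i + real (Suc l) * h \<le> y $ i + real m * h"
    using Suc.prems assms(2) by (simp add: mult_right_mono)
  also have "\<dots> \<le> R $ i"
    using Omega_disc_le[OF assms(4), of i] by (simp add: axis_def)
  finally have "(y + (real l * h) *\<^sub>R axis i 1) $ i + mesh J h i \<le> R $ i"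
    using assms(1) by (simp add: axis_def mesh_def algebra_simps)
  from Omega_disc_step[OF assms(2) Suc.IH this] Suc.prems assms(1) show ?case
    by (simp add: mesh_def algebra_simps)
qed (use assms in simp)

text \<open>Although \<open>t\<close> is in general no multiple of the mesh, the rounded points lie
  on a common grid line at a whole number of steps.\<close>

lemma floor_shift:
  assumes "i \<in> J" "0 \<le> t"
  obtains m :: nat where "fl n (x + t *\<^sub>R axis i 1) = fl n x + (real m * e n) *\<^sub>R axis i 1"
proof
  define m where "m = nat (\<lfloor>(x $ i + t) / e n\<rfloor> - \<lfloor>x $ i / e n\<rfloor>)"
  have "\<lfloor>x $ i / e n\<rfloor> \<le> \<lfloor>(x $ i + t) / e n\<rfloor>"
    using assms(2) by (intro floor_mono divide_right_mono) auto
  then have m: "real m = of_int \<lfloor>(x $ i + t) / e n\<rfloor> - of_int \<lfloor>x $ i / e n\<rfloor>"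
    unfolding m_def by simp
  show "fl n (x + t *\<^sub>R axis i 1) = fl n x + (real m * e n) *\<^sub>R axis i 1"
    unfolding vec_eq_iff
  proof
    fix j
    show "fl n (x + t *\<^sub>R axis i 1) $ j = (fl n x + (real m * e n) *\<^sub>R axis i 1) $ j"
      unfolding axis_step_nth m using assms(1)
      by (cases "i = j") (simp_all add: grid_floor_def axis_def algebra_simps)
  qed
qed

text \<open>The length on the grid that stands for the increment \<open>t\<close>; it differs from
  \<open>t\<close> by at most one mesh width.\<close>

definition \<tau> :: "nat \<Rightarrow> real ^ 'd \<Rightarrow> 'd \<Rightarrow> real \<Rightarrow> real" where
  "\<tau> n x i t = fl n (x + t *\<^sub>R axis i 1) $ i - fl n x $ i"

lemma \<tau>_props:
  assumes "i \<in> J" "0 \<le> t"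
  obtains m :: nat where "\<tau> n x i t = real m * e n"
    "fl n (x + t *\<^sub>R axis i 1) = fl n x + (real m * e n) *\<^sub>R axis i 1"
proof -
  obtain m :: nat where m: "fl n (x + t *\<^sub>R axis i 1) = fl n x + (real m * e n) *\<^sub>R axis i 1"
    by (rule floor_shift[OF assms])
  then show thesis using that[of m] by (simp add: \<tau>_def axis_def)
qed

lemma \<tau>_lim: "(\<lambda>n. \<tau> n x i t) \<longlonglongrightarrow> t"
proof -
  have "(\<lambda>n. \<tau> n x i t) \<longlonglongrightarrow> (x + t *\<^sub>R axis i 1) $ i - x $ i"
    unfolding \<tau>_def by (intro tendsto_intros fl_lim)
  then show ?thesis by (simp add: axis_def)
qed

text \<open>The scheme is a Taylor expansion with local error of order \<open>e n\<close> and drift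
  at most \<open>L * \<Lambda>\<close> per length. In the limit the local error disappears and a
  quadratic remainder is left, which yields the differential equation without an integral.\<close>

lemma a0_taylor:
  assumes k: "i \<in> E k" "i \<in> J" and x: "x \<in> \<Omega>0" and t: "0 \<le> t" and xt: "x + t *\<^sub>R axis i 1 \<in> \<Omega>0"
  shows "norm (a0 (x + t *\<^sub>R axis i 1) $ k - a0 x $ k - t *\<^sub>R f 0 k i (a0 x)) \<le> t * (L * \<Lambda> * t)"
proof (rule LIMSEQ_le)
  let ?x = "x + t *\<^sub>R axis i 1"
  show "(\<lambda>n. norm (a (e n) (fl n ?x) $ k - a (e n) (fl n x) $ k - \<tau> n x i t *\<^sub>R f 0 k i (a (e n) (fl n x))))
      \<longlonglongrightarrow> norm (a0 ?x $ k - a0 x $ k - t *\<^sub>R f 0 k i (a0 x))"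
    by (intro tendsto_intros a0_lim f0_a_lim(1) \<tau>_lim k x xt)
  have "(\<lambda>n. \<tau> n x i t * (L * e n + L * \<Lambda> * \<tau> n x i t)) \<longlonglongrightarrow> t * (L * 0 + L * \<Lambda> * t)"
    by (intro tendsto_intros \<tau>_lim e_lim)
  then show "(\<lambda>n. \<tau> n x i t * (L * e n + L * \<Lambda> * \<tau> n x i t)) \<longlonglongrightarrow> t * (L * \<Lambda> * t)" by simp
  show "\<exists>N. \<forall>n\<ge>N. norm (a (e n) (fl n ?x) $ k - a (e n) (fl n x) $ k - \<tau> n x i t *\<^sub>R f 0 k i (a (e n) (fl n x)))
      \<le> \<tau> n x i t * (L * e n + L * \<Lambda> * \<tau> n x i t)"
  proof (intro exI[of _ N0] allI impI)
    fix n assume n: "n \<ge> N0"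
    let ?h = "e n" and ?y = "fl n x"
    obtain m :: nat where m: "\<tau> n x i t = real m * ?h" "fl n ?x = ?y + (real m * ?h) *\<^sub>R axis i 1"
      by (rule \<tau>_props[OF k(2) t])
    have y: "?y \<in> \<Omega> ?h" "?y + (real m * ?h) *\<^sub>R axis i 1 \<in> \<Omega> ?h"
      using fl_in[OF x, of n] fl_in[OF xt, of n] m(2) by auto
    have seg: "?y + (real l * ?h) *\<^sub>R axis i 1 \<in> \<Omega> ?h" if "l \<le> m" for l
      by (rule grid_segment[OF k(2) _ y that]) simp
    have base: "set_coords J (?y + (real l * ?h) *\<^sub>R axis i 1) 0 = set_coords J ?y 0" for l
      by (rule set_coords_add_axis[OF k(2)])
    have near: "dist (a ?h (?y + (real l * ?h) *\<^sub>R axis i 1)) (A (set_coords J ?y 0)) \<le> \<delta>"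
      "a ?h (?y + (real l * ?h) *\<^sub>R axis i 1) \<in> P" if "l \<le> m" for l
      using a_near[OF e_scale[OF n] e_less[OF n], of "?y + (real l * ?h) *\<^sub>R axis i 1"] seg[OF that]
        a_P[OF e_scale[OF n] seg[OF that]] by (auto simp: R2_def base)
    note nc = near_constD[OF A_near[OF base_\<Omega>[OF y(1)]] k(1)]
    show "norm (a ?h (fl n ?x) $ k - a ?h ?y $ k - \<tau> n x i t *\<^sub>R f 0 k i (a ?h ?y))
        \<le> \<tau> n x i t * (L * ?h + L * \<Lambda> * \<tau> n x i t)"
      unfolding m
    proof (rule grid_taylor[where u = "\<lambda>y. a ?h y $ k" and w = "\<lambda>y. f 0 k i (a ?h y)"])
      fix l assume l: "l < m"
      let ?z = "?y + (real l * ?h) *\<^sub>R axis i 1"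
      have eq: "?z + mesh J ?h i *\<^sub>R axis i 1 = ?y + (real (Suc l) * ?h) *\<^sub>R axis i 1"
        using k(2) by (simp add: algebra_simps mesh_def)
      have z: "?z \<in> Omega_disc J ?h r" "?z + mesh J ?h i *\<^sub>R axis i 1 \<in> Omega_disc J ?h r"
        unfolding eq using seg[of l] seg[of "Suc l"] l subsetD[OF \<Omega>_sub] by simp_all
      have "a ?h (?z + ?h *\<^sub>R axis i 1) $ k = a ?h ?z $ k + ?h *\<^sub>R f ?h k i (a ?h ?z)"
        using a_step[OF e_scale[OF n] k(1) z] k(2) by (simp add: mesh_def)
      then have "a ?h (?z + ?h *\<^sub>R axis i 1) $ k - a ?h ?z $ k - ?h *\<^sub>R f 0 k i (a ?h ?z)
          = ?h *\<^sub>R (f ?h k i (a ?h ?z) - f 0 k i (a ?h ?z))"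
        by (simp add: algebra_simps)
      then show "norm (a ?h (?z + ?h *\<^sub>R axis i 1) $ k - a ?h ?z $ k - ?h *\<^sub>R f 0 k i (a ?h ?z)) \<le> ?h * (L * ?h)"
        using nc(2)[OF near(2,1) e_scale[OF n], of l] l by (simp add: mult_left_mono)
      have "norm (f 0 k i (a ?h ?z) - f 0 k i (a ?h ?y)) \<le> L * norm (a ?h ?z - a ?h ?y)"
        using nc(3)[OF near(2,1)[of l] near(2,1)[of 0]] l by simp
      also have "norm (a ?h ?z - a ?h ?y) \<le> \<Lambda> * (\<Sum>j\<in>UNIV. \<bar>?z $ j - ?y $ j\<bar>)"
        by (rule a_lipschitz[OF e_scale[OF n] e_less[OF n]]) (use seg l y base in auto)
      also have "(\<Sum>j\<in>UNIV. \<bar>?z $ j - ?y $ j\<bar>) = real l * ?h"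
        unfolding axis_step_nth by (simp add: if_distrib[of abs] cong: if_cong)
      finally show "norm (f 0 k i (a ?h ?z) - f 0 k i (a ?h ?y)) \<le> L * \<Lambda> * (real l * ?h)"
        using L_nonneg by (simp add: mult_left_mono mult.assoc)
    qed (use L_nonneg \<Lambda>_nonneg in auto)
  qed
qed

lemma a0_disc_step:
  assumes k: "i \<in> E k" "i \<notin> J" and x: "x \<in> \<Omega>0" and x1: "x + axis i 1 \<in> \<Omega>0"
  shows "a0 (x + axis i 1) $ k = a0 x $ k + f 0 k i (a0 x)"
proof (rule LIMSEQ_unique)
  show "(\<lambda>n. a (e n) (fl n (x + axis i 1)) $ k) \<longlonglongrightarrow> a0 (x + axis i 1) $ k"
    by (intro tendsto_intros a0_lim x1)
  have "(\<lambda>n. a (e n) (fl n x) $ k + f (e n) k i (a (e n) (fl n x))) \<longlonglongrightarrow> a0 x $ k + f 0 k i (a0 x)"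
    by (intro tendsto_intros a0_lim f0_a_lim(2) x k)
  moreover have "\<forall>\<^sub>F n in sequentially. a (e n) (fl n (x + axis i 1)) $ k
      = a (e n) (fl n x) $ k + f (e n) k i (a (e n) (fl n x))"
    unfolding eventually_sequentially
  proof (intro exI[of _ N0] allI impI)
    fix n assume n: "n \<ge> N0"
    have "fl n (x + axis i 1) = fl n x + mesh J (e n) i *\<^sub>R axis i 1"
      using k(2) by (auto simp: vec_eq_iff grid_floor_def mesh_def axis_def)
    moreover have "fl n x \<in> Omega_disc J (e n) r" "fl n (x + axis i 1) \<in> Omega_disc J (e n) r"
      using fl_in[OF x] fl_in[OF x1] \<Omega>_sub by blast+
    ultimately show "a (e n) (fl n (x + axis i 1)) $ k = a (e n) (fl n x) $ k + f (e n) k i (a (e n) (fl n x))"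
      using a_step[OF e_scale[OF n] k(1), of "fl n x"] k(2) by (simp add: mesh_def)
  qed
  ultimately show "(\<lambda>n. a (e n) (fl n (x + axis i 1)) $ k) \<longlonglongrightarrow> a0 x $ k + f 0 k i (a0 x)"
    by (simp add: tendsto_cong)
qed

text \<open>Rounding down keeps zero coordinates, so the rounded points remain in the data set;
  Lipschitz continuity of \<open>g0\<close> covers the distance to \<open>x\<close>.\<close>

lemma a0_data:
  assumes x: "x \<in> goursat_set \<Omega>0 (E k)"
  shows "a0 x $ k = g0 k x"
proof (rule LIMSEQ_unique)
  have x0: "x \<in> \<Omega>0" "\<And>i. i \<in> E k \<Longrightarrow> x $ i = 0" using x by (auto simp: goursat_set_def)
  show "(\<lambda>n. a (e n) (fl n x) $ k) \<longlonglongrightarrow> a0 x $ k"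
    by (intro tendsto_intros a0_lim x0)
  obtain Cg where Cg: "0 \<le> Cg" "\<And>k \<epsilon> x. \<epsilon> \<in> scales \<epsilon>0 \<Longrightarrow> x \<in> goursat_set (Omega_disc J \<epsilon> r) (E k) \<Longrightarrow>
      norm (g \<epsilon> k x - g0 k x) \<le> Cg * \<epsilon>"
    "\<And>k. Cg-lipschitz_on (goursat_set (Omega_lim J r) (E k)) (g0 k)"
    using data_constants by blast
  have flG: "fl n x \<in> goursat_set (Omega_disc J (e n) r) (E k)" for n
    using fl_in[OF x0(1), of n] \<Omega>_sub x0(2) by (auto simp: goursat_set_def grid_floor_def)
  have "(\<lambda>n. a (e n) (fl n x) $ k - g0 k x) \<longlonglongrightarrow> 0"
  proof (rule Lim_null_comparison)
    have "norm (a (e n) (fl n x) $ k - g0 k x) \<le> Cg * e n + Cg * norm (fl n x - x)" if n: "n \<ge> N0" for n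
    proof -
      have "a (e n) (fl n x) $ k - g0 k x = (g (e n) k (fl n x) - g0 k (fl n x)) + (g0 k (fl n x) - g0 k x)"
        using a_data[OF e_scale[OF n] flG] by simp
      also have "norm \<dots> \<le> Cg * e n + Cg * norm (fl n x - x)"
      proof (intro norm_triangle_le add_mono Cg(2) e_scale n flG lipschitz_on_normD[OF Cg(3)])
        show "fl n x \<in> goursat_set (Omega_lim J r) (E k)" "x \<in> goursat_set (Omega_lim J r) (E k)"
          using flG goursat_set_mono[OF Omega_disc_subset_lim] x goursat_set_mono[OF \<Omega>0_sub] by blast+
      qed
      finally show ?thesis .
    qed
    then show "\<forall>\<^sub>F n in sequentially. norm (a (e n) (fl n x) $ k - g0 k x) \<le> Cg * e n + Cg * norm (fl n x - x)"
      unfolding eventually_sequentially by blast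
    have "(\<lambda>n. Cg * e n + Cg * norm (fl n x - x)) \<longlonglongrightarrow> Cg * 0 + Cg * norm (x - x)"
      by (intro tendsto_intros e_lim fl_lim_vec)
    then show "(\<lambda>n. Cg * e n + Cg * norm (fl n x - x)) \<longlonglongrightarrow> 0" by simp
  qed
  then show "(\<lambda>n. a (e n) (fl n x) $ k) \<longlonglongrightarrow> g0 k x" by (simp add: LIM_zero_iff)
qed

text \<open>Half of the controlled side, so that forward increments from its points stay inside the
  region at small scales.\<close>

definition "rb = set_coords J r \<rho>"

lemma rb_sub: "Omega_lim J rb \<subseteq> \<Omega>0"
  using \<rho>_pos by (intro Omega_lim_mono) (auto simp: rb_def R2_def set_coords_def)

lemma a0_solution: "limit_goursat_solution X E J rb (f 0) g0 a0"
  unfolding limit_goursat_solution_def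
proof (intro conjI allI ballI impI)
  show "a0 ` Omega_lim J rb \<subseteq> P" using a0_P rb_sub by blast
  obtain L' where "L'-lipschitz_on \<Omega>0 a0" using a0_lipschitz by blast
  then show "continuous_on (Omega_lim J rb) a0"
    using lipschitz_on_continuous_on continuous_on_subset rb_sub by blast
next
  fix k i x assume k: "i \<in> E k \<inter> J" and x: "x \<in> Omega_lim J rb"
  show "((\<lambda>t. a0 (x + t *\<^sub>R axis i 1) $ k) has_vector_derivative f 0 k i (a0 x)) (line_filter (Omega_lim J rb) i x)"
  proof (rule has_vector_derivative_of_forward_taylor[of 1 "L * \<Lambda>" _ i "\<lambda>y. a0 y $ k"
        "\<lambda>y. f 0 k i (a0 y)", OF _ _ _ _ x])
    fix y t assume y: "y \<in> Omega_lim J rb" "0 \<le> t" "y + t *\<^sub>R axis i 1 \<in> Omega_lim J rb"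
    have y': "y \<in> \<Omega>0" "y + t *\<^sub>R axis i 1 \<in> \<Omega>0" using y rb_sub by auto
    show "norm (a0 (y + t *\<^sub>R axis i 1) $ k - a0 y $ k - t *\<^sub>R f 0 k i (a0 y)) \<le> L * \<Lambda> * t\<^sup>2"
      using a0_taylor[of i k y t] k y' y(2) by (simp add: power2_eq_square mult_ac)
    have iJ: "i \<in> J" using k by simp
    have "norm (f 0 k i (a0 (y + t *\<^sub>R axis i 1)) - f 0 k i (a0 y)) \<le> L * norm (a0 (y + t *\<^sub>R axis i 1) - a0 y)"
      using k y' by (intro f0_a0_lipschitz) (auto simp: set_coords_add_axis)
    also have "norm (a0 (y + t *\<^sub>R axis i 1) - a0 y) \<le> \<Lambda> * (\<Sum>j\<in>UNIV. \<bar>(y + t *\<^sub>R axis i 1) $ j - y $ j\<bar>)"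
      using iJ by (intro a0_lipschitz_slab y') (simp add: set_coords_add_axis)
    also have "(\<Sum>j\<in>UNIV. \<bar>(y + t *\<^sub>R axis i 1) $ j - y $ j\<bar>) = t"
      unfolding axis_step_nth using y(2) by (simp add: if_distrib[of abs] cong: if_cong)
    finally show "norm (f 0 k i (a0 (y + t *\<^sub>R axis i 1)) - f 0 k i (a0 y)) \<le> L * \<Lambda> * t"
      using L_nonneg by (simp add: mult_left_mono mult.assoc)
  qed (use L_nonneg \<Lambda>_nonneg in auto)
next
  fix k i x assume "i \<in> E k - J" "x \<in> Omega_lim J rb" "x + axis i 1 \<in> Omega_lim J rb"
  then show "diff_quot 1 i (\<lambda>y. a0 y $ k) x = f 0 k i (a0 x)"
    using a0_disc_step[of i k x] subsetD[OF rb_sub] by (simp add: diff_quot_def)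
next
  fix k x assume "x \<in> goursat_set (Omega_lim J rb) (E k)"
  then show "a0 x $ k = g0 k x"
    using a0_data goursat_set_mono[OF rb_sub] by blast
qed

text \<open>The rate of \<open>a0_limit\<close> holds from index \<open>N0\<close> on. The finitely
  many larger scales have finite grids and only enlarge the constant.\<close>

lemma a_conv:
  assumes R: "\<And>i. R $ i \<le> R2 $ i"
  shows "\<exists>C. \<forall>\<epsilon>\<in>scales \<epsilon>0. \<forall>x\<in>Omega_disc J \<epsilon> R. norm (a \<epsilon> x - a0 x) \<le> C * \<epsilon>"
proof -
  obtain C where C: "0 \<le> C" "\<And>x n. x \<in> \<Omega>0 \<Longrightarrow> n \<ge> N0 \<Longrightarrow> norm (a (e n) (fl n x) - a0 x) \<le> C * e n"
    using a0_limit by blast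
  define F where "F = {\<epsilon> \<in> scales \<epsilon>0. e N0 \<le> \<epsilon>}"
  have "finite F" unfolding F_def by (rule finite_scales_ge) simp
  \<comment> \<open>A finite sum in place of a maximum, over all larger scales and all their grid
    points.\<close>
  define M where "M = (\<Sum>\<epsilon>\<in>F. \<Sum>x\<in>\<Omega> \<epsilon>. norm (a \<epsilon> x - a0 x) / \<epsilon>)"
  have M: "norm (a \<epsilon> x - a0 x) / \<epsilon> \<le> M" if "\<epsilon> \<in> F" "x \<in> \<Omega> \<epsilon>" for \<epsilon> x
  proof -
    have pos: "\<epsilon> > 0" if "\<epsilon> \<in> F" for \<epsilon> using that scales_pos by (auto simp: F_def)
    have "norm (a \<epsilon> x - a0 x) / \<epsilon> \<le> (\<Sum>x\<in>\<Omega> \<epsilon>. norm (a \<epsilon> x - a0 x) / \<epsilon>)"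
      using that pos[OF that(1)] finite_Omega_disc[OF pos[OF that(1)]]
      by (intro member_le_sum[where f = "\<lambda>x. norm (a \<epsilon> x - a0 x) / \<epsilon>"]) auto
    also have "\<dots> \<le> M"
      unfolding M_def using that pos \<open>finite F\<close>
      by (intro member_le_sum[where f = "\<lambda>\<epsilon>. \<Sum>x\<in>\<Omega> \<epsilon>. norm (a \<epsilon> x - a0 x) / \<epsilon>"])
        (auto intro!: sum_nonneg divide_nonneg_pos)
    finally show ?thesis .
  qed
  have "norm (a \<epsilon> x - a0 x) \<le> max C M * \<epsilon>" if \<epsilon>: "\<epsilon> \<in> scales \<epsilon>0" and x: "x \<in> Omega_disc J \<epsilon> R" for \<epsilon> x
  proof -
    have x': "x \<in> \<Omega> \<epsilon>" using x Omega_disc_mono[of R R2, OF R] by blast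
    have pos: "0 < \<epsilon>" using scales_pos[OF \<epsilon>] .
    show ?thesis
    proof (cases "e N0 \<le> \<epsilon>")
      case True
      then have "norm (a \<epsilon> x - a0 x) \<le> M * \<epsilon>"
        using M[of \<epsilon> x] \<epsilon> x' pos by (simp add: F_def pos_divide_le_eq)
      also have "\<dots> \<le> max C M * \<epsilon>" using pos by (intro mult_right_mono) auto
      finally show ?thesis .
    next
      case False
      then obtain n where n: "n \<ge> N0" "\<epsilon> = e n" using scales_index[OF \<epsilon>, of N0] by auto
      have "norm (a \<epsilon> x - a0 x) \<le> C * \<epsilon>"
        using C(2)[OF subsetD[OF Omega_disc_subset_lim x'] n(1)] grid_floor_id[OF pos x'] n(2) by simp
      also have "\<dots> \<le> max C M * \<epsilon>" using pos by (intro mult_right_mono) auto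
      finally show ?thesis .
    qed
  qed
  then show ?thesis by blast
qed

section \<open>Uniqueness for the limiting problem\<close>

lemma f0_continuous: "i \<in> E k \<Longrightarrow> continuous_on P (f 0 k i)"
  using local_lipschitz_continuous_on[OF f0_loc_lipschitz] by blast

text \<open>A solution of the limiting problem satisfies the discrete equations up to
  \<open>h * c\<close> uniformly on the box. For a merely continuous \<open>b\<close> this follows
  from uniform continuity of \<open>f 0\<close> along \<open>b\<close> on a compact box.\<close>

lemma limit_solution_consistent:
  assumes b: "limit_goursat_solution X E J R (f 0) g0 b" and "0 < c"
  shows "\<exists>h0>0. \<forall>h. 0 < h \<longrightarrow> h < h0 \<longrightarrow> (\<forall>k. \<forall>i\<in>E k \<inter> J. \<forall>x\<in>Omega_lim J R.
    x + h *\<^sub>R axis i 1 \<in> Omega_lim J R \<longrightarrow>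
      norm (b (x + h *\<^sub>R axis i 1) $ k - b x $ k - h *\<^sub>R f 0 k i (b x)) \<le> h * c)"
proof -
  have bP: "b ` Omega_lim J R \<subseteq> P" and bc: "continuous_on (Omega_lim J R) b"
    using b unfolding limit_goursat_solution_def by auto
  define \<Phi> where "\<Phi> = (\<lambda>(k, i) h0 (C::real). \<forall>x\<in>Omega_lim J R. \<forall>y\<in>Omega_lim J R.
      dist x y < h0 \<longrightarrow> dist (f 0 k i (b x)) (f 0 k i (b y)) < c)"
  have "\<exists>h0>0. \<exists>C\<ge>0. \<forall>z\<in>{(k, i). i \<in> E k}. \<Phi> z h0 C"
  proof (rule finite_uniform_constants)
    fix z assume "z \<in> {(k, i). i \<in> E k}"
    then obtain k i where z: "z = (k, i)" "i \<in> E k" by auto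
    have "continuous_on (Omega_lim J R) (\<lambda>x. f 0 k i (b x))"
      using continuous_on_compose2[OF f0_continuous[OF z(2)] bc bP] .
    then have "uniformly_continuous_on (Omega_lim J R) (\<lambda>x. f 0 k i (b x))"
      using compact_uniformly_continuous compact_Omega_lim by blast
    then show "\<exists>h0>0. \<exists>C. \<Phi> z h0 C"
      using \<open>0 < c\<close> unfolding uniformly_continuous_on_def \<Phi>_def z(1) prod.case
      by (metis dist_commute)
  qed (auto simp: \<Phi>_def)
  then obtain h0 C where h0: "h0 > 0" and *: "\<forall>z\<in>{(k, i). i \<in> E k}. \<Phi> z h0 C" by blast
  have "norm (b (x + h *\<^sub>R axis i 1) $ k - b x $ k - h *\<^sub>R f 0 k i (b x)) \<le> h * c"
    if h: "0 < h" "h < h0" and k: "i \<in> E k" "i \<in> J" and x: "x \<in> Omega_lim J R" "x + h *\<^sub>R axis i 1 \<in> Omega_lim J R"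
    for h k i x
  proof -
    have seg: "x + s *\<^sub>R axis i 1 \<in> Omega_lim J R" if "s \<in> {0..h}" for s
      using x(2) that x(1) unfolding line_in_Omega_lim[OF k(2) x(1)]
      by (auto simp: Omega_lim_def intro: order_trans[of _ 0])
    \<comment> \<open>The derivative along the box is restricted to the segment, which lies in it;
      this removes \<open>line_filter\<close> before the mean value estimate.\<close>
    have der: "((\<lambda>s. b (x + s *\<^sub>R axis i 1) $ k) has_vector_derivative f 0 k i (b (x + s *\<^sub>R axis i 1))) (at s within {0..h})"
      if s: "s \<in> {0..h}" for s
      unfolding has_vector_derivative_def has_derivative_within_alt
    proof (intro conjI allI impI)
      let ?y = "x + s *\<^sub>R axis i 1"
      let ?D = "f 0 k i (b ?y)"
      show "bounded_linear (\<lambda>t. t *\<^sub>R ?D)" by (rule bounded_linear_scaleR_left)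
      fix c' :: real assume "c' > 0"
      have "((\<lambda>t. b (?y + t *\<^sub>R axis i 1) $ k) has_vector_derivative ?D) (line_filter (Omega_lim J R) i ?y)"
        using b k seg[OF s] unfolding limit_goursat_solution_def by blast
      then obtain d where d: "d > 0" "\<And>t. ?y + t *\<^sub>R axis i 1 \<in> Omega_lim J R \<Longrightarrow> norm t < d \<Longrightarrow>
          norm (b (?y + t *\<^sub>R axis i 1) $ k - b ?y $ k - t *\<^sub>R ?D) \<le> c' * norm t"
        unfolding line_filter_def has_vector_derivative_def has_derivative_within_alt using \<open>c' > 0\<close> by auto
      have "norm (b (x + t *\<^sub>R axis i 1) $ k - b ?y $ k - (t - s) *\<^sub>R ?D) \<le> c' * norm (t - s)"
        if t: "t \<in> {0..h}" "norm (t - s) < d" for t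
      proof -
        have eq: "?y + (t - s) *\<^sub>R axis i 1 = x + t *\<^sub>R axis i 1" by (simp add: algebra_simps)
        show ?thesis using d(2)[of "t - s", unfolded eq] seg[OF t(1)] t(2) by simp
      qed
      then show "\<exists>d>0. \<forall>t\<in>{0..h}. norm (t - s) < d \<longrightarrow>
          norm (b (x + t *\<^sub>R axis i 1) $ k - b ?y $ k - (t - s) *\<^sub>R ?D) \<le> c' * norm (t - s)"
        using d(1) by blast
    qed
    have "norm (b (x + h *\<^sub>R axis i 1) $ k - b (x + 0 *\<^sub>R axis i 1) $ k - (h - 0) *\<^sub>R f 0 k i (b (x + 0 *\<^sub>R axis i 1))) \<le> norm (h - 0) * c"
    proof (rule vector_differentiable_bound_linearization[OF der])
      fix s assume s: "s \<in> {0..h}"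
      have "dist (x + s *\<^sub>R axis i 1) (x + 0 *\<^sub>R axis i 1) < h0"
        using s h by (simp add: dist_norm norm_axis_1)
      then show "norm (f 0 k i (b (x + s *\<^sub>R axis i 1)) - f 0 k i (b (x + 0 *\<^sub>R axis i 1))) \<le> c"
        using *[rule_format, of "(k, i)"] k(1) seg[OF s] x(1) unfolding \<Phi>_def dist_norm by force
    qed (use h in \<open>auto simp: closed_segment_eq_real_ivl\<close>)
    then show ?thesis using h by simp
  qed
  then show ?thesis using h0 by (intro exI[of _ h0]) auto
qed

text \<open>Both solutions nearly solve the same discrete problem with the same data, so Gronwall
  bounds their difference on the grids by a multiple of an arbitrary \<open>c\<close>; continuity
  carries this to all points through the rounded ones.\<close>

lemma limit_solution_unique:
  assumes b: "limit_goursat_solution X E J rb (f 0) g0 b" and x: "x \<in> Omega_lim J rb"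
  shows "b x = a0 x"
proof -
  let ?O = "Omega_lim J rb"
  note sa = a0_solution
  have bP: "b ` ?O \<subseteq> P" and bc: "continuous_on ?O b" using b unfolding limit_goursat_solution_def by auto
  have aP: "a0 ` ?O \<subseteq> P" and ac: "continuous_on ?O a0" using sa unfolding limit_goursat_solution_def by auto
  \<comment> \<open>Nothing places \<open>b\<close> near the states \<open>A\<close>, so the
    Lipschitz constant is taken on the compact set of all values of the two solutions.\<close>
  define Q where "Q = a0 ` ?O \<union> b ` ?O"
  have Q: "compact Q" "Q \<subseteq> P"
    using aP bP compact_continuous_image[OF ac compact_Omega_lim] compact_continuous_image[OF bc compact_Omega_lim]
    by (auto simp: Q_def)
  define \<Phi> where "\<Phi> = (\<lambda>(k, i) (\<delta>::real) M. M-lipschitz_on Q (f 0 k i))"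
  have "\<exists>\<delta>>0. \<exists>M\<ge>0. \<forall>z\<in>{(k, i). i \<in> E k}. \<Phi> z \<delta> M"
  proof (rule finite_uniform_constants)
    fix z assume "z \<in> {(k, i). i \<in> E k}"
    then obtain k i where z: "z = (k, i)" "i \<in> E k" by auto
    have "local_lipschitz {0} Q (\<lambda>\<epsilon>. f \<epsilon> k i)"
      using local_lipschitz_subset[OF f0_loc_lipschitz[OF z(2)]] Q(2) by blast
    then obtain M where "\<And>t. t \<in> {0} \<Longrightarrow> M-lipschitz_on Q (f t k i)"
      by (rule local_lipschitz_compact_implies_lipschitz[OF _ Q(1) compact_sing]) auto
    then show "\<exists>\<delta>>0. \<exists>M. \<Phi> z \<delta> M"
      unfolding \<Phi>_def z(1) prod.case by (intro exI[of _ 1]) auto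
  qed (auto simp: \<Phi>_def intro: lipschitz_on_mono)
  then obtain \<delta>' M where M: "M \<ge> 0" and *: "\<forall>z\<in>{(k, i). i \<in> E k}. \<Phi> z \<delta>' M" by blast
  have lip: "norm (f 0 k i p - f 0 k i q) \<le> M * norm (p - q)" if "i \<in> E k" "p \<in> Q" "q \<in> Q" for k i p q
    using *[rule_format, of "(k, i)"] that lipschitz_on_normD unfolding \<Phi>_def by fastforce
  define K where "K = CARD('k) * (2 * exp ((M * CARD('k) + 1) * coord_sum r))"
  have K: "0 \<le> K" by (simp add: K_def)
  have rb_r: "rb $ i \<le> r $ i" for i
    using \<rho>_le[of i] \<rho>_pos by (cases "i \<in> J") (simp_all add: rb_def set_coords_def)
  have small: "\<exists>N. \<forall>n\<ge>N. \<forall>x\<in>Omega_disc J (e n) rb. norm (a0 x - b x) \<le> K * c" if c: "c > 0" for c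
  proof -
    obtain ha where ha: "ha > 0" "\<And>h k i x. 0 < h \<Longrightarrow> h < ha \<Longrightarrow> i \<in> E k \<inter> J \<Longrightarrow> x \<in> ?O \<Longrightarrow> x + h *\<^sub>R axis i 1 \<in> ?O \<Longrightarrow>
        norm (a0 (x + h *\<^sub>R axis i 1) $ k - a0 x $ k - h *\<^sub>R f 0 k i (a0 x)) \<le> h * c"
      using limit_solution_consistent[OF sa c] by blast
    obtain hb where hb: "hb > 0" "\<And>h k i x. 0 < h \<Longrightarrow> h < hb \<Longrightarrow> i \<in> E k \<inter> J \<Longrightarrow> x \<in> ?O \<Longrightarrow> x + h *\<^sub>R axis i 1 \<in> ?O \<Longrightarrow>
        norm (b (x + h *\<^sub>R axis i 1) $ k - b x $ k - h *\<^sub>R f 0 k i (b x)) \<le> h * c"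
      using limit_solution_consistent[OF b c] by blast
    obtain N where N: "\<forall>n\<ge>N. e n \<in> scales \<epsilon>0 \<and> e n < min ha hb"
      using eventually_scales[OF eps0_pos, of "min ha hb"] ha(1) hb(1) by auto
    have "norm (a0 x - b x) \<le> K * c" if n: "n \<ge> N" and x: "x \<in> Omega_disc J (e n) rb" for n x
    proof -
      let ?S = "Omega_disc J (e n) rb"
      have \<epsilon>: "e n \<in> scales \<epsilon>0" "e n < ha" "e n < hb" using N n by auto
      have S: "?S \<subseteq> ?O" by (rule Omega_disc_subset_lim)
      define u where "u k x = norm (a0 x $ k - b x $ k)" for k x
      \<comment> \<open>Zero for the common data, and one consistency error \<open>c\<close> for
        each solution.\<close>
      have "u k x \<le> (0 + 2 * c) * exp ((M * CARD('k) + 1) * coord_sum r)" for k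
      proof (rule grid_gronwall[OF \<epsilon>(1), where S = ?S and u = u and R = rb])
        fix x j assume "x \<in> ?S" "0 < x $ j"
        then show "x - mesh J (e n) j *\<^sub>R axis j 1 \<in> ?S" by (intro Omega_disc_back) auto
      next
        fix k x assume "x \<in> goursat_set ?S (E k)"
        then have "x \<in> goursat_set ?O (E k)" using goursat_set_mono[OF S] by blast
        then show "u k x \<le> 0"
          using sa b unfolding limit_goursat_solution_def u_def by simp
      next
        fix k j B and w :: "real ^ 'd"
        let ?h = "mesh J (e n) j"
        assume w: "w \<in> ?S" and x: "w + ?h *\<^sub>R axis j 1 \<in> ?S" and j: "j \<in> E k" and B: "0 \<le> B" "\<And>l. u l w \<le> B"
        have w': "w \<in> ?O" "w + ?h *\<^sub>R axis j 1 \<in> ?O" using w x S by auto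
        have "norm (a0 w - b w) \<le> CARD('k) * B"
          by (rule norm_vec_le) (use B(2) in \<open>simp add: u_def\<close>)
        then have "M * norm (a0 w - b w) \<le> M * (CARD('k) * B)" using M by (rule mult_left_mono)
        then have fd: "norm (f 0 k j (a0 w) - f 0 k j (b w)) \<le> M * CARD('k) * B"
          using lip[OF j, of "a0 w" "b w"] w'(1) by (simp add: Q_def)
        have h: "0 < ?h" by (rule mesh_pos) simp
        \<comment> \<open>In directions outside \<open>J\<close> the equations are already discrete
          and the error is zero.\<close>
        have cons: "norm (a0 (w + ?h *\<^sub>R axis j 1) $ k - a0 w $ k - ?h *\<^sub>R f 0 k j (a0 w)) \<le> ?h * c \<and>
            norm (b (w + ?h *\<^sub>R axis j 1) $ k - b w $ k - ?h *\<^sub>R f 0 k j (b w)) \<le> ?h * c"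
        proof (cases "j \<in> J")
          case True
          then have "?h = e n" by (simp add: mesh_def)
          then show ?thesis
            using ha(2)[of ?h j k w] hb(2)[of ?h j k w] \<epsilon>(2,3) True j w' by simp
        next
          case False
          then have h1: "?h = 1" by (simp add: mesh_def)
          have "diff_quot 1 j (\<lambda>y. a0 y $ k) w = f 0 k j (a0 w)" "diff_quot 1 j (\<lambda>y. b y $ k) w = f 0 k j (b w)"
            using sa b w' j False unfolding limit_goursat_solution_def h1 by auto
          then show ?thesis unfolding h1 using c by (auto simp: diff_quot_def)
        qed
        have tri: "norm (p + q + s - t) \<le> B1 + B2 + B3 + B4"
          if "norm p \<le> B1" "norm q \<le> B2" "norm s \<le> B3" "norm t \<le> B4" for p q s t :: 'v and B1 B2 B3 B4
          by (intro norm_triangle_le_diff norm_triangle_le add_mono that)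
        have "u k (w + ?h *\<^sub>R axis j 1) = norm ((a0 w $ k - b w $ k) + ?h *\<^sub>R (f 0 k j (a0 w) - f 0 k j (b w))
            + (a0 (w + ?h *\<^sub>R axis j 1) $ k - a0 w $ k - ?h *\<^sub>R f 0 k j (a0 w))
            - (b (w + ?h *\<^sub>R axis j 1) $ k - b w $ k - ?h *\<^sub>R f 0 k j (b w)))"
          unfolding u_def by (simp add: algebra_simps)
        also have "\<dots> \<le> B + ?h * (M * CARD('k) * B) + ?h * c + ?h * c"
        proof (rule tri)
          show "norm (a0 w $ k - b w $ k) \<le> B" using B(2)[of k] by (simp add: u_def)
          show "norm (?h *\<^sub>R (f 0 k j (a0 w) - f 0 k j (b w))) \<le> ?h * (M * CARD('k) * B)"
            using fd h by (simp add: mult_left_mono)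
        qed (use cons in auto)
        finally show "u k (w + ?h *\<^sub>R axis j 1) \<le> 0 \<or> u k (w + ?h *\<^sub>R axis j 1) \<le> B + ?h * (M * CARD('k) * B + 2 * c)"
          by (simp add: algebra_simps)
      qed (use M c x rb_r in auto)
      then have "norm ((a0 x - b x) $ k) \<le> 2 * exp ((M * CARD('k) + 1) * coord_sum r) * c" for k
        by (simp add: u_def mult_ac)
      then have "norm (a0 x - b x) \<le> CARD('k) * (2 * exp ((M * CARD('k) + 1) * coord_sum r) * c)"
        by (rule norm_vec_le)
      then show ?thesis by (simp add: K_def mult.assoc)
    qed
    then show ?thesis by blast
  qed
  have seq: "(\<lambda>n. norm (a0 (fl n x) - b (fl n x))) \<longlonglongrightarrow> norm (a0 x - b x)"
  proof -
    have "\<forall>n. fl n x \<in> ?O" using fl_in[OF x] Omega_disc_subset_lim by blast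
    then show ?thesis
      using ac bc x fl_lim_vec[of x] unfolding continuous_on_sequentially o_def
      by (intro tendsto_intros) auto
  qed
  have le: "norm (a0 x - b x) \<le> K * c" if "c > 0" for c
  proof (rule LIMSEQ_le_const2[OF seq])
    show "\<exists>N. \<forall>n\<ge>N. norm (a0 (fl n x) - b (fl n x)) \<le> K * c"
      using small[OF that] fl_in[OF x] by blast
  qed
  have "norm (a0 x - b x) \<le> c" if "c > 0" for c
  proof -
    have "norm (a0 x - b x) \<le> K * (c / (K + 1))"
      by (rule le) (use that K in simp)
    also have "\<dots> \<le> c" using that K by (simp add: field_simps)
    finally show ?thesis .
  qed
  then have "norm (a0 x - b x) \<le> 0" by (rule field_le_epsilon[of _ 0, simplified])
  then show ?thesis by simp
qed

end

section \<open>Bounds for difference quotients\<close>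

text \<open>Each of the finitely many derivatives is bounded at \<open>q\<close> and changes by at
  most 1 nearby.\<close>

lemma Cm_derivatives_locally_bounded:
  fixes f :: "'a::real_normed_vector \<Rightarrow> 'b::real_normed_vector"
  assumes D: "Cm_derivatives P m f D" and q: "q \<in> P"
  shows "\<exists>\<delta>>0. \<exists>B. \<forall>j\<le>m. \<forall>b\<in>P. dist b q < \<delta> \<longrightarrow> (\<forall>hs\<in>unit_lists P j. norm (D b hs) \<le> B)"
proof -
  have "\<exists>\<delta>>0. \<exists>B\<ge>0. \<forall>j\<in>{..m}. \<forall>b\<in>P. dist b q < \<delta> \<longrightarrow> (\<forall>hs\<in>unit_lists P j. norm (D b hs) \<le> B)"
  proof (rule finite_uniform_constants[where \<Phi> = "\<lambda>j \<delta> B. \<forall>b\<in>P. dist b q < \<delta> \<longrightarrow>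
        (\<forall>hs\<in>unit_lists P j. norm (D b hs) \<le> B)"])
    fix j assume "j \<in> {..m}"
    then have j: "j \<le> m" by simp
    obtain \<delta> where \<delta>: "\<delta> > 0" "\<forall>b\<in>P. dist b q < \<delta> \<longrightarrow> (\<forall>hs\<in>unit_lists P j. norm (D b hs - D q hs) \<le> 1)"
      using D q j zero_less_one unfolding Cm_derivatives_def by meson
    have "bounded_multilinear_on P j (D q)"
      using D q j unfolding Cm_derivatives_def by blast
    then obtain B where B: "\<forall>hs\<in>unit_lists P j. norm (D q hs) \<le> B"
      unfolding bounded_multilinear_on_def by blast
    have "norm (D b hs) \<le> B + 1" if "b \<in> P" "dist b q < \<delta>" "hs \<in> unit_lists P j" for b hs
    proof -
      have "norm (D b hs) \<le> norm (D q hs) + norm (D b hs - D q hs)"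
        by (rule norm_triangle_sub)
      also have "\<dots> \<le> B + 1" using \<delta>(2) B that by (intro add_mono) auto
      finally show ?thesis .
    qed
    then show "\<exists>\<delta>>0. \<exists>B. \<forall>b\<in>P. dist b q < \<delta> \<longrightarrow> (\<forall>hs\<in>unit_lists P j. norm (D b hs) \<le> B)"
      using \<delta>(1) by (intro exI[of _ \<delta>] conjI exI[of _ "B + 1"]) auto
  next
    fix j \<delta> B \<delta>' B'
    assume *: "\<forall>b\<in>P. dist b q < \<delta> \<longrightarrow> (\<forall>hs\<in>unit_lists P j. norm (D b hs) \<le> B)" "\<delta>' \<le> \<delta>" "B \<le> (B' :: real)"
    show "\<forall>b\<in>P. dist b q < \<delta>' \<longrightarrow> (\<forall>hs\<in>unit_lists P j. norm (D b hs) \<le> B')"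
    proof (intro ballI impI)
      fix b hs assume "b \<in> P" "dist b q < \<delta>'" "hs \<in> unit_lists P j"
      then have "norm (D b hs) \<le> B" using * by auto
      then show "norm (D b hs) \<le> B'" using *(3) by simp
    qed
  qed simp
  then obtain \<delta> B where "\<delta> > 0" and B: "\<forall>j\<in>{..m}. \<forall>b\<in>P. dist b q < \<delta> \<longrightarrow> (\<forall>hs\<in>unit_lists P j. norm (D b hs) \<le> B)"
    by (elim exE conjE)
  then show ?thesis
    by (intro exI[of _ \<delta>] conjI exI[of _ B]) auto
qed

text \<open>On a compact set the limit derivatives are bounded and those at small scales are within
  1 of them. \<open>uniform_near_compact\<close> extends this common bound to a neighbourhood, where
  the convergence itself is not known to be uniform.\<close>

lemma Cm_loc_convergent_bounded:
  fixes F :: "real \<Rightarrow> 'a::real_normed_vector \<Rightarrow> 'b::real_normed_vector"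
  assumes conv: "Cm_loc_convergent S P m F" and Q: "compact Q" "Q \<subseteq> P"
  shows "\<exists>\<delta>>0. \<exists>B. \<exists>D. (\<forall>\<epsilon>\<in>S. Cm_derivatives P m (F \<epsilon>) (D \<epsilon>)) \<and>
    (\<forall>\<epsilon>\<in>S. \<epsilon> < \<delta> \<longrightarrow> (\<forall>q\<in>Q. \<forall>b\<in>P. dist b q < \<delta> \<longrightarrow>
      (\<forall>j\<le>m. \<forall>hs\<in>unit_lists P j. norm (D \<epsilon> b hs) \<le> B)))"
proof -
  obtain D where D: "\<forall>\<epsilon>\<in>insert 0 S. Cm_derivatives P m (F \<epsilon>) (D \<epsilon>)"
    and Dc': "\<forall>Q. compact Q \<and> Q \<subseteq> P \<longrightarrow> (\<forall>j\<le>m. \<forall>e>0. \<exists>\<eta>>0. \<forall>\<epsilon>\<in>S. \<epsilon> < \<eta> \<longrightarrow>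
      (\<forall>a\<in>Q. \<forall>hs\<in>unit_lists P j. norm (D \<epsilon> a hs - D 0 a hs) \<le> e))"
    using conv unfolding Cm_loc_convergent_def by (elim exE conjE)
  have Dc: "\<exists>\<eta>>0. \<forall>\<epsilon>\<in>S. \<epsilon> < \<eta> \<longrightarrow> (\<forall>a\<in>Q. \<forall>hs\<in>unit_lists P j. norm (D \<epsilon> a hs - D 0 a hs) \<le> e)"
    if "compact Q" "Q \<subseteq> P" "j \<le> m" "e > 0" for Q j e
    by (rule Dc'[THEN spec, THEN mp, THEN spec, THEN mp, THEN spec, THEN mp]) (use that in simp_all)
  \<comment> \<open>One index plays two roles, threshold for the scale and bound for the
    derivatives, so that a single \<open>n\<close> controls both.\<close>
  define R where "R n b \<longleftrightarrow> (\<exists>\<epsilon>\<in>S. \<epsilon> < 1 / Suc n \<and> (\<exists>j\<le>m. \<exists>hs\<in>unit_lists P j. norm (D \<epsilon> b hs) > real n))"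
    for n :: nat and b
  have "\<exists>\<delta>>0. \<exists>n. \<forall>q\<in>Q. \<forall>b\<in>P. dist b q < \<delta> \<longrightarrow> \<not> R n b"
  proof (rule uniform_near_compact[OF _ _ Q])
    fix Q' assume Q': "compact Q'" "Q' \<subseteq> P"
    define R0 where "R0 n b \<longleftrightarrow> (\<exists>j\<le>m. \<exists>hs\<in>unit_lists P j. norm (D 0 b hs) > real n)" for n :: nat and b
    have "\<exists>\<delta>>0. \<exists>n. \<forall>q\<in>Q'. \<forall>b\<in>P. dist b q < \<delta> \<longrightarrow> \<not> R0 n b"
    proof (rule uniform_near_compact_of_local[OF _ _ Q'(1)])
      fix q assume "q \<in> Q'"
      then have "q \<in> P" using Q'(2) by blast
      obtain \<delta> B where \<delta>: "\<delta> > 0" "\<forall>j\<le>m. \<forall>b\<in>P. dist b q < \<delta> \<longrightarrow> (\<forall>hs\<in>unit_lists P j. norm (D 0 b hs) \<le> B)"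
        using Cm_derivatives_locally_bounded[OF D[rule_format, of 0] \<open>q \<in> P\<close>] by auto
      have "\<not> R0 (nat \<lceil>B\<rceil>) b" if "b \<in> P" "dist b q < \<delta>" for b
      proof -
        have "norm (D 0 b hs) \<le> real (nat \<lceil>B\<rceil>)" if "j \<le> m" "hs \<in> unit_lists P j" for j hs
          using \<delta>(2) \<open>b \<in> P\<close> \<open>dist b q < \<delta>\<close> that real_nat_ceiling_ge[of B] by (meson order_trans)
        then show ?thesis unfolding R0_def by (auto simp: not_less)
      qed
      then show "\<exists>\<delta>>0. \<exists>n. \<forall>b\<in>P. dist b q < \<delta> \<longrightarrow> \<not> R0 n b"
        using \<delta>(1) by blast
    next
      fix k n b assume "R0 n b" "k \<le> n"
      then show "R0 k b" unfolding R0_def by (meson le_less_trans of_nat_le_iff)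
    qed
    then obtain n0 where n0: "\<And>b. b \<in> Q' \<Longrightarrow> \<not> R0 n0 b" using Q'(2) by (metis dist_self subsetD)
    have "\<exists>\<eta>>0. \<exists>C\<ge>(0::real). \<forall>j\<in>{..m}. \<forall>\<epsilon>\<in>S. \<epsilon> < \<eta> \<longrightarrow> (\<forall>a\<in>Q'. \<forall>hs\<in>unit_lists P j. norm (D \<epsilon> a hs - D 0 a hs) \<le> 1)"
      by (rule finite_uniform_constants[where \<Phi> = "\<lambda>j \<eta> C. \<forall>\<epsilon>\<in>S. \<epsilon> < \<eta> \<longrightarrow>
            (\<forall>a\<in>Q'. \<forall>hs\<in>unit_lists P j. norm (D \<epsilon> a hs - D 0 a hs) \<le> 1)"])
        (use Dc[OF Q' _ zero_less_one] in auto)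
    then obtain \<eta> where "\<eta> > 0" and \<eta>': "\<forall>j\<in>{..m}. \<forall>\<epsilon>\<in>S. \<epsilon> < \<eta> \<longrightarrow>
        (\<forall>a\<in>Q'. \<forall>hs\<in>unit_lists P j. norm (D \<epsilon> a hs - D 0 a hs) \<le> 1)"
      by (elim exE conjE)
    then have \<eta>: "\<eta> > 0" "\<And>j \<epsilon> a hs. j \<le> m \<Longrightarrow> \<epsilon> \<in> S \<Longrightarrow> \<epsilon> < \<eta> \<Longrightarrow> a \<in> Q' \<Longrightarrow> hs \<in> unit_lists P j \<Longrightarrow>
        norm (D \<epsilon> a hs - D 0 a hs) \<le> 1"
      by auto
    obtain n1 where n1: "1 / Suc n1 < \<eta>" using nat_approx_posE[OF \<eta>(1)] by metis
    \<comment> \<open>\<open>Suc n0\<close> makes room for the deviation 1 from the limit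
      derivatives, \<open>n1\<close> forces the scale below \<eta>.\<close>
    define n where "n = max (Suc n0) n1"
    have "1 / Suc n \<le> 1 / Suc n1" by (simp add: n_def frac_le)
    then have n\<eta>: "1 / Suc n < \<eta>" using n1 by simp
    have "\<not> R n b" if b: "b \<in> Q'" for b
    proof -
      have "norm (D \<epsilon> b hs) \<le> real n" if "\<epsilon> \<in> S" "\<epsilon> < 1 / Suc n" "j \<le> m" "hs \<in> unit_lists P j" for \<epsilon> j hs
      proof -
        have "norm (D \<epsilon> b hs) \<le> norm (D 0 b hs) + norm (D \<epsilon> b hs - D 0 b hs)"
          by (rule norm_triangle_sub)
        also have "\<dots> \<le> real n0 + 1"
          using n0[OF b] that n\<eta> b unfolding R0_def by (intro add_mono \<eta>(2)[of j]) (auto simp: not_less)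
        also have "\<dots> \<le> real n" by (simp add: n_def)
        finally show ?thesis .
      qed
      then show ?thesis unfolding R_def by (auto simp: not_less)
    qed
    then show "\<exists>n. \<forall>b\<in>Q'. \<not> R n b" by blast
  next
    fix k n b assume R: "R n b" and "k \<le> n"
    have "1 / Suc n \<le> 1 / Suc k" using \<open>k \<le> n\<close> by (simp add: frac_le)
    moreover have "real k \<le> real n" using \<open>k \<le> n\<close> by simp
    ultimately show "R k b" using R unfolding R_def by (meson le_less_trans less_le_trans)
  qed
  then obtain \<delta> n where \<delta>: "\<delta> > 0" "\<forall>q\<in>Q. \<forall>b\<in>P. dist b q < \<delta> \<longrightarrow> \<not> R n b" by blast
  define \<delta>' where "\<delta>' = min \<delta> (1 / Suc n)"
  have "\<delta>' > 0" using \<delta>(1) by (simp add: \<delta>'_def)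
  moreover have "norm (D \<epsilon> b hs) \<le> real n"
    if "\<epsilon> \<in> S" "\<epsilon> < \<delta>'" "q \<in> Q" "b \<in> P" "dist b q < \<delta>'" "j \<le> m" "hs \<in> unit_lists P j" for \<epsilon> q b j hs
  proof -
    have "\<not> R n b" using \<delta>(2) that by (auto simp: \<delta>'_def)
    then show ?thesis using that unfolding R_def by (auto simp: \<delta>'_def not_less)
  qed
  ultimately show ?thesis using D by (intro exI[of _ \<delta>'] conjI exI[of _ "real n"] exI[of _ D]) auto
qed

section \<open>Shifted points and quotient boxes inside the grid\<close>

lemma shift_Nil: "shift h [] x = x"
  and shift_Cons: "shift h (j # js) x = shift h js x + h *\<^sub>R axis j 1"
  by (simp_all add: shift_def add_ac)

lemma shift_add: "shift h js (x + v) = shift h js x + v"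
  by (simp add: shift_def add_ac)

lemma shift_diff: "shift h js (x - v) = shift h js x - v"
  by (simp add: shift_def)

lemma shift_nth: "shift h js x $ i = x $ i + h * count_list js i"
  by (induction js) (auto simp: shift_Nil shift_Cons axis_def algebra_simps)

lemma shift_perm: "mset js = mset js' \<Longrightarrow> shift h js x = shift h js' x"
  unfolding shift_def by (metis mset_map sum_mset_sum_list)

text \<open>A box that contains two opposite corners contains what lies between them; thus a point
  and its full shift are the only membership conditions that need to be recorded for a
  quotient.\<close>

lemma shift_Cons_in_disc:
  assumes h: "0 < h" and j: "j \<in> J" and x: "x \<in> Omega_disc J h R" "shift h (j # js) x \<in> Omega_disc J h R"
  shows "shift h js x \<in> Omega_disc J h R" "x + h *\<^sub>R axis j 1 \<in> Omega_disc J h R"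
proof -
  have "x $ j + h \<le> x $ j + h * count_list (j # js) j"
    using h by simp
  also have "\<dots> = shift h (j # js) x $ j"
    unfolding shift_nth ..
  finally have le: "x $ j + h \<le> shift h (j # js) x $ j" .
  then have "0 < shift h (j # js) x $ j"
    using Omega_disc_nonneg[OF x(1), of j] h by linarith
  from Omega_disc_back[OF h x(2) this] show "shift h js x \<in> Omega_disc J h R"
    using j by (simp add: shift_Cons mesh_def)
  have "x $ j + mesh J h j \<le> R $ j"
    using le Omega_disc_le[OF x(2), of j] j by (simp add: mesh_def)
  from Omega_disc_step[OF h x(1) this] show "x + h *\<^sub>R axis j 1 \<in> Omega_disc J h R"
    using j by (simp add: mesh_def)
qed

lemma diff_box_subset_disc:
  assumes "0 < h" "set js \<subseteq> J" "x \<in> Omega_disc J h R" "shift h js x \<in> Omega_disc J h R"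
  shows "diff_box h js x \<subseteq> Omega_disc J h R"
  using assms(2-)
proof (induction js arbitrary: x)
  case (Cons j js)
  have j: "j \<in> J" "set js \<subseteq> J" using Cons.prems(1) by auto
  note in' = shift_Cons_in_disc[OF assms(1) j(1) Cons.prems(2,3)]
  have "shift h js (x + h *\<^sub>R axis j 1) \<in> Omega_disc J h R"
    using Cons.prems(3) by (simp add: shift_add shift_Cons)
  then show ?case
    using Cons.IH[OF j(2) Cons.prems(2) in'(1)] Cons.IH[OF j(2) in'(2)] by simp
qed simp

lemma diff_box_nth: "z \<in> diff_box h js x \<Longrightarrow> i \<notin> set js \<Longrightarrow> z $ i = x $ i"
  by (induction js arbitrary: x) (auto simp: axis_def)

lemma diff_box_dist:
  fixes h :: real
  assumes "0 < h" "z \<in> diff_box h js x"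
  shows "(\<Sum>i\<in>UNIV. \<bar>z $ i - x $ i\<bar>) \<le> length js * h"
  using assms(2)
proof (induction js arbitrary: x)
  case (Cons j js)
  from Cons.prems consider "z \<in> diff_box h js x" | "z \<in> diff_box h js (x + h *\<^sub>R axis j 1)" by auto
  then show ?case
  proof cases
    case 1
    then show ?thesis using Cons.IH[of x] assms(1) by (simp add: algebra_simps)
  next
    case 2
    have "(\<Sum>i\<in>UNIV. \<bar>z $ i - x $ i\<bar>)
        \<le> (\<Sum>i\<in>UNIV. \<bar>z $ i - (x + h *\<^sub>R axis j 1) $ i\<bar> + (if j = i then h else 0))"
      using assms(1) by (intro sum_mono) (auto simp: axis_def)
    also have "\<dots> \<le> length js * h + h"
      using Cons.IH[OF 2] by (simp add: sum.distrib)
    finally show ?thesis by (simp add: algebra_simps)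
  qed
qed simp

text \<open>\<open>pre\<close> collects the directions already differenced. Of all quotients in
  \<open>diff_bound\<close>, only the one along the whole list at \<open>y\<close> can reach order
  \<open>l\<close>; it is supplied separately, the others by the lower order bound.\<close>

lemma diff_bound_intro:
  fixes u :: "real ^ 'd::finite \<Rightarrow> 'v::real_normed_vector"
  assumes "0 < h"
    and low: "\<And>ss y. set ss \<subseteq> J \<Longrightarrow> length ss < l \<Longrightarrow> y \<in> Omega_disc J h R \<Longrightarrow> shift h ss y \<in> Omega_disc J h R \<Longrightarrow>
      norm (iter_diff_quot h ss u y) \<le> U"
    and "length (is @ pre) \<le> l" "set (is @ pre) \<subseteq> J" "y \<in> Omega_disc J h R" "shift h (is @ pre) y \<in> Omega_disc J h R"
    and "norm (iter_diff_quot h (is @ pre) u y) \<le> U"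
  shows "diff_bound h U is y (iter_diff_quot h pre u)"
  using assms(3-)
proof (induction "is" arbitrary: pre y)
  case Nil
  then show ?case by simp
next
  case (Cons i "is")
  have i: "i \<in> J" using Cons.prems(2) by simp
  have sh: "shift h (i # (is @ pre)) y \<in> Omega_disc J h R" using Cons.prems(4) by simp
  note in' = shift_Cons_in_disc[OF assms(1) i Cons.prems(3) sh]
  have sh': "shift h (is @ pre) (y + h *\<^sub>R axis i 1) \<in> Omega_disc J h R"
    using sh by (simp add: shift_add shift_Cons)
  have "diff_bound h U is y (iter_diff_quot h pre u)"
    using Cons.prems in' by (intro Cons.IH low) auto
  moreover have "diff_bound h U is (y + h *\<^sub>R axis i 1) (iter_diff_quot h pre u)"
    using Cons.prems in' sh' by (intro Cons.IH low) auto
  moreover have "diff_bound h U is y (iter_diff_quot h (i # pre) u)"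
  proof (rule Cons.IH)
    have "mset (is @ i # pre) = mset ((i # is) @ pre)" by simp
    then show "shift h (is @ i # pre) y \<in> Omega_disc J h R"
      using Cons.prems(4) shift_perm by metis
    have "iter_diff_quot h (is @ i # pre) u = iter_diff_quot h ((i # is) @ pre) u"
      unfolding iter_diff_quot_append iter_diff_quot_Cons'[of h i "is"] by simp
    then show "norm (iter_diff_quot h (is @ i # pre) u y) \<le> U"
      using Cons.prems(5) by (simp del: iter_diff_quot.simps)
  qed (use Cons.prems in auto)
  ultimately show ?case by simp
qed

lemma diff_bound'_intro:
  fixes u :: "real ^ 'd::finite \<Rightarrow> 'v::real_normed_vector"
  assumes "0 < h"
    and low: "\<And>ss y. set ss \<subseteq> J \<Longrightarrow> length ss \<le> l \<Longrightarrow> y \<in> Omega_disc J h R \<Longrightarrow> shift h ss y \<in> Omega_disc J h R \<Longrightarrow>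
      norm (iter_diff_quot h ss u y) \<le> U"
    and "length is \<le> l" "set is \<subseteq> J" "y \<in> Omega_disc J h R" "shift h is y \<in> Omega_disc J h R"
  shows "diff_bound' h U is y u"
  using assms(3-)
proof (induction "is" arbitrary: y)
  case (Cons i "is")
  have i: "i \<in> J" using Cons.prems(2) by simp
  note in' = shift_Cons_in_disc[OF assms(1) i Cons.prems(3,4)]
  have sh': "shift h is (y + h *\<^sub>R axis i 1) \<in> Omega_disc J h R"
    using Cons.prems(4) by (simp add: shift_add shift_Cons)
  have eq: "mset (is @ [i]) = mset (i # is)" by simp
  have "diff_bound h U is y (iter_diff_quot h [i] u)"
  proof (rule diff_bound_intro[OF assms(1) low, where l = l])
    show "shift h (is @ [i]) y \<in> Omega_disc J h R"
      using Cons.prems(4) shift_perm[OF eq] by metis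
    then show "norm (iter_diff_quot h (is @ [i]) u y) \<le> U"
      using Cons.prems by (intro low) auto
  qed (use Cons.prems in auto)
  then show ?case
    using Cons.IH[of y] Cons.IH[of "y + h *\<^sub>R axis i 1"] Cons.prems in' sh' by simp
qed simp

context goursat_region begin

lemma compact_image_a0: "compact (a0 ` \<Omega>0)" and image_a0_P: "a0 ` \<Omega>0 \<subseteq> P"
proof -
  obtain L' where "L'-lipschitz_on \<Omega>0 a0" using a0_lipschitz by blast
  then show "compact (a0 ` \<Omega>0)"
    using compact_continuous_image[OF lipschitz_on_continuous_on compact_Omega_lim] by blast
  show "a0 ` \<Omega>0 \<subseteq> P" using a0_P by blast
qed

text \<open>Packs derivatives and their bound near the limit values into a statement monotone in
  \<delta> and \<open>B\<close>, as \<open>finite_uniform_constants\<close> requires.\<close>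

definition field_bounded :: "nat \<Rightarrow> 'k \<Rightarrow> 'd \<Rightarrow> real \<Rightarrow> real \<Rightarrow> bool" where
  "field_bounded m k i \<delta>' B \<longleftrightarrow> (\<exists>D. (\<forall>\<epsilon>\<in>scales \<epsilon>0. Cm_derivatives P m (f \<epsilon> k i) (D \<epsilon>)) \<and>
    (\<forall>\<epsilon>\<in>scales \<epsilon>0. \<epsilon> < \<delta>' \<longrightarrow> (\<forall>q\<in>a0 ` \<Omega>0. \<forall>b\<in>P. dist b q < \<delta>' \<longrightarrow>
      (\<forall>j\<le>m. \<forall>hs\<in>unit_lists P j. norm (D \<epsilon> b hs) \<le> B))))"

lemma field_bounded_mono:
  assumes "field_bounded m k i \<delta>1 B" "\<delta>2 \<le> \<delta>1" "B \<le> B'"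
  shows "field_bounded m k i \<delta>2 B'"
proof -
  obtain D where D: "\<forall>\<epsilon>\<in>scales \<epsilon>0. Cm_derivatives P m (f \<epsilon> k i) (D \<epsilon>)"
    "\<And>\<epsilon> q b j hs. \<epsilon> \<in> scales \<epsilon>0 \<Longrightarrow> \<epsilon> < \<delta>1 \<Longrightarrow> q \<in> a0 ` \<Omega>0 \<Longrightarrow> b \<in> P \<Longrightarrow> dist b q < \<delta>1 \<Longrightarrow> j \<le> m \<Longrightarrow>
      hs \<in> unit_lists P j \<Longrightarrow> norm (D \<epsilon> b hs) \<le> B"
    using assms(1) unfolding field_bounded_def by blast
  have "norm (D \<epsilon> b hs) \<le> B'" if "\<epsilon> \<in> scales \<epsilon>0" "\<epsilon> < \<delta>2" "q \<in> a0 ` \<Omega>0" "b \<in> P" "dist b q < \<delta>2" "j \<le> m"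
      "hs \<in> unit_lists P j" for \<epsilon> q b j hs
    using order_trans[OF D(2)[of \<epsilon> q b j hs] assms(3)] that assms(2) by linarith
  then show ?thesis unfolding field_bounded_def using D(1) by blast
qed

text \<open>The chain rule is applied in a ball around \<open>a0 x\<close>. At small scales the
  discrete values on the whole quotient box lie in it, by the step bound and the rate of
  convergence. Up to order \<open>p\<close> the result is a constant; in order \<open>p + 1\<close>
  it is affine in the quotient of \<open>a\<close> of the same order at the same point, as Gronwall
  needs.\<close>

lemma quotient_f_bound:
  assumes n: "n \<ge> N0" and i: "i \<in> E k" and fb: "field_bounded m k i \<delta>' B" and A': "0 \<le> A'" and p: "Suc p \<le> m"
    and IH: "\<And>ss y. set ss \<subseteq> J \<Longrightarrow> length ss \<le> p \<Longrightarrow> y \<in> \<Omega> (e n) \<Longrightarrow> shift (e n) ss y \<in> \<Omega> (e n) \<Longrightarrow>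
      norm (iter_diff_quot (e n) ss (a (e n)) y) \<le> A'"
    and C: "\<And>x. x \<in> \<Omega> (e n) \<Longrightarrow> norm (a (e n) x - a0 x) \<le> C * e n"
    and small: "(\<Lambda> * Suc p + C) * e n < \<delta>'" "e n < \<delta>'"
    and x: "x \<in> \<Omega> (e n)" "set js \<subseteq> J" "shift (e n) js x \<in> \<Omega> (e n)"
  shows "length js \<le> p \<Longrightarrow> norm (iter_diff_quot (e n) js (\<lambda>z. f (e n) k i (a (e n) z)) x) \<le> chain_const A' B (length js) 0"
    and "length js = Suc p \<Longrightarrow> norm (iter_diff_quot (e n) js (\<lambda>z. f (e n) k i (a (e n) z)) x)
      \<le> chain_const A' B p 1 * (A' + norm (iter_diff_quot (e n) js (a (e n)) x))"
proof -
  let ?h = "e n"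
  have h: "0 < ?h" by simp
  have \<epsilon>: "?h \<in> scales \<epsilon>0" by (rule e_scale[OF n])
  obtain D where D: "\<forall>\<epsilon>\<in>scales \<epsilon>0. Cm_derivatives P m (f \<epsilon> k i) (D \<epsilon>)"
    "\<And>\<epsilon> q b j hs. \<epsilon> \<in> scales \<epsilon>0 \<Longrightarrow> \<epsilon> < \<delta>' \<Longrightarrow> q \<in> a0 ` \<Omega>0 \<Longrightarrow> b \<in> P \<Longrightarrow> dist b q < \<delta>' \<Longrightarrow> j \<le> m \<Longrightarrow>
      hs \<in> unit_lists P j \<Longrightarrow> norm (D \<epsilon> b hs) \<le> B"
    using fb unfolding field_bounded_def by blast
  \<comment> \<open>Convex as a subspace meets a ball; centred at a limit value, where the bound on
    the derivatives holds.\<close>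
  define N where "N = P \<inter> ball (a0 x) \<delta>'"
  have x0: "x \<in> \<Omega>0" using x(1) Omega_disc_subset_lim by blast
  interpret Cm_bounded P m "f ?h k i" "D ?h" N A' B
  proof
    show "subspace P" by (rule P_subspace)
    show "Cm_derivatives P m (f ?h k i) (D ?h)" using D(1) \<epsilon> by blast
    show "convex N" unfolding N_def by (intro convex_Int subspace_imp_convex P_subspace convex_ball)
    show "N \<subseteq> P" by (simp add: N_def)
    show "norm (D ?h b hs) \<le> B" if "b \<in> N" "j \<le> m" "hs \<in> unit_lists P j" for b j hs
      using that x0 by (intro D(2)[OF \<epsilon> small(2), of "a0 x" b j hs]) (auto simp: N_def dist_commute)
  qed (rule A')
  have box: "diff_box ?h js x \<subseteq> \<Omega> ?h" by (rule diff_box_subset_disc[OF h x(2,1,3)])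
  have fD: "iter_diff_quot ?h js (\<lambda>z. f ?h k i (a ?h z)) x = iter_diff_quot ?h js (\<lambda>z. D ?h (a ?h z) []) x"
  proof (rule iter_diff_quot_cong)
    fix z assume "z \<in> diff_box ?h js x"
    then have "a ?h z \<in> P" using box a_P[OF \<epsilon>] by blast
    then show "f ?h k i (a ?h z) = D ?h (a ?h z) []"
      using D(1) \<epsilon> unfolding Cm_derivatives_def by auto
  qed
  have inN: "a ?h z \<in> N" if z: "z \<in> diff_box ?h js x" and len: "length js \<le> Suc p" for z
  proof -
    have z': "z \<in> \<Omega> ?h" using z box by blast
    have "set_coords J z 0 = set_coords J x 0"
      using diff_box_nth[OF z] x(2) unfolding set_coords_eq_iff by blast
    then have "norm (a ?h z - a ?h x) \<le> \<Lambda> * (\<Sum>i\<in>UNIV. \<bar>z $ i - x $ i\<bar>)"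
      by (rule a_lipschitz[OF \<epsilon> e_less[OF n] z' x(1)])
    also have "\<dots> \<le> \<Lambda> * (Suc p * ?h)"
    proof (rule mult_left_mono[OF _ \<Lambda>_nonneg])
      have "(\<Sum>i\<in>UNIV. \<bar>z $ i - x $ i\<bar>) \<le> length js * ?h" by (rule diff_box_dist[OF h z])
      also have "\<dots> \<le> Suc p * ?h" using len by (intro mult_right_mono) auto
      finally show "(\<Sum>i\<in>UNIV. \<bar>z $ i - x $ i\<bar>) \<le> Suc p * ?h" .
    qed
    finally have "norm (a ?h z - a0 x) \<le> \<Lambda> * (Suc p * ?h) + C * ?h"
      using norm_triangle_ineq[of "a ?h z - a ?h x" "a ?h x - a0 x"] C[OF x(1)] by simp
    also have "\<dots> < \<delta>'" using small(1) by (simp add: algebra_simps)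
    finally show ?thesis
      using a_P[OF \<epsilon> z'] by (simp add: N_def dist_norm norm_minus_commute)
  qed
  {
    assume len: "length js \<le> p"
    have "norm (iter_diff_quot ?h js (\<lambda>z. D ?h (a ?h z) (map (\<lambda>u. u z) [])) x)
        \<le> chain_const A' B (length js) (length ([] :: (real ^ 'd \<Rightarrow> 'v ^ 'k) list)) * prod_list []"
    proof (rule chain_bound[OF h])
      show "diff_bound' ?h A' js x (a ?h)"
        by (rule diff_bound'_intro[OF h IH len x(2,1,3)])
    qed (use len p inN in auto)
    then show "norm (iter_diff_quot ?h js (\<lambda>z. f ?h k i (a ?h z)) x) \<le> chain_const A' B (length js) 0"
      unfolding fD by simp
  }
  {
    assume len: "length js = Suc p"
    then obtain j js' where js: "js = j # js'" by (cases js) auto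
    have j: "j \<in> J" "set js' \<subseteq> J" using x(2) js by auto
    note in' = shift_Cons_in_disc[OF h j(1) x(1) x(3)[unfolded js]]
    have sh': "shift ?h js' (x + ?h *\<^sub>R axis j 1) \<in> \<Omega> ?h"
      using x(3) by (simp add: js shift_add shift_Cons)
    define T where "T = norm (iter_diff_quot ?h js (a ?h) x)"
    \<comment> \<open>\<open>A' + T\<close> bounds the lower order quotients and the top one
      together.\<close>
    have "norm (iter_diff_quot ?h (j # js') (\<lambda>z. D ?h (a ?h z) []) x) \<le> chain_const A' B (length js') 1 * (A' + T)"
    proof (rule chain_bound_top[OF h])
      show "diff_bound' ?h A' js' x (a ?h)" "diff_bound' ?h A' js' (x + ?h *\<^sub>R axis j 1) (a ?h)"
        using len by (auto simp: js intro!: diff_bound'_intro[OF h IH _ j(2)] in' sh' x)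
      have "diff_bound ?h (A' + T) js' x (iter_diff_quot ?h [j] (a ?h))"
      proof (rule diff_bound_intro[OF h, where l = "Suc p"])
        show "norm (iter_diff_quot ?h ss (a ?h) y) \<le> A' + T"
          if "set ss \<subseteq> J" "length ss < Suc p" "y \<in> \<Omega> ?h" "shift ?h ss y \<in> \<Omega> ?h" for ss y
          using IH[of ss y] that by (simp add: T_def add_increasing2)
        have eq: "mset (js' @ [j]) = mset js" by (simp add: js)
        show "shift ?h (js' @ [j]) x \<in> \<Omega> ?h" using x(3) shift_perm[OF eq] by metis
        have "iter_diff_quot ?h (js' @ [j]) (a ?h) = iter_diff_quot ?h js (a ?h)"
          unfolding js iter_diff_quot_append iter_diff_quot_Cons'[of ?h j js'] by simp
        then show "norm (iter_diff_quot ?h (js' @ [j]) (a ?h) x) \<le> A' + T"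
          using A' by (simp add: T_def)
      qed (use len js x j in auto)
      then show "diff_bound ?h (A' + T) js' x (diff_quot ?h j (a ?h))" by simp
    qed (use len p inN js in auto)
    then show "norm (iter_diff_quot ?h js (\<lambda>z. f ?h k i (a ?h z)) x)
      \<le> chain_const A' B p 1 * (A' + norm (iter_diff_quot ?h js (a ?h) x))"
      unfolding fD using len by (simp add: js T_def del: iter_diff_quot.simps)
  }
qed

end

lemma shift_in_larger_disc:
  fixes h c c' :: real
  assumes h: "0 < h" and "set js \<subseteq> J" and y: "y \<in> Omega_disc J h (set_coords J r c)"
    and "length js * h \<le> c' - c"
  shows "shift h js y \<in> Omega_disc J h (set_coords J r c')"
  using assms(2,4)
proof (induction js)
  case Nil
  have "c \<le> c'" using Nil.prems(2) by simp
  then have "Omega_disc J h (set_coords J r c) \<subseteq> Omega_disc J h (set_coords J r c')"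
    by (intro Omega_disc_mono) (simp add: set_coords_def)
  then show ?case using y by (auto simp: shift_Nil)
next
  case (Cons j js)
  have j: "j \<in> J" using Cons.prems(1) by simp
  have len: "length js * h + h \<le> c' - c" using Cons.prems(2) by (simp add: algebra_simps)
  then have IH: "shift h js y \<in> Omega_disc J h (set_coords J r c')"
    using Cons h by simp
  have "y $ j \<le> c" using Omega_disc_le[OF y, of j] j by (simp add: set_coords_def)
  moreover have "h * count_list js j \<le> length js * h"
    using h count_le_length[of js j] by (simp add: mult.commute mult_right_mono)
  ultimately have "shift h js y $ j + mesh J h j \<le> set_coords J r c' $ j"
    using len j by (simp add: shift_nth mesh_def set_coords_def)
  from Omega_disc_step[OF h IH this] show ?case
    using j by (simp add: shift_Cons mesh_def)
qed

lemma grid_line_lipschitz: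
  fixes u :: "real ^ 'd::finite \<Rightarrow> 'v::real_normed_vector"
  assumes "0 \<le> h"
    and "\<And>l. l < m \<Longrightarrow> norm (u (x + (real l * h) *\<^sub>R axis i 1 + h *\<^sub>R axis i 1) - u (x + (real l * h) *\<^sub>R axis i 1)) \<le> h * M"
  shows "norm (u (x + (real m * h) *\<^sub>R axis i 1) - u x) \<le> M * (real m * h)"
  using grid_taylor[of h 0 m u x i "\<lambda>_. 0" M] assms by (simp add: mult.commute)

context goursat_region begin

text \<open>All components share the same list \<open>js\<close>, so the vector of top order
  quotients satisfies a closed Gronwall inequality. A direction of \<open>js\<close> in
  \<open>E k\<close> lets the equation trade one order for the field, already bounded; otherwise the
  quotient at a data point uses data values only.\<close>

lemma quotients_bounded:
  assumes fconv: "\<And>k i. i \<in> E k \<Longrightarrow> Cm_loc_convergent (scales \<epsilon>0) P (K + 1) (\<lambda>\<epsilon>. f \<epsilon> k i)"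
    and gb: "\<And>k \<epsilon> js x. \<epsilon> \<in> scales \<epsilon>0 \<Longrightarrow> set js \<subseteq> J - E k \<Longrightarrow> length js \<le> K + 1 \<Longrightarrow>
      x \<in> goursat_set (Omega_disc J \<epsilon> r) (E k) \<Longrightarrow> shift \<epsilon> js x \<in> goursat_set (Omega_disc J \<epsilon> r) (E k) \<Longrightarrow>
      norm (iter_diff_quot \<epsilon> js (g \<epsilon> k) x) \<le> Mg"
    and "p \<le> K + 1"
  shows "\<exists>M\<ge>0. \<exists>n1\<ge>N0. \<forall>n\<ge>n1. \<forall>js x. set js \<subseteq> J \<longrightarrow> length js \<le> p \<longrightarrow> x \<in> \<Omega> (e n) \<longrightarrow>
    shift (e n) js x \<in> \<Omega> (e n) \<longrightarrow> norm (iter_diff_quot (e n) js (a (e n)) x) \<le> M"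
  using \<open>p \<le> K + 1\<close>
proof (induction p)
  case 0
  define M where "M = (\<Sum>z\<in>base. norm (A z)) + \<delta>"
  have "norm (a (e n) x) \<le> M" if n: "n \<ge> N0" and x: "x \<in> \<Omega> (e n)" for n x
  proof -
    have "norm (a (e n) x) \<le> norm (A (set_coords J x 0)) + norm (a (e n) x - A (set_coords J x 0))"
      by (rule norm_triangle_sub)
    also have "\<dots> \<le> M"
      unfolding M_def using a_near[OF e_scale[OF n] e_less[OF n], of x] x base_\<Omega>[OF x] finite_base
      by (intro add_mono member_le_sum) (auto simp: dist_norm R2_def)
    finally show ?thesis .
  qed
  moreover have "0 \<le> M" unfolding M_def using \<delta>_pos by (intro add_nonneg_nonneg sum_nonneg) auto
  ultimately show ?case by (intro exI[of _ M] conjI exI[of _ N0]) auto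
next
  case (Suc p)
  then obtain A' n1 where A': "0 \<le> A'" and n1: "N0 \<le> n1" and IH: "\<And>n js x. n \<ge> n1 \<Longrightarrow> set js \<subseteq> J \<Longrightarrow> length js \<le> p \<Longrightarrow>
      x \<in> \<Omega> (e n) \<Longrightarrow> shift (e n) js x \<in> \<Omega> (e n) \<Longrightarrow> norm (iter_diff_quot (e n) js (a (e n)) x) \<le> A'"
    by fastforce
  have p: "Suc p \<le> K + 1" using Suc.prems by simp
  define \<Phi> where "\<Phi> = (\<lambda>(k, i). field_bounded (K + 1) k i)"
  have "\<exists>\<delta>'>0. \<exists>B\<ge>0. \<forall>z\<in>{(k, i). i \<in> E k}. \<Phi> z \<delta>' B"
  proof (rule finite_uniform_constants)
    fix z assume "z \<in> {(k, i). i \<in> E k}"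
    then obtain k i where z: "z = (k, i)" "i \<in> E k" by auto
    show "\<exists>\<delta>'>0. \<exists>B. \<Phi> z \<delta>' B"
      unfolding \<Phi>_def z(1) prod.case field_bounded_def
      by (rule Cm_loc_convergent_bounded[OF fconv[OF z(2)] compact_image_a0 image_a0_P])
  next
    fix z \<delta>1 B \<delta>2 B' assume "z \<in> {(k, i). i \<in> E k}" "\<Phi> z \<delta>1 B" "\<delta>2 \<le> \<delta>1" "B \<le> B'"
    then show "\<Phi> z \<delta>2 B'" unfolding \<Phi>_def by (auto intro: field_bounded_mono)
  qed simp
  then obtain \<delta>' B where \<delta>': "\<delta>' > 0" and B: "B \<ge> 0" and fb': "\<forall>z\<in>{(k, i). i \<in> E k}. \<Phi> z \<delta>' B"
    by (elim exE conjE)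
  have fb: "field_bounded (K + 1) k i \<delta>' B" if "i \<in> E k" for k i
    using bspec[OF fb', of "(k, i)"] that unfolding \<Phi>_def by simp
  obtain C where C: "0 \<le> C" and C_bound: "\<And>n x. n \<ge> N0 \<Longrightarrow> x \<in> \<Omega>0 \<Longrightarrow> norm (a (e n) (fl n x) - a0 x) \<le> C * e n"
    using a0_limit by blast
  have Cx: "norm (a (e n) x - a0 x) \<le> C * e n" if "n \<ge> N0" "x \<in> \<Omega> (e n)" for n x
    using C_bound[OF that(1) subsetD[OF Omega_disc_subset_lim that(2)]] grid_floor_id[OF _ that(2)] by simp
  \<comment> \<open>Brings the values on a quotient box of order \<open>p + 1\<close> within
    \<delta>' of the limit value at its corner.\<close>
  define d where "d = min \<delta>' (\<delta>' / (\<Lambda> * Suc p + C + 1))"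
  have pos: "0 < \<Lambda> * Suc p + C + 1" using \<Lambda>_nonneg C by (simp add: add_nonneg_pos)
  then have "d > 0" using \<delta>' by (simp add: d_def)
  then obtain n2 where n2: "\<And>n. n \<ge> n2 \<Longrightarrow> e n < d"
    using eventually_scales[OF eps0_pos] by blast
  define N1 where "N1 = max n1 n2"
  have small: "(\<Lambda> * Suc p + C) * e n < \<delta>'" "e n < \<delta>'" if "n \<ge> N1" for n
  proof -
    have "e n < d" using n2 that by (simp add: N1_def)
    then show "e n < \<delta>'" by (simp add: d_def)
    have "(\<Lambda> * Suc p + C) * e n \<le> (\<Lambda> * Suc p + C + 1) * e n" by (intro mult_right_mono) auto
    also have "\<dots> < \<delta>'"
      using \<open>e n < d\<close> pos unfolding d_def by (simp add: pos_less_divide_eq mult.commute)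
    finally show "(\<Lambda> * Suc p + C) * e n < \<delta>'" .
  qed
  define Cc where "Cc = chain_const A' B p 1"
  define C0 where "C0 = chain_const A' B p 0"
  have Cc: "0 \<le> Cc" "0 \<le> C0" using A' B by (auto simp: Cc_def C0_def intro: chain_const_nonneg)
  \<comment> \<open>\<open>Mg\<close> bounds quotients of the data, \<open>C0\<close> quotients of
    order \<open>p\<close> of a field. The maximum with 0 is taken because \<open>Mg\<close> carries
    no sign.\<close>
  define \<alpha> where "\<alpha> = max 0 Mg + C0"
  have \<alpha>: "0 \<le> \<alpha>" using Cc by (simp add: \<alpha>_def)
  define M1 where "M1 = CARD('k) * ((\<alpha> + Cc * A') * exp ((Cc * CARD('k) + 1) * coord_sum r))"
  have top: "norm (iter_diff_quot (e n) js (a (e n)) x) \<le> M1"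
    if n: "n \<ge> N1" and js: "set js \<subseteq> J" "length js = Suc p" and x: "x \<in> \<Omega> (e n)" "shift (e n) js x \<in> \<Omega> (e n)" for n js x
  proof -
    let ?h = "e n"
    have h: "0 < ?h" by simp
    have nN: "n \<ge> N0" "n \<ge> n1" using n n1 by (auto simp: N1_def)
    have \<epsilon>: "?h \<in> scales \<epsilon>0" by (rule e_scale[OF nN(1)])
    define S where "S = {x \<in> \<Omega> ?h. shift ?h js x \<in> \<Omega> ?h}"
    define u where "u k x = norm (iter_diff_quot ?h js (\<lambda>y. a ?h y $ k) x)" for k x
    have qf1: "norm (iter_diff_quot ?h js' (\<lambda>z. f ?h k j (a ?h z)) x) \<le> chain_const A' B (length js') 0"
      if "j \<in> E k" "length js' \<le> p" "x \<in> \<Omega> ?h" "set js' \<subseteq> J" "shift ?h js' x \<in> \<Omega> ?h" for k j js' x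
      by (rule quotient_f_bound(1)[OF nN(1) that(1) fb[OF that(1)] A' p])
        (use IH[OF nN(2)] Cx[OF nN(1)] small[OF n] that in auto)
    have qf2: "norm (iter_diff_quot ?h js (\<lambda>z. f ?h k j (a ?h z)) x) \<le> Cc * (A' + norm (iter_diff_quot ?h js (a ?h) x))"
      if "j \<in> E k" "x \<in> \<Omega> ?h" "shift ?h js x \<in> \<Omega> ?h" for k j x
      unfolding Cc_def
      by (rule quotient_f_bound(2)[OF nN(1) that(1) fb[OF that(1)] A' p])
        (use IH[OF nN(2)] Cx[OF nN(1)] small[OF n] that js in auto)
    \<comment> \<open>One quotient in a direction of \<open>E k\<close> is moved innermost and
      replaced by the field, which leaves order \<open>p\<close>.\<close>
    have case1: "u k x \<le> \<alpha>" if x: "x \<in> S" and j: "j \<in> set js" "j \<in> E k" for k x j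
    proof -
      have xS: "x \<in> \<Omega> ?h" "shift ?h js x \<in> \<Omega> ?h" using x by (auto simp: S_def)
      have jJ: "j \<in> J" using j js by auto
      define js' where "js' = remove1 j js"
      have js': "set js' \<subseteq> J" "length js' = p"
        using js j set_remove1_subset[of j js] by (auto simp: js'_def length_remove1)
      have "mset (j # js') = mset js" using j(1) by (simp add: js'_def)
      then have sh: "shift ?h (j # js') x \<in> \<Omega> ?h" using xS(2) shift_perm by metis
      note in' = shift_Cons_in_disc[OF h jJ xS(1) sh]
      have box: "diff_box ?h js' x \<subseteq> \<Omega> ?h" by (rule diff_box_subset_disc[OF h js'(1) xS(1) in'(1)])
      have box': "diff_box ?h js' (x + ?h *\<^sub>R axis j 1) \<subseteq> \<Omega> ?h"
        by (rule diff_box_subset_disc[OF h js'(1) in'(2)]) (use sh in \<open>simp add: shift_add shift_Cons\<close>)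
      have "iter_diff_quot ?h js (\<lambda>y. a ?h y $ k) x = iter_diff_quot ?h js' (diff_quot ?h j (\<lambda>y. a ?h y $ k)) x"
        unfolding js'_def by (simp add: iter_diff_quot_remove1[OF j(1)])
      also have "\<dots> = iter_diff_quot ?h js' (\<lambda>z. f ?h k j (a ?h z)) x"
      proof (rule iter_diff_quot_cong)
        fix z assume z: "z \<in> diff_box ?h js' x"
        have "z \<in> Omega_disc J ?h r" "z + mesh J ?h j *\<^sub>R axis j 1 \<in> Omega_disc J ?h r"
          using box box' z diff_box_translate[OF z, of "?h *\<^sub>R axis j 1"] \<Omega>_sub[of ?h] jJ by (auto simp: mesh_def)
        from a_step[OF \<epsilon> j(2) this] show "diff_quot ?h j (\<lambda>y. a ?h y $ k) z = f ?h k j (a ?h z)"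
          using jJ by (simp add: diff_quot_def mesh_def)
      qed
      finally have "u k x \<le> chain_const A' B (length js') 0"
        unfolding u_def using qf1[OF j(2) _ xS(1) js'(1) in'(1)] js'(2) by simp
      then show ?thesis using js'(2) by (simp add: \<alpha>_def C0_def)
    qed
    have "u k x \<le> (\<alpha> + Cc * A') * exp ((Cc * CARD('k) + 1) * coord_sum r)" for k
    proof (rule grid_gronwall[OF \<epsilon>, where S = S and u = u and R = R2])
      show "x \<in> S" using x by (simp add: S_def)
      show "S \<subseteq> \<Omega> ?h" by (auto simp: S_def)
    next
      fix x j assume x: "x \<in> S" "0 < x $ j"
      have "x $ j \<le> shift ?h js x $ j" by (simp add: shift_nth)
      then have "0 < shift ?h js x $ j" using x(2) by linarith
      then show "x - mesh J ?h j *\<^sub>R axis j 1 \<in> S"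
        using Omega_disc_back[OF h, of x] Omega_disc_back[OF h, of "shift ?h js x"] x
        by (simp add: S_def shift_diff)
    next
      fix k x assume x: "x \<in> S" and G: "x \<in> goursat_set (\<Omega> ?h) (E k)"
      show "u k x \<le> \<alpha>"
      proof (cases "set js \<inter> E k = {}")
        case True
        have xS: "x \<in> \<Omega> ?h" "shift ?h js x \<in> \<Omega> ?h" using x by (auto simp: S_def)
        have box: "diff_box ?h js x \<subseteq> \<Omega> ?h" by (rule diff_box_subset_disc[OF h js(1) xS])
        have Gz: "z \<in> goursat_set (Omega_disc J ?h r) (E k)" if z: "z \<in> diff_box ?h js x" for z
        proof -
          have "z $ i = 0" if "i \<in> E k" for i
            using diff_box_nth[OF z, of i] True that G by (auto simp: goursat_set_def)
          \<comment> \<open>All vertices of the quotient box are data points, since none of its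
            directions belongs to \<open>E k\<close>.\<close>
          then show ?thesis using z box \<Omega>_sub[of ?h] by (auto simp: goursat_set_def)
        qed
        have "iter_diff_quot ?h js (\<lambda>y. a ?h y $ k) x = iter_diff_quot ?h js (g ?h k) x"
          by (rule iter_diff_quot_cong) (rule a_data[OF \<epsilon> Gz])
        moreover have "norm (iter_diff_quot ?h js (g ?h k) x) \<le> Mg"
        proof (rule gb[OF \<epsilon>])
          show "set js \<subseteq> J - E k" using True js(1) by blast
          show "length js \<le> K + 1" using js(2) p by simp
          show "x \<in> goursat_set (Omega_disc J ?h r) (E k)" by (rule Gz[OF self_in_diff_box])
          have "shift ?h js x $ i = 0" if "i \<in> E k" for i
          proof -
            have "i \<notin> set js" using that True by blast
            then have "count_list js i = 0" by (rule count_notin)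
            then show ?thesis using that G by (simp add: shift_nth goursat_set_def)
          qed
          then show "shift ?h js x \<in> goursat_set (Omega_disc J ?h r) (E k)"
            using xS(2) \<Omega>_sub[of ?h] by (auto simp: goursat_set_def)
        qed
        ultimately show ?thesis using Cc by (simp add: u_def \<alpha>_def)
      qed (use case1 x in blast)
    next
      fix k j B' and w :: "real ^ 'd"
      let ?m = "mesh J ?h j"
      assume w: "w \<in> S" and x: "w + ?m *\<^sub>R axis j 1 \<in> S" and j: "j \<in> E k" and B': "0 \<le> B'" "\<And>l. u l w \<le> B'"
      have m: "0 < ?m" by (rule mesh_pos[OF h])
      have wS: "w \<in> \<Omega> ?h" "shift ?h js w \<in> \<Omega> ?h" "w + ?m *\<^sub>R axis j 1 \<in> \<Omega> ?h" "shift ?h js (w + ?m *\<^sub>R axis j 1) \<in> \<Omega> ?h"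
        using w x by (auto simp: S_def)
      have box: "diff_box ?h js w \<subseteq> \<Omega> ?h" "diff_box ?h js (w + ?m *\<^sub>R axis j 1) \<subseteq> \<Omega> ?h"
        by (rule diff_box_subset_disc[OF h js(1) wS(1,2)], rule diff_box_subset_disc[OF h js(1) wS(3,4)])
      have "iter_diff_quot ?h js (\<lambda>y. a ?h y $ k) (w + ?m *\<^sub>R axis j 1)
          = iter_diff_quot ?h js (\<lambda>y. a ?h (y + ?m *\<^sub>R axis j 1) $ k) w"
        by (simp add: iter_diff_quot_translate[where u = "\<lambda>y. a ?h y $ k"])
      also have "\<dots> = iter_diff_quot ?h js (\<lambda>y. a ?h y $ k + ?m *\<^sub>R f ?h k j (a ?h y)) w"
      proof (rule iter_diff_quot_cong)
        fix z assume z: "z \<in> diff_box ?h js w"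
        have "z \<in> Omega_disc J ?h r" "z + ?m *\<^sub>R axis j 1 \<in> Omega_disc J ?h r"
          using box z diff_box_translate[OF z, of "?m *\<^sub>R axis j 1"] \<Omega>_sub[of ?h] by auto
        then show "a ?h (z + ?m *\<^sub>R axis j 1) $ k = a ?h z $ k + ?m *\<^sub>R f ?h k j (a ?h z)"
          by (rule a_step[OF \<epsilon> j])
      qed
      also have "\<dots> = iter_diff_quot ?h js (\<lambda>y. a ?h y $ k) w + ?m *\<^sub>R iter_diff_quot ?h js (\<lambda>y. f ?h k j (a ?h y)) w"
        by (simp add: iter_diff_quot_add iter_diff_quot_scaleR)
      finally have "u k (w + ?m *\<^sub>R axis j 1) \<le> u k w + ?m * norm (iter_diff_quot ?h js (\<lambda>y. f ?h k j (a ?h y)) w)"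
        unfolding u_def using m by (simp add: norm_triangle_le)
      also have "\<dots> \<le> B' + ?m * (Cc * (A' + CARD('k) * B'))"
      proof (intro add_mono B'(2) mult_left_mono)
        have "norm (iter_diff_quot ?h js (a ?h) w) \<le> CARD('k) * B'"
          by (rule norm_vec_le) (use B'(2) in \<open>simp add: u_def iter_diff_quot_nth\<close>)
        then have "Cc * (A' + norm (iter_diff_quot ?h js (a ?h) w)) \<le> Cc * (A' + CARD('k) * B')"
          using Cc(1) by (intro mult_left_mono) auto
        then show "norm (iter_diff_quot ?h js (\<lambda>y. f ?h k j (a ?h y)) w) \<le> Cc * (A' + CARD('k) * B')"
          using qf2[OF j wS(1,2)] by simp
      qed (use m in simp)
      also have "\<dots> = B' + ?m * (Cc * CARD('k) * B' + Cc * A')" by (simp add: algebra_simps)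
      finally show "u k (w + ?m *\<^sub>R axis j 1) \<le> \<alpha> \<or> u k (w + ?m *\<^sub>R axis j 1) \<le> B' + ?m * (Cc * CARD('k) * B' + Cc * A')"
        by simp
    qed (use R2_le \<alpha> Cc A' in auto)
    then show ?thesis
      unfolding M1_def by (intro norm_vec_le) (simp add: u_def iter_diff_quot_nth)
  qed
  have "norm (iter_diff_quot (e n) js (a (e n)) x) \<le> max A' M1"
    if "n \<ge> N1" "set js \<subseteq> J" "length js \<le> Suc p" "x \<in> \<Omega> (e n)" "shift (e n) js x \<in> \<Omega> (e n)" for n js x
  proof (cases "length js = Suc p")
    case True
    then show ?thesis using top[of n js x] that by auto
  next
    case False
    then show ?thesis using IH[of n js x] that by (auto simp: N1_def)
  qed
  moreover have "N0 \<le> N1" using n1 by (simp add: N1_def)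
  ultimately show ?case using A' by (intro exI[of _ "max A' M1"] conjI exI[of _ N1]) auto
qed

text \<open>Uniform on every box strictly inside the region. Each differentiation costs an
  arbitrarily small margin, so quantifying over all \<rho>' lets the property be iterated.\<close>

definition grid_converges :: "(nat \<Rightarrow> real ^ 'd \<Rightarrow> 'v) \<Rightarrow> (real ^ 'd \<Rightarrow> 'v) \<Rightarrow> bool" where
  "grid_converges u v \<longleftrightarrow> (\<forall>\<rho>'. 0 < \<rho>' \<longrightarrow> \<rho>' < 2 * \<rho> \<longrightarrow> (\<forall>c>0. \<exists>n1. \<forall>n\<ge>n1.
     \<forall>x\<in>Omega_lim J (set_coords J r \<rho>'). norm (u n (fl n x) - v x) \<le> c))"

definition steps_bounded :: "(nat \<Rightarrow> real ^ 'd \<Rightarrow> 'v) \<Rightarrow> bool" where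
  "steps_bounded u \<longleftrightarrow> (\<forall>\<rho>'. 0 < \<rho>' \<longrightarrow> \<rho>' < 2 * \<rho> \<longrightarrow> (\<exists>M\<ge>0. \<exists>n1. \<forall>n\<ge>n1. \<forall>i\<in>J.
     \<forall>y\<in>Omega_disc J (e n) (set_coords J r \<rho>'). norm (diff_quot (e n) i (u n) y) \<le> M))"

lemma steps_boundedE:
  assumes "steps_bounded u" "0 < \<rho>'" "\<rho>' < 2 * \<rho>"
  obtains M n1 where "0 \<le> M" "\<And>n i y. n \<ge> n1 \<Longrightarrow> i \<in> J \<Longrightarrow> y \<in> Omega_disc J (e n) (set_coords J r \<rho>') \<Longrightarrow>
      norm (diff_quot (e n) i (u n) y) \<le> M"
proof -
  have "\<exists>M\<ge>0. \<exists>n1. \<forall>n\<ge>n1. \<forall>i\<in>J. \<forall>y\<in>Omega_disc J (e n) (set_coords J r \<rho>').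
      norm (diff_quot (e n) i (u n) y) \<le> M"
    by (rule assms(1)[unfolded steps_bounded_def, THEN spec, THEN mp, THEN mp, OF assms(2,3)])
  then obtain M n1 where "0 \<le> M" and *: "\<forall>n\<ge>n1. \<forall>i\<in>J. \<forall>y\<in>Omega_disc J (e n) (set_coords J r \<rho>').
      norm (diff_quot (e n) i (u n) y) \<le> M"
    by (elim exE conjE)
  then show thesis using that[of M n1] by simp
qed

lemma grid_convergesE:
  assumes "grid_converges u v" "0 < \<rho>'" "\<rho>' < 2 * \<rho>" "0 < c"
  obtains n1 where "\<And>n x. n \<ge> n1 \<Longrightarrow> x \<in> Omega_lim J (set_coords J r \<rho>') \<Longrightarrow> norm (u n (fl n x) - v x) \<le> c"
proof -
  have "\<exists>n1. \<forall>n\<ge>n1. \<forall>x\<in>Omega_lim J (set_coords J r \<rho>'). norm (u n (fl n x) - v x) \<le> c"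
    by (rule assms(1)[unfolded grid_converges_def, THEN spec, THEN mp, THEN mp, THEN spec, THEN mp, OF assms(2-4)])
  then obtain n1 where "\<forall>n\<ge>n1. \<forall>x\<in>Omega_lim J (set_coords J r \<rho>'). norm (u n (fl n x) - v x) \<le> c"
    by (elim exE)
  then show thesis using that[of n1] by simp
qed

lemma grid_converges_pointwise:
  assumes "grid_converges u v" "0 < \<rho>'" "\<rho>' < 2 * \<rho>" "x \<in> Omega_lim J (set_coords J r \<rho>')"
  shows "(\<lambda>n. u n (fl n x)) \<longlonglongrightarrow> v x"
proof (rule LIMSEQ_I)
  fix c :: real assume "c > 0"
  then have "0 < c / 2" by simp
  then obtain n1 where n1: "\<And>n x. n \<ge> n1 \<Longrightarrow> x \<in> Omega_lim J (set_coords J r \<rho>') \<Longrightarrow> norm (u n (fl n x) - v x) \<le> c / 2"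
    using grid_convergesE[OF assms(1-3)] by metis
  have "norm (u n (fl n x) - v x) < c" if "n \<ge> n1" for n
    using n1[OF that assms(4)] \<open>c > 0\<close> by simp
  then show "\<exists>n0. \<forall>n\<ge>n0. norm (u n (fl n x) - v x) < c" by blast
qed

lemma diff_quot_step:
  "0 < h \<Longrightarrow> u (x + h *\<^sub>R axis i 1) = u x + h *\<^sub>R diff_quot h i u x"
  by (simp add: diff_quot_def)

text \<open>Bounded steps give a Lipschitz bound within a slab, and points closer than 1 lie in the
  same slab.\<close>

lemma grid_limit_continuous:
  assumes conv: "grid_converges u v" and steps: "steps_bounded u" and \<rho>': "0 < \<rho>'" "\<rho>' < 2 * \<rho>"
  shows "continuous_on (Omega_lim J (set_coords J r \<rho>')) v"
proof -
  let ?S = "Omega_lim J (set_coords J r \<rho>')"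
  obtain M n1 where M: "M \<ge> 0" "\<And>n i y. n \<ge> n1 \<Longrightarrow> i \<in> J \<Longrightarrow> y \<in> Omega_disc J (e n) (set_coords J r \<rho>') \<Longrightarrow>
      norm (diff_quot (e n) i (u n) y) \<le> M"
    by (rule steps_boundedE[OF steps \<rho>']) blast
  have lip: "norm (v x - v y) \<le> M * (\<Sum>i\<in>UNIV. \<bar>x $ i - y $ i\<bar>)"
    if x: "x \<in> ?S" and y: "y \<in> ?S" and xy: "set_coords J x 0 = set_coords J y 0" for x y
  proof (rule LIMSEQ_le)
    show "(\<lambda>n. norm (u n (fl n x) - u n (fl n y))) \<longlonglongrightarrow> norm (v x - v y)"
      by (intro tendsto_intros grid_converges_pointwise[OF conv \<rho>'] x y)
    show "(\<lambda>n. M * (\<Sum>i\<in>UNIV. \<bar>fl n x $ i - fl n y $ i\<bar>)) \<longlonglongrightarrow> M * (\<Sum>i\<in>UNIV. \<bar>x $ i - y $ i\<bar>)"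
      by (intro tendsto_intros fl_lim)
    have "norm (u n (fl n x) - u n (fl n y)) \<le> M * (\<Sum>i\<in>UNIV. \<bar>fl n x $ i - fl n y $ i\<bar>)" if n: "n \<ge> n1" for n
    proof (rule grid_lipschitz[OF _ _ fl_in[OF x] fl_in[OF y]])
      fix i z assume "i \<in> J" "z \<in> Omega_disc J (e n) (set_coords J r \<rho>')"
      then show "norm (u n (z + e n *\<^sub>R axis i 1) - u n z) \<le> M * e n"
        using M(2)[OF n, of i z] by (simp add: diff_quot_step mult.commute mult_left_mono)
    qed (simp_all add: grid_floor_set_coords xy)
    then show "\<exists>N. \<forall>n\<ge>N. norm (u n (fl n x) - u n (fl n y)) \<le> M * (\<Sum>i\<in>UNIV. \<bar>fl n x $ i - fl n y $ i\<bar>)"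
      by blast
  qed
  show ?thesis
    unfolding continuous_on_iff
  proof (intro ballI allI impI)
    fix x and c :: real assume x: "x \<in> ?S" and c: "0 < c"
    define d where "d = min 1 (c / (M * CARD('d) + 1))"
    have pos: "0 < M * CARD('d) + 1" using M(1) by (simp add: add_nonneg_pos)
    have "d > 0" using c pos by (simp add: d_def)
    moreover have "dist (v y) (v x) < c" if y: "y \<in> ?S" "dist y x < d" for y
    proof -
      have nth: "\<bar>y $ i - x $ i\<bar> \<le> norm (y - x)" for i using component_le_norm_cart[of "y - x" i] by simp
      have "set_coords J y 0 = set_coords J x 0"
        unfolding set_coords_eq_iff
      proof (intro allI impI)
        fix i assume "i \<notin> J"
        then have "y $ i - x $ i \<in> \<int>" using x y(1) by (auto simp: Omega_lim_def)
        moreover have "\<bar>y $ i - x $ i\<bar> < 1" using nth[of i] y(2) by (simp add: d_def dist_norm)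
        ultimately show "y $ i = x $ i" by (metis Ints_eq_abs_less1 Ints_0 diff_zero eq_iff_diff_eq_0)
      qed
      then have "norm (v y - v x) \<le> M * (\<Sum>i\<in>UNIV. \<bar>y $ i - x $ i\<bar>)" by (rule lip[OF y(1) x])
      also have "\<dots> \<le> M * (\<Sum>i\<in>(UNIV :: 'd set). norm (y - x))"
        by (intro mult_left_mono sum_mono nth M(1))
      also have "\<dots> \<le> (M * CARD('d) + 1) * norm (y - x)" by (simp add: algebra_simps)
      also have "\<dots> < c"
        using y(2) pos by (simp add: d_def dist_norm pos_less_divide_eq mult.commute)
      finally show ?thesis by (simp add: dist_norm)
    qed
    ultimately show "\<exists>d>0. \<forall>y\<in>?S. dist y x < d \<longrightarrow> dist (v y) (v x) < c" by blast
  qed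
qed

text \<open>Interpolation between the function values and the second difference quotients:
  by Taylor's formula the difference quotient of \<open>u n\<close> is within \<open>O(t)\<close> of the increment
  \<open>(v (x + t e\<^sub>j) - v x) / t\<close>, which does not depend on \<open>n\<close>, so difference quotients
  converge without any differentiation of the limit equations.\<close>

lemma grid_derivative_converges:
  fixes u :: "nat \<Rightarrow> real ^ 'd \<Rightarrow> 'v"
  assumes conv: "grid_converges u v" and steps: "steps_bounded u"
    and j: "j \<in> J" and steps': "steps_bounded (\<lambda>n. diff_quot (e n) j (u n))"
    and S: "complete S" and inS: "\<And>\<rho>'. 0 < \<rho>' \<Longrightarrow> \<rho>' < 2 * \<rho> \<Longrightarrow> \<exists>n1. \<forall>n\<ge>n1.
      \<forall>y\<in>Omega_disc J (e n) (set_coords J r \<rho>'). diff_quot (e n) j (u n) y \<in> S"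
  defines "w \<equiv> \<lambda>x. lim (\<lambda>n. diff_quot (e n) j (u n) (fl n x))"
  shows "grid_converges (\<lambda>n. diff_quot (e n) j (u n)) w"
    and "\<And>\<rho>' x. 0 < \<rho>' \<Longrightarrow> \<rho>' < 2 * \<rho> \<Longrightarrow> x \<in> Omega_lim J (set_coords J r \<rho>') \<Longrightarrow>
      ((\<lambda>t. v (x + t *\<^sub>R axis j 1)) has_vector_derivative w x) (line_filter (Omega_lim J (set_coords J r \<rho>')) j x)"
proof -
  have main: "(\<forall>c>0. \<exists>n1. \<forall>n\<ge>n1. \<forall>x\<in>Omega_lim J (set_coords J r \<rho>').
        norm (diff_quot (e n) j (u n) (fl n x) - w x) \<le> c) \<and>
      (\<forall>x\<in>Omega_lim J (set_coords J r \<rho>'). ((\<lambda>t. v (x + t *\<^sub>R axis j 1)) has_vector_derivative w x)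
        (line_filter (Omega_lim J (set_coords J r \<rho>')) j x))"
    if \<rho>': "0 < \<rho>'" "\<rho>' < 2 * \<rho>" for \<rho>'
  proof -
    \<comment> \<open>An intermediate box: forward increments up to \<open>T\<close> from the
      smaller box stay in it, and the hypotheses apply there.\<close>
    define \<rho>2 where "\<rho>2 = (\<rho>' + 2 * \<rho>) / 2"
    have \<rho>2: "0 < \<rho>2" "\<rho>2 < 2 * \<rho>" "\<rho>' < \<rho>2" using \<rho>' by (auto simp: \<rho>2_def)
    define T where "T = min 1 (\<rho>2 - \<rho>')"
    have T: "0 < T" using \<rho>2 by (simp add: T_def)
    let ?S' = "Omega_lim J (set_coords J r \<rho>')" and ?S2 = "Omega_lim J (set_coords J r \<rho>2)"
    have sub: "?S' \<subseteq> ?S2" using \<rho>2 by (intro Omega_lim_mono) (auto simp: set_coords_def)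
    have move: "x + t *\<^sub>R axis j 1 \<in> ?S2" if x: "x \<in> ?S'" and t: "0 \<le> t" "t \<le> T" for x t
    proof -
      have "0 \<le> x $ j" "x $ j \<le> set_coords J r \<rho>' $ j" using x by (auto simp: Omega_lim_def)
      then have "0 \<le> x $ j" "x $ j \<le> \<rho>'" using j by (simp_all add: set_coords_def)
      then show ?thesis
        unfolding line_in_Omega_lim[OF j subsetD[OF sub x]] using t j by (auto simp: T_def set_coords_def)
    qed
    define q where "q n = diff_quot (e n) j (u n)" for n
    obtain M1 n1 where M1: "M1 \<ge> 0" "\<And>n y. n \<ge> n1 \<Longrightarrow> y \<in> Omega_disc J (e n) (set_coords J r \<rho>2) \<Longrightarrow> norm (q n y) \<le> M1"
      unfolding q_def by (rule steps_boundedE[OF steps \<rho>2(1,2)]) (use j in blast)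
    obtain M2 n2 where M2: "M2 \<ge> 0" "\<And>n y. n \<ge> n2 \<Longrightarrow> y \<in> Omega_disc J (e n) (set_coords J r \<rho>2) \<Longrightarrow>
        norm (diff_quot (e n) j (q n) y) \<le> M2"
      unfolding q_def by (rule steps_boundedE[OF steps' \<rho>2(1,2)]) (use j in blast)
    define M where "M = max M1 M2"
    have M: "0 \<le> M" "M1 \<le> M" "M2 \<le> M" using M1(1) by (auto simp: M_def)
    define n3 where "n3 = max n1 n2"
    have qlip: "norm (q n (fl n (x + t *\<^sub>R axis j 1)) - q n (fl n x)) \<le> M * \<tau> n x j t"
      and taylor: "norm (u n (fl n (x + t *\<^sub>R axis j 1)) - u n (fl n x) - \<tau> n x j t *\<^sub>R q n (fl n x)) \<le> M * (\<tau> n x j t)\<^sup>2"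
      if n: "n \<ge> n3" and x: "x \<in> ?S'" and t: "0 \<le> t" "t \<le> T" for n x t
    proof -
      let ?h = "e n" and ?y = "fl n x"
      obtain m :: nat where m: "\<tau> n x j t = real m * ?h" "fl n (x + t *\<^sub>R axis j 1) = ?y + (real m * ?h) *\<^sub>R axis j 1"
        by (rule \<tau>_props[OF j t(1)])
      have y: "?y \<in> Omega_disc J ?h (set_coords J r \<rho>2)" "?y + (real m * ?h) *\<^sub>R axis j 1 \<in> Omega_disc J ?h (set_coords J r \<rho>2)"
        using fl_in[OF subsetD[OF sub x], of n] fl_in[OF move[OF x t], of n] m(2) by auto
      have seg: "?y + (real l * ?h) *\<^sub>R axis j 1 \<in> Omega_disc J ?h (set_coords J r \<rho>2)" if "l \<le> m" for l
        by (rule grid_segment[OF j _ y that]) simp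
      have lip: "norm (q n (?y + (real l * ?h) *\<^sub>R axis j 1) - q n ?y) \<le> M * (real l * ?h)" if "l \<le> m" for l
      proof (rule grid_line_lipschitz)
        fix l' assume "l' < l"
        then have "norm (diff_quot ?h j (q n) (?y + (real l' * ?h) *\<^sub>R axis j 1)) \<le> M"
          using M2(2)[OF _ seg[of l']] n that M(3) by (force simp: n3_def)
        then show "norm (q n (?y + (real l' * ?h) *\<^sub>R axis j 1 + ?h *\<^sub>R axis j 1) - q n (?y + (real l' * ?h) *\<^sub>R axis j 1)) \<le> ?h * M"
          by (simp add: diff_quot_step mult_left_mono)
      qed simp
      show "norm (q n (fl n (x + t *\<^sub>R axis j 1)) - q n (fl n x)) \<le> M * \<tau> n x j t"
        unfolding m by (rule lip) simp
      have "norm (u n (?y + (real m * ?h) *\<^sub>R axis j 1) - u n ?y - (real m * ?h) *\<^sub>R q n ?y)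
          \<le> real m * ?h * (0 + M * (real m * ?h))"
      proof (rule grid_taylor)
        fix l assume "l < m"
        show "norm (u n (?y + (real l * ?h) *\<^sub>R axis j 1 + ?h *\<^sub>R axis j 1) - u n (?y + (real l * ?h) *\<^sub>R axis j 1)
            - ?h *\<^sub>R q n (?y + (real l * ?h) *\<^sub>R axis j 1)) \<le> ?h * 0"
          by (simp add: diff_quot_step q_def)
        show "norm (q n (?y + (real l * ?h) *\<^sub>R axis j 1) - q n ?y) \<le> M * (real l * ?h)"
          by (rule lip) (use \<open>l < m\<close> in simp)
      qed (use M in auto)
      then show "norm (u n (fl n (x + t *\<^sub>R axis j 1)) - u n (fl n x) - \<tau> n x j t *\<^sub>R q n (fl n x)) \<le> M * (\<tau> n x j t)\<^sup>2"
        unfolding m by (simp add: power2_eq_square mult_ac)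
    qed
    \<comment> \<open>Four \<open>M\<close> from the Taylor remainder at length at most
      \<open>2 * t\<close>, one \<open>M\<close> from replacing the grid length by \<open>t\<close>,
      and 2 from replacing \<open>u n\<close> by \<open>v\<close> at both ends.\<close>
    define Kc where "Kc = 2 + 5 * M"
    have Kc: "0 < Kc" "M \<le> Kc" using M(1) by (auto simp: Kc_def)
    \<comment> \<open>For fixed \<open>t\<close> both the mesh and the error of \<open>u n\<close>
      are eventually below \<open>t\<^sup>2\<close>; the remaining deviation is
      \<open>Kc * t\<^sup>2\<close>, and division by \<open>t\<close> makes it small.\<close>
    have approx: "\<exists>n4. \<forall>n\<ge>n4. \<forall>x\<in>?S'. norm (v (x + t *\<^sub>R axis j 1) - v x - t *\<^sub>R q n (fl n x)) \<le> Kc * t\<^sup>2"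
      if t: "0 < t" "t \<le> T" for t
    proof -
      have t2: "0 < t\<^sup>2" using t by simp
      obtain n5 where n5: "\<And>n x. n \<ge> n5 \<Longrightarrow> x \<in> ?S2 \<Longrightarrow> norm (u n (fl n x) - v x) \<le> t\<^sup>2"
        using grid_convergesE[OF conv \<rho>2(1,2) t2] by metis
      obtain n6 where n6: "\<And>n. n \<ge> n6 \<Longrightarrow> e n < t\<^sup>2"
        using eventually_scales[OF eps0_pos t2] by blast
      have "norm (v (x + t *\<^sub>R axis j 1) - v x - t *\<^sub>R q n (fl n x)) \<le> Kc * t\<^sup>2"
        if n: "n \<ge> max n3 (max n5 n6)" and x: "x \<in> ?S'" for n x
      proof -
        let ?x = "x + t *\<^sub>R axis j 1" and ?\<tau> = "\<tau> n x j t"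
        have "e n \<le> t\<^sup>2" using n6 n by (simp add: less_imp_le)
        also have "\<dots> \<le> t * 1" unfolding power2_eq_square using t by (intro mult_left_mono) (auto simp: T_def)
        finally have en: "e n \<le> t" "e n \<le> t\<^sup>2" using \<open>e n \<le> t\<^sup>2\<close> by auto
        have \<tau>1: "\<bar>?\<tau> - t\<bar> \<le> e n"
        proof -
          have "x $ j - e n \<le> fl n x $ j" "fl n x $ j \<le> x $ j" "?x $ j - e n \<le> fl n ?x $ j" "fl n ?x $ j \<le> ?x $ j"
            by (simp_all only: grid_floor_nth_le grid_floor_nth_ge zero_less_power zero_less_divide_1_iff zero_less_numeral)
          moreover have "?x $ j = x $ j + t" by (simp add: axis_def)
          ultimately show ?thesis unfolding \<tau>_def abs_le_iff by linarith
        qed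
        have \<tau>0: "0 \<le> ?\<tau>" by (rule \<tau>_props[OF j less_imp_le[OF t(1)], of n x]) simp
        have \<tau>2: "?\<tau>\<^sup>2 \<le> (2 * t)\<^sup>2" using \<tau>1 \<tau>0 en(1) by (intro power_mono) auto
        have qb: "norm (q n (fl n x)) \<le> M"
          using M1(2)[OF _ fl_in[OF subsetD[OF sub x]], of n] n M(2) by (force simp: n3_def)
        have "v ?x - v x - t *\<^sub>R q n (fl n x) = (u n (fl n ?x) - u n (fl n x) - ?\<tau> *\<^sub>R q n (fl n x))
            + (?\<tau> - t) *\<^sub>R q n (fl n x) + (u n (fl n x) - v x) - (u n (fl n ?x) - v ?x)"
          by (simp add: algebra_simps)
        also have "norm \<dots> \<le> M * ?\<tau>\<^sup>2 + e n * M + t\<^sup>2 + t\<^sup>2"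
        proof -
          have tri: "norm (a + b + c - d) \<le> B1 + B2 + B3 + B4"
            if "norm a \<le> B1" "norm b \<le> B2" "norm c \<le> B3" "norm d \<le> B4" for a b c d :: 'v and B1 B2 B3 B4
            by (intro norm_triangle_le_diff norm_triangle_le add_mono that)
          show ?thesis
          proof (rule tri)
            show "norm (u n (fl n ?x) - u n (fl n x) - ?\<tau> *\<^sub>R q n (fl n x)) \<le> M * ?\<tau>\<^sup>2"
              using n x t by (intro taylor) auto
            show "norm ((?\<tau> - t) *\<^sub>R q n (fl n x)) \<le> e n * M"
              using \<tau>1 qb by (auto intro: mult_mono)
            show "norm (u n (fl n x) - v x) \<le> t\<^sup>2" using n5 n subsetD[OF sub x] by auto
            show "norm (u n (fl n ?x) - v ?x) \<le> t\<^sup>2" using n5 n move[OF x] t by auto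
          qed
        qed
        also have "\<dots> \<le> M * (2 * t)\<^sup>2 + t\<^sup>2 * M + t\<^sup>2 + t\<^sup>2"
          using \<tau>2 en(2) M(1) by (intro add_mono mult_left_mono mult_right_mono) auto
        also have "\<dots> = Kc * t\<^sup>2" by (simp add: Kc_def algebra_simps power2_eq_square)
        finally show ?thesis .
      qed
      then show ?thesis by blast
    qed
    have cauchy: "\<exists>n4. \<forall>n\<ge>n4. \<forall>m\<ge>n4. \<forall>x\<in>?S'. norm (q n (fl n x) - q m (fl m x)) \<le> c" if c: "c > 0" for c
    proof -
      define t where "t = min T (c / (2 * Kc))"
      have t: "0 < t" "t \<le> T" "2 * Kc * t \<le> c"
        using T c Kc(1) by (auto simp: t_def min_def field_simps)
      obtain n4 where n4: "\<forall>n\<ge>n4. \<forall>x\<in>?S'. norm (v (x + t *\<^sub>R axis j 1) - v x - t *\<^sub>R q n (fl n x)) \<le> Kc * t\<^sup>2"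
        using approx[OF t(1,2)] by blast
      have "norm (q n (fl n x) - q m (fl m x)) \<le> c" if nm: "n \<ge> n4" "m \<ge> n4" and x: "x \<in> ?S'" for n m x
      proof -
        let ?v = "v (x + t *\<^sub>R axis j 1) - v x"
        have "t * norm (q n (fl n x) - q m (fl m x)) = norm (t *\<^sub>R (q n (fl n x) - q m (fl m x)))"
          using t(1) by simp
        also have "t *\<^sub>R (q n (fl n x) - q m (fl m x)) = (?v - t *\<^sub>R q m (fl m x)) - (?v - t *\<^sub>R q n (fl n x))"
          by (simp add: algebra_simps)
        also have "norm \<dots> \<le> Kc * t\<^sup>2 + Kc * t\<^sup>2"
          by (rule norm_triangle_le_diff, rule add_mono) (use n4 nm x in auto)
        also have "\<dots> = t * (2 * Kc * t)" by (simp add: power2_eq_square)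
        also have "\<dots> \<le> t * c" using t(1,3) by (intro mult_left_mono) auto
        finally show ?thesis using t(1) by simp
      qed
      then show ?thesis by blast
    qed
    have lim: "(\<lambda>n. q n (fl n x)) \<longlonglongrightarrow> w x" if x: "x \<in> ?S'" for x
    proof -
      obtain n7 where n7: "\<And>n. n \<ge> n7 \<Longrightarrow> q n (fl n x) \<in> S"
        using inS[OF \<rho>'] fl_in[OF x] unfolding q_def by blast
      have "Cauchy (\<lambda>n. q (n + n7) (fl (n + n7) x))"
      proof (rule CauchyI)
        fix c :: real assume "c > 0"
        then obtain n4 where n4: "\<forall>n\<ge>n4. \<forall>m\<ge>n4. \<forall>x\<in>?S'. norm (q n (fl n x) - q m (fl m x)) \<le> c / 2"
          using cauchy[of "c / 2"] by auto
        have "norm (q (n + n7) (fl (n + n7) x) - q (m + n7) (fl (m + n7) x)) < c" if "n \<ge> n4" "m \<ge> n4" for n m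
        proof -
          have "norm (q (n + n7) (fl (n + n7) x) - q (m + n7) (fl (m + n7) x)) \<le> c / 2"
            using n4 that x by auto
          then show ?thesis using \<open>c > 0\<close> by simp
        qed
        then show "\<exists>M. \<forall>m\<ge>M. \<forall>n\<ge>M. norm (q (m + n7) (fl (m + n7) x) - q (n + n7) (fl (n + n7) x)) < c" by blast
      qed
      then obtain l where "(\<lambda>n. q (n + n7) (fl (n + n7) x)) \<longlonglongrightarrow> l"
        using S[unfolded complete_def, rule_format, of "\<lambda>n. q (n + n7) (fl (n + n7) x)"] n7 by auto
      then have "(\<lambda>n. q n (fl n x)) \<longlonglongrightarrow> l" by (rule LIMSEQ_offset)
      moreover from this have "w x = l" unfolding w_def q_def by (rule limI)
      ultimately show ?thesis by simp
    qed
    have unif: "\<exists>n4. \<forall>n\<ge>n4. \<forall>x\<in>?S'. norm (q n (fl n x) - w x) \<le> c" if c: "c > 0" for c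
    proof -
      obtain n4 where n4: "\<forall>n\<ge>n4. \<forall>m\<ge>n4. \<forall>x\<in>?S'. norm (q n (fl n x) - q m (fl m x)) \<le> c"
        using cauchy[OF c] by blast
      have "norm (q n (fl n x) - w x) \<le> c" if "n \<ge> n4" "x \<in> ?S'" for n x
      proof (rule LIMSEQ_le_const2)
        show "(\<lambda>m. norm (q n (fl n x) - q m (fl m x))) \<longlonglongrightarrow> norm (q n (fl n x) - w x)"
          by (intro tendsto_intros lim that)
        show "\<exists>N. \<forall>m\<ge>N. norm (q n (fl n x) - q m (fl m x)) \<le> c" using n4 that by blast
      qed
      then show ?thesis by blast
    qed
    have fw: "norm (v (x + t *\<^sub>R axis j 1) - v x - t *\<^sub>R w x) \<le> Kc * t\<^sup>2"
      if x: "x \<in> ?S'" and t: "0 \<le> t" "t \<le> T" for x t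
    proof (cases "t = 0")
      case False
      then have t0: "0 < t" using t by simp
      show ?thesis
      proof (rule LIMSEQ_le_const2)
        show "(\<lambda>n. norm (v (x + t *\<^sub>R axis j 1) - v x - t *\<^sub>R q n (fl n x))) \<longlonglongrightarrow> norm (v (x + t *\<^sub>R axis j 1) - v x - t *\<^sub>R w x)"
          by (intro tendsto_intros lim x)
        show "\<exists>N. \<forall>n\<ge>N. norm (v (x + t *\<^sub>R axis j 1) - v x - t *\<^sub>R q n (fl n x)) \<le> Kc * t\<^sup>2"
          using approx[OF t0 t(2)] x by blast
      qed
    qed simp
    have wlip: "norm (w (x + t *\<^sub>R axis j 1) - w x) \<le> Kc * t"
      if x: "x \<in> ?S'" and t: "0 \<le> t" "t \<le> T" and xt: "x + t *\<^sub>R axis j 1 \<in> ?S'" for x t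
    proof -
      have "norm (w (x + t *\<^sub>R axis j 1) - w x) \<le> M * t"
      proof (rule LIMSEQ_le)
        show "(\<lambda>n. norm (q n (fl n (x + t *\<^sub>R axis j 1)) - q n (fl n x))) \<longlonglongrightarrow> norm (w (x + t *\<^sub>R axis j 1) - w x)"
          by (intro tendsto_intros lim x xt)
        show "(\<lambda>n. M * \<tau> n x j t) \<longlonglongrightarrow> M * t" by (intro tendsto_intros \<tau>_lim)
        show "\<exists>N. \<forall>n\<ge>N. norm (q n (fl n (x + t *\<^sub>R axis j 1)) - q n (fl n x)) \<le> M * \<tau> n x j t"
          using qlip[OF _ x t] by blast
      qed
      also have "\<dots> \<le> Kc * t" using Kc(2) t(1) by (rule mult_right_mono)
      finally show ?thesis .
    qed
    have "((\<lambda>t. v (x + t *\<^sub>R axis j 1)) has_vector_derivative w x) (line_filter ?S' j x)" if x: "x \<in> ?S'" for x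
      by (rule has_vector_derivative_of_forward_taylor[of T Kc, OF T less_imp_le[OF Kc(1)] fw wlip x])
    then show ?thesis using unif unfolding q_def by blast
  qed
  then show "grid_converges (\<lambda>n. diff_quot (e n) j (u n)) w"
    unfolding grid_converges_def by blast
  show "((\<lambda>t. v (x + t *\<^sub>R axis j 1)) has_vector_derivative w x) (line_filter (Omega_lim J (set_coords J r \<rho>')) j x)"
    if "0 < \<rho>'" "\<rho>' < 2 * \<rho>" "x \<in> Omega_lim J (set_coords J r \<rho>')" for \<rho>' x
    using main[OF that(1,2)] that(3) by blast
qed

section \<open>Convergence of difference quotients\<close>

definition quot :: "'k \<Rightarrow> 'd list \<Rightarrow> nat \<Rightarrow> real ^ 'd \<Rightarrow> 'v" where
  "quot k js n = iter_diff_quot (e n) js (\<lambda>y. a (e n) y $ k)"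

definition quot_lim :: "'k \<Rightarrow> 'd list \<Rightarrow> real ^ 'd \<Rightarrow> 'v" where
  "quot_lim k js x = lim (\<lambda>n. quot k js n (fl n x))"

lemma R2_region: "Omega_lim J (set_coords J r \<rho>') \<subseteq> \<Omega>0" if "\<rho>' < 2 * \<rho>"
  using that unfolding R2_def by (intro Omega_lim_mono) (simp add: set_coords_def)

text \<open>Turns the fixed margin \<open>2 * \<rho> - \<rho>'\<close> into room for
  \<open>l\<close> forward steps at small scales.\<close>

lemma eventually_shift_in_\<Omega>:
  assumes "0 < \<rho>'" "\<rho>' < 2 * \<rho>"
  shows "\<exists>n1\<ge>N0. \<forall>n\<ge>n1. \<forall>js y. set js \<subseteq> J \<longrightarrow> length js \<le> l \<longrightarrow>
    y \<in> Omega_disc J (e n) (set_coords J r \<rho>') \<longrightarrow> y \<in> \<Omega> (e n) \<and> shift (e n) js y \<in> \<Omega> (e n)"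
proof -
  define d where "d = (2 * \<rho> - \<rho>') / (l + 1)"
  have "0 < d" using assms by (simp add: d_def)
  then obtain n2 where n2: "\<And>n. n \<ge> n2 \<Longrightarrow> e n < d"
    using eventually_scales[OF eps0_pos] by blast
  have "y \<in> \<Omega> (e n) \<and> shift (e n) js y \<in> \<Omega> (e n)"
    if n: "n \<ge> max N0 n2" and js: "set js \<subseteq> J" "length js \<le> l" and y: "y \<in> Omega_disc J (e n) (set_coords J r \<rho>')"
    for n js y
  proof -
    have "length js * e n \<le> (l + 1) * e n" using js(2) by (intro mult_right_mono) auto
    also have "\<dots> \<le> (l + 1) * d" using n2[of n] n by (intro mult_left_mono) auto
    also have "\<dots> = 2 * \<rho> - \<rho>'" by (simp add: d_def)
    finally have "shift (e n) js y \<in> \<Omega> (e n)"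
      unfolding R2_def by (intro shift_in_larger_disc[OF _ js(1) y]) auto
    moreover have "shift (e n) [] y \<in> \<Omega> (e n)"
      unfolding R2_def using assms by (intro shift_in_larger_disc[OF _ _ y]) auto
    ultimately show ?thesis by (simp add: shift_Nil)
  qed
  then show ?thesis by (intro exI[of _ "max N0 n2"]) auto
qed

context
  fixes K :: nat and M :: real and n0 :: nat
  assumes n0: "N0 \<le> n0" and M: "0 \<le> M"
    and bounded: "\<And>n js x. n \<ge> n0 \<Longrightarrow> set js \<subseteq> J \<Longrightarrow> length js \<le> K + 1 \<Longrightarrow> x \<in> \<Omega> (e n) \<Longrightarrow>
      shift (e n) js x \<in> \<Omega> (e n) \<Longrightarrow> norm (iter_diff_quot (e n) js (a (e n)) x) \<le> M"
begin

lemma quot_steps_bounded: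
  assumes js: "set js \<subseteq> J" "length js \<le> K"
  shows "steps_bounded (quot k js)"
  unfolding steps_bounded_def
proof (intro allI impI)
  fix \<rho>' assume \<rho>': "0 < \<rho>'" "\<rho>' < 2 * \<rho>"
  obtain n1 where n1: "n1 \<ge> N0" "\<And>n js y. n \<ge> n1 \<Longrightarrow> set js \<subseteq> J \<Longrightarrow> length js \<le> K + 1 \<Longrightarrow>
      y \<in> Omega_disc J (e n) (set_coords J r \<rho>') \<Longrightarrow> y \<in> \<Omega> (e n) \<and> shift (e n) js y \<in> \<Omega> (e n)"
    using eventually_shift_in_\<Omega>[OF \<rho>', of "K + 1"] by blast
  have "norm (diff_quot (e n) i (quot k js n) y) \<le> M"
    if n: "n \<ge> max n0 n1" and i: "i \<in> J" and y: "y \<in> Omega_disc J (e n) (set_coords J r \<rho>')" for n i y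
  proof -
    have "diff_quot (e n) i (quot k js n) y = iter_diff_quot (e n) (i # js) (a (e n)) y $ k"
      unfolding quot_def iter_diff_quot_nth by (simp add: diff_quot_def)
    also have "norm \<dots> \<le> norm (iter_diff_quot (e n) (i # js) (a (e n)) y)"
      by (rule Finite_Cartesian_Product.norm_nth_le)
    also have "\<dots> \<le> M"
      using n1(2)[of n "i # js" y] n i y js by (intro bounded) auto
    finally show ?thesis .
  qed
  then show "\<exists>M\<ge>0. \<exists>n1. \<forall>n\<ge>n1. \<forall>i\<in>J. \<forall>y\<in>Omega_disc J (e n) (set_coords J r \<rho>'). norm (diff_quot (e n) i (quot k js n) y) \<le> M"
    using M by blast
qed

lemma quot_in_X:
  assumes js: "set js \<subseteq> J" "length js \<le> K" and \<rho>': "0 < \<rho>'" "\<rho>' < 2 * \<rho>"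
  shows "\<exists>n1. \<forall>n\<ge>n1. \<forall>y\<in>Omega_disc J (e n) (set_coords J r \<rho>'). quot k js n y \<in> X k"
proof -
  obtain n1 where n1: "n1 \<ge> N0" "\<And>n js y. n \<ge> n1 \<Longrightarrow> set js \<subseteq> J \<Longrightarrow> length js \<le> K \<Longrightarrow>
      y \<in> Omega_disc J (e n) (set_coords J r \<rho>') \<Longrightarrow> y \<in> \<Omega> (e n) \<and> shift (e n) js y \<in> \<Omega> (e n)"
    using eventually_shift_in_\<Omega>[OF \<rho>', of K] by blast
  have "quot k js n y \<in> X k" if n: "n \<ge> n1" and y: "y \<in> Omega_disc J (e n) (set_coords J r \<rho>')" for n y
    unfolding quot_def
  proof (rule iter_diff_quot_in_subspace[OF X_subspace])
    fix z assume "z \<in> diff_box (e n) js y"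
    then have "z \<in> \<Omega> (e n)"
      using diff_box_subset_disc[of "e n" js J y R2] n1(2)[OF n js y] js(1) by auto
    then show "a (e n) z $ k \<in> X k"
      using a_P[OF e_scale] n n1(1) by (force simp: state_space_def)
  qed
  then show ?thesis by blast
qed

lemma quot_lim_Nil: "x \<in> \<Omega>0 \<Longrightarrow> quot_lim k [] x = a0 x $ k"
  unfolding quot_lim_def quot_def by (intro limI) (simp, intro tendsto_intros a0_lim)

text \<open>Each further quotient converges because its own steps are bounded, which uses one order
  beyond it; bounds up to order \<open>K + 1\<close> therefore reach order \<open>K\<close>.\<close>

lemma quot_converges:
  assumes "set js \<subseteq> J" "length js \<le> K"
  shows "grid_converges (quot k js) (quot_lim k js)"
  using assms
proof (induction js)
  case Nil
  obtain C where C: "0 \<le> C" "\<And>n x. n \<ge> N0 \<Longrightarrow> x \<in> \<Omega>0 \<Longrightarrow> norm (a (e n) (fl n x) - a0 x) \<le> C * e n"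
    using a0_limit by blast
  show ?case
    unfolding grid_converges_def
  proof (intro allI impI)
    fix \<rho>' c assume \<rho>': "0 < \<rho>'" "\<rho>' < 2 * \<rho>" and c: "0 < (c :: real)"
    obtain n1 where n1: "\<And>n. n \<ge> n1 \<Longrightarrow> e n < c / (C + 1)"
      using eventually_scales[OF eps0_pos, of "c / (C + 1)"] c C(1) by auto
    have "norm (quot k [] n (fl n x) - quot_lim k [] x) \<le> c"
      if n: "n \<ge> max N0 n1" and x: "x \<in> Omega_lim J (set_coords J r \<rho>')" for n x
    proof -
      have x0: "x \<in> \<Omega>0" using R2_region[OF \<rho>'(2)] x by blast
      have "norm (quot k [] n (fl n x) - quot_lim k [] x) = norm ((a (e n) (fl n x) - a0 x) $ k)"
        by (simp add: quot_lim_Nil[OF x0] quot_def)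
      also have "\<dots> \<le> norm (a (e n) (fl n x) - a0 x)" by (rule Finite_Cartesian_Product.norm_nth_le)
      also have "\<dots> \<le> C * e n" using C(2)[OF _ x0] n by simp
      also have "\<dots> \<le> (C + 1) * e n" by (intro mult_right_mono) auto
      also have "\<dots> \<le> c"
        using n1[of n] n C(1) by (simp add: pos_less_divide_eq mult.commute)
      finally show ?thesis .
    qed
    then show "\<exists>n1. \<forall>n\<ge>n1. \<forall>x\<in>Omega_lim J (set_coords J r \<rho>'). norm (quot k [] n (fl n x) - quot_lim k [] x) \<le> c"
      by blast
  qed
next
  case (Cons j js)
  have eq: "(\<lambda>n. diff_quot (e n) j (quot k js n)) = quot k (j # js)"
    by (simp add: quot_def fun_eq_iff)
  have "grid_converges (\<lambda>n. diff_quot (e n) j (quot k js n)) (\<lambda>x. lim (\<lambda>n. diff_quot (e n) j (quot k js n) (fl n x)))"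
  proof (rule grid_derivative_converges(1)[OF _ _ _ _ X_complete[of k]])
    show "grid_converges (quot k js) (quot_lim k js)" using Cons by simp
    show "steps_bounded (quot k js)" using Cons.prems by (intro quot_steps_bounded) auto
    show "steps_bounded (\<lambda>n. diff_quot (e n) j (quot k js n))"
      unfolding eq using Cons.prems by (intro quot_steps_bounded) auto
    show "\<exists>n1. \<forall>n\<ge>n1. \<forall>y\<in>Omega_disc J (e n) (set_coords J r \<rho>'). diff_quot (e n) j (quot k js n) y \<in> X k"
      if "0 < \<rho>'" "\<rho>' < 2 * \<rho>" for \<rho>'
      using quot_in_X[OF Cons.prems that, of k] by (simp add: quot_def)
  qed (use Cons.prems in simp)
  then show ?case by (simp add: quot_def quot_lim_def[abs_def])
qed

lemma quot_lim_derivative: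
  assumes js: "set (j # js) \<subseteq> J" "length (j # js) \<le> K" and \<rho>': "0 < \<rho>'" "\<rho>' < 2 * \<rho>"
    and x: "x \<in> Omega_lim J (set_coords J r \<rho>')"
  shows "((\<lambda>t. quot_lim k js (x + t *\<^sub>R axis j 1)) has_vector_derivative quot_lim k (j # js) x)
    (line_filter (Omega_lim J (set_coords J r \<rho>')) j x)"
proof -
  have eq: "(\<lambda>n. diff_quot (e n) j (quot k js n)) = quot k (j # js)"
    by (simp add: quot_def fun_eq_iff)
  have "((\<lambda>t. quot_lim k js (x + t *\<^sub>R axis j 1)) has_vector_derivative
      lim (\<lambda>n. diff_quot (e n) j (quot k js n) (fl n x))) (line_filter (Omega_lim J (set_coords J r \<rho>')) j x)"
  proof (rule grid_derivative_converges(2)[OF _ _ _ _ X_complete[of k] _ \<rho>' x])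
    show "grid_converges (quot k js) (quot_lim k js)" using js by (intro quot_converges) auto
    show "steps_bounded (quot k js)" using js by (intro quot_steps_bounded) auto
    show "steps_bounded (\<lambda>n. diff_quot (e n) j (quot k js n))"
      unfolding eq using js by (intro quot_steps_bounded) auto
    show "\<exists>n1. \<forall>n\<ge>n1. \<forall>y\<in>Omega_disc J (e n) (set_coords J r \<rho>'). diff_quot (e n) j (quot k js n) y \<in> X k"
      if "0 < \<rho>'" "\<rho>' < 2 * \<rho>" for \<rho>'
      using quot_in_X[OF js that, of k] by (simp add: quot_def)
  qed (use js in simp)
  then show ?thesis by (simp add: quot_def quot_lim_def)
qed

lemma rb_derivative:
  assumes js: "set (j # js) \<subseteq> J" "length (j # js) \<le> K" and x: "x \<in> Omega_lim J rb"
    and eq: "\<And>x. x \<in> Omega_lim J rb \<Longrightarrow> w x = quot_lim k js x"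
  shows "((\<lambda>t. w (x + t *\<^sub>R axis j 1)) has_vector_derivative quot_lim k (j # js) x)
    (line_filter (Omega_lim J rb) j x)"
proof -
  have "((\<lambda>t. quot_lim k js (x + t *\<^sub>R axis j 1)) has_vector_derivative quot_lim k (j # js) x)
    (line_filter (Omega_lim J rb) j x)"
    unfolding rb_def by (rule quot_lim_derivative[OF js]) (use \<rho>_pos x in \<open>auto simp: rb_def\<close>)
  then show ?thesis
    unfolding line_filter_def
    by (rule has_vector_derivative_transform[rotated 2]) (use x eq in auto)
qed

text \<open>The iterated limits of quotients are derivatives of each other along the box; uniqueness
  of these derivatives identifies them with the iterated partial derivatives of
  \<open>a0\<close>.\<close>

lemma iter_partial_eq:
  assumes "set js \<subseteq> J" "length js \<le> K" "x \<in> Omega_lim J rb"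
  shows "iter_partial_on (Omega_lim J rb) js (\<lambda>y. a0 y $ k) x = quot_lim k js x"
  using assms
proof (induction js arbitrary: x)
  case Nil
  then show ?case using rb_sub by (auto simp: quot_lim_Nil)
next
  case (Cons j js)
  have "partial_on (Omega_lim J rb) j (iter_partial_on (Omega_lim J rb) js (\<lambda>y. a0 y $ k)) x = quot_lim k (j # js) x"
  proof (rule partial_on_eq)
    show "j \<in> J" "x \<in> Omega_lim J rb" using Cons.prems by auto
    then show "0 < rb $ j" using \<rho>_pos by (simp add: rb_def set_coords_def)
    show "((\<lambda>t. iter_partial_on (Omega_lim J rb) js (\<lambda>y. a0 y $ k) (x + t *\<^sub>R axis j 1)) has_vector_derivative
        quot_lim k (j # js) x) (line_filter (Omega_lim J rb) j x)"
      using Cons.prems by (intro rb_derivative Cons.IH) auto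
  qed
  then show ?case by simp
qed

lemma a0_CK: "CK_on K J (Omega_lim J rb) (\<lambda>x. a0 x $ k)"
  unfolding CK_on_def
proof (intro conjI allI ballI impI)
  fix js assume js: "set js \<subseteq> J \<and> length js \<le> K"
  have "continuous_on (Omega_lim J rb) (quot_lim k js)"
    unfolding rb_def
    by (rule grid_limit_continuous[OF quot_converges quot_steps_bounded]) (use js \<rho>_pos in auto)
  then show "continuous_on (Omega_lim J rb) (iter_partial_on (Omega_lim J rb) js (\<lambda>x. a0 x $ k))"
    by (rule continuous_on_eq) (use iter_partial_eq js in auto)
next
  fix js i x assume i: "i \<in> J" and js: "set js \<subseteq> J \<and> length js < K" and x: "x \<in> Omega_lim J rb"
  have "((\<lambda>t. iter_partial_on (Omega_lim J rb) js (\<lambda>x. a0 x $ k) (x + t *\<^sub>R axis i 1)) has_vector_derivative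
      quot_lim k (i # js) x) (line_filter (Omega_lim J rb) i x)"
    using i js x by (intro rb_derivative iter_partial_eq) auto
  then show "(\<lambda>t. iter_partial_on (Omega_lim J rb) js (\<lambda>x. a0 x $ k) (x + t *\<^sub>R axis i 1)) differentiable
      line_filter (Omega_lim J rb) i x"
    by (rule differentiableI_vector)
qed

text \<open>Grid points are fixed by rounding, so uniform convergence at rounded points is
  convergence on the grid.\<close>

lemma quotients_converge:
  assumes js: "set js \<subseteq> J" "length js \<le> K" and c: "0 < c"
  shows "\<exists>\<eta>>0. \<forall>\<epsilon>\<in>scales \<epsilon>0. \<epsilon> < \<eta> \<longrightarrow> (\<forall>x\<in>Omega_disc J \<epsilon> (shrink J (real K * \<epsilon>) rb).
    norm (iter_diff_quot \<epsilon> js (\<lambda>y. a \<epsilon> y $ k) x - iter_partial_on (Omega_lim J rb) js (\<lambda>y. a0 y $ k) x) \<le> c)"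
proof -
  obtain n1 where n1: "\<And>n x. n \<ge> n1 \<Longrightarrow> x \<in> Omega_lim J rb \<Longrightarrow> norm (quot k js n (fl n x) - quot_lim k js x) \<le> c"
    using grid_convergesE[OF quot_converges[OF js] \<rho>_pos _ c, of k] \<rho>_pos unfolding rb_def
    by (metis less_add_same_cancel1 mult_2)
  have "norm (iter_diff_quot \<epsilon> js (\<lambda>y. a \<epsilon> y $ k) x - iter_partial_on (Omega_lim J rb) js (\<lambda>y. a0 y $ k) x) \<le> c"
    if \<epsilon>: "\<epsilon> \<in> scales \<epsilon>0" "\<epsilon> < e n1" and x: "x \<in> Omega_disc J \<epsilon> (shrink J (real K * \<epsilon>) rb)" for \<epsilon> x
  proof -
    obtain n where n: "n \<ge> n1" "\<epsilon> = e n" using scales_index[OF \<epsilon>] by blast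
    have "Omega_disc J \<epsilon> (shrink J (real K * \<epsilon>) rb) \<subseteq> Omega_disc J \<epsilon> rb"
      using scales_pos[OF \<epsilon>(1)] by (intro Omega_disc_mono) (simp add: shrink_def)
    then have x': "x \<in> Omega_disc J (e n) rb" using x n(2) by blast
    then have x0: "x \<in> Omega_lim J rb" using Omega_disc_subset_lim by blast
    have "fl n x = x" by (rule grid_floor_id[OF _ x']) simp
    then show ?thesis
      using n1[OF n(1) x0] iter_partial_eq[OF js x0, of k] by (simp add: quot_def n(2))
  qed
  then show ?thesis by (intro exI[of _ "e n1"]) auto
qed

end

end

theorem theorem5:
  fixes X :: "'k::finite \<Rightarrow> 'v::real_normed_vector set"
    and E :: "'k \<Rightarrow> 'd::finite set"
    and J :: "'d set"
    and r :: "real ^ 'd"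
    and \<epsilon>0 :: real
    and f :: "real \<Rightarrow> 'k \<Rightarrow> 'd \<Rightarrow> 'v ^ 'k \<Rightarrow> 'v"
    and g :: "real \<Rightarrow> 'k \<Rightarrow> real ^ 'd \<Rightarrow> 'v"
    and g0 :: "'k \<Rightarrow> real ^ 'd \<Rightarrow> 'v"
    and a :: "real \<Rightarrow> real ^ 'd \<Rightarrow> 'v ^ 'k"
  assumes X_subspace: "\<And>k. subspace (X k)"
    and X_complete: "\<And>k. complete (X k)"
    and E_nonempty: "\<And>k. E k \<noteq> {}"
    and J_nonempty: "J \<noteq> {}"
    and r_pos: "\<And>i. 0 < r $ i"
    and r_int: "\<And>i. i \<notin> J \<Longrightarrow> r $ i \<in> \<int>"
    and eps0_pos: "0 < \<epsilon>0"
    and f_range: "\<And>\<epsilon> k i. \<epsilon> \<in> {0..\<epsilon>0} \<Longrightarrow> i \<in> E k \<Longrightarrow> f \<epsilon> k i ` state_space X \<subseteq> X k"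
    and f_cont_eps: "\<And>k i b. i \<in> E k \<Longrightarrow> b \<in> state_space X \<Longrightarrow>
          continuous_on {0..\<epsilon>0} (\<lambda>\<epsilon>. f \<epsilon> k i b)"
    and f0_loc_lipschitz: "\<And>k i. i \<in> E k \<Longrightarrow>
          local_lipschitz {0} (state_space X) (\<lambda>\<epsilon>. f \<epsilon> k i)"
    and compat: "\<And>\<epsilon>. \<epsilon> \<in> scales \<epsilon>0 \<Longrightarrow> compatible X E (mesh J \<epsilon>) (f \<epsilon>)"
    and sol: "\<And>\<epsilon>. \<epsilon> \<in> scales \<epsilon>0 \<Longrightarrow> discrete_goursat_solution X E J \<epsilon> r (f \<epsilon>) (g \<epsilon>) (a \<epsilon>)"
    and f_conv: "\<And>k i Q. i \<in> E k \<Longrightarrow> compact Q \<Longrightarrow> Q \<subseteq> state_space X \<Longrightarrow>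
          \<exists>C. \<forall>\<epsilon>\<in>scales \<epsilon>0. \<forall>b\<in>Q. norm (f \<epsilon> k i b - f 0 k i b) \<le> C * \<epsilon>"
    and g0_range: "\<And>k. g0 k ` goursat_set (Omega_lim J r) (E k) \<subseteq> X k"
    and g0_lipschitz: "\<And>k. \<exists>L. L-lipschitz_on (goursat_set (Omega_lim J r) (E k)) (g0 k)"
    and g_conv: "\<And>k. \<exists>C. \<forall>\<epsilon>\<in>scales \<epsilon>0. \<forall>x\<in>goursat_set (Omega_disc J \<epsilon> r) (E k).
          norm (g \<epsilon> k x - g0 k x) \<le> C * \<epsilon>"
  shows "\<exists>rb a0.
     (\<forall>i\<in>J. 0 < rb $ i \<and> rb $ i \<le> r $ i) \<and> (\<forall>i. i \<notin> J \<longrightarrow> rb $ i = r $ i) \<and>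
     (\<exists>L. L-lipschitz_on (Omega_lim J rb) a0) \<and>
     (\<exists>C. \<forall>\<epsilon>\<in>scales \<epsilon>0. \<forall>x\<in>Omega_disc J \<epsilon> rb. norm (a \<epsilon> x - a0 x) \<le> C * \<epsilon>) \<and>
     limit_goursat_solution X E J rb (f 0) g0 a0 \<and>
     (\<forall>b. limit_goursat_solution X E J rb (f 0) g0 b \<longrightarrow> (\<forall>x\<in>Omega_lim J rb. b x = a0 x)) \<and>
     (\<forall>K::nat.
        (\<forall>k. \<forall>i\<in>E k. Cm_loc_convergent (scales \<epsilon>0) (state_space X) (K + 1) (\<lambda>\<epsilon>. f \<epsilon> k i)) \<and>
        (\<exists>M. \<forall>k. \<forall>\<epsilon>\<in>scales \<epsilon>0. \<forall>js. set js \<subseteq> J - E k \<and> length js \<le> K + 1 \<longrightarrow>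
           (\<forall>x\<in>goursat_set (Omega_disc J \<epsilon> r) (E k).
              shift \<epsilon> js x \<in> goursat_set (Omega_disc J \<epsilon> r) (E k) \<longrightarrow>
              norm (iter_diff_quot \<epsilon> js (g \<epsilon> k) x) \<le> M)) \<and>
        (\<forall>k. CK_on K (J - E k) (goursat_set (Omega_lim J r) (E k)) (g0 k))
        \<longrightarrow>
        (\<forall>k. CK_on K J (Omega_lim J rb) (\<lambda>x. a0 x $ k)) \<and>
        (\<forall>k js. set js \<subseteq> J \<and> length js \<le> K \<longrightarrow>
           (\<forall>e>0. \<exists>\<eta>>0. \<forall>\<epsilon>\<in>scales \<epsilon>0. \<epsilon> < \<eta> \<longrightarrow>
              (\<forall>x\<in>Omega_disc J \<epsilon> (shrink J (real K * \<epsilon>) rb).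
                 norm (iter_diff_quot \<epsilon> js (\<lambda>y. a \<epsilon> y $ k) x
                       - iter_partial_on (Omega_lim J rb) js (\<lambda>y. a0 y $ k) x) \<le> e))))"
proof -
  interpret goursat_family X E J r \<epsilon>0 f g g0 a
  proof
    show "f 0 k i ` state_space X \<subseteq> X k" if "i \<in> E k" for k i
      using f_range[of 0 i k] that eps0_pos by simp
  qed (fact X_subspace X_complete r_pos eps0_pos f0_loc_lipschitz sol f_conv g0_range g0_lipschitz g_conv)+
  obtain \<rho> A \<delta> L \<Lambda> \<eta> where region: "0 < \<rho>" "\<forall>i\<in>J. 2 * \<rho> \<le> r $ i" "0 < \<delta>" "0 \<le> L" "0 \<le> \<Lambda>" "0 < \<eta>"
    "\<forall>z\<in>base. near_const (A z) \<delta> L"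
    "\<forall>\<epsilon>\<in>scales \<epsilon>0. \<epsilon> < \<eta> \<longrightarrow> (\<forall>x\<in>Omega_disc J \<epsilon> (set_coords J r (2 * \<rho>)).
       dist (a \<epsilon> x) (A (set_coords J x 0)) \<le> \<delta> \<and>
       (\<forall>i\<in>J. x + \<epsilon> *\<^sub>R axis i 1 \<in> Omega_disc J \<epsilon> (set_coords J r (2 * \<rho>)) \<longrightarrow>
         norm (a \<epsilon> (x + \<epsilon> *\<^sub>R axis i 1) - a \<epsilon> x) \<le> \<Lambda> * \<epsilon>))"
    using region_exists by (elim exE conjE)
  interpret goursat_region X E J r \<epsilon>0 f g g0 a \<rho> A \<delta> L \<Lambda> \<eta>
    by unfold_locales (use region in auto)
  have rb: "\<forall>i\<in>J. 0 < rb $ i \<and> rb $ i \<le> r $ i" "\<forall>i. i \<notin> J \<longrightarrow> rb $ i = r $ i"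
    using region(1,2) by (auto simp: rb_def set_coords_def)
  have lip: "\<exists>L. L-lipschitz_on (Omega_lim J rb) a0"
    using a0_lipschitz lipschitz_on_subset[OF _ rb_sub] by blast
  have conv: "\<exists>C. \<forall>\<epsilon>\<in>scales \<epsilon>0. \<forall>x\<in>Omega_disc J \<epsilon> rb. norm (a \<epsilon> x - a0 x) \<le> C * \<epsilon>"
    using region(1) by (intro a_conv) (simp add: rb_def R2_def set_coords_def)
  \<comment> \<open>\<open>rb\<close> and \<open>a0\<close> are fixed before \<open>K\<close>; only
    the bound \<open>M\<close> and the index \<open>n1\<close> depend on it.\<close>
  have smooth: "(\<forall>k. CK_on K J (Omega_lim J rb) (\<lambda>x. a0 x $ k)) \<and>
      (\<forall>k js. set js \<subseteq> J \<and> length js \<le> K \<longrightarrow>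
         (\<forall>e>0. \<exists>\<eta>>0. \<forall>\<epsilon>\<in>scales \<epsilon>0. \<epsilon> < \<eta> \<longrightarrow>
            (\<forall>x\<in>Omega_disc J \<epsilon> (shrink J (real K * \<epsilon>) rb).
               norm (iter_diff_quot \<epsilon> js (\<lambda>y. a \<epsilon> y $ k) x
                     - iter_partial_on (Omega_lim J rb) js (\<lambda>y. a0 y $ k) x) \<le> e)))"
    if H: "(\<forall>k. \<forall>i\<in>E k. Cm_loc_convergent (scales \<epsilon>0) (state_space X) (K + 1) (\<lambda>\<epsilon>. f \<epsilon> k i)) \<and>
        (\<exists>M. \<forall>k. \<forall>\<epsilon>\<in>scales \<epsilon>0. \<forall>js. set js \<subseteq> J - E k \<and> length js \<le> K + 1 \<longrightarrow>
           (\<forall>x\<in>goursat_set (Omega_disc J \<epsilon> r) (E k).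
              shift \<epsilon> js x \<in> goursat_set (Omega_disc J \<epsilon> r) (E k) \<longrightarrow>
              norm (iter_diff_quot \<epsilon> js (g \<epsilon> k) x) \<le> M)) \<and>
        (\<forall>k. CK_on K (J - E k) (goursat_set (Omega_lim J r) (E k)) (g0 k))" for K
  proof -
    obtain Mg where Mg: "\<forall>k. \<forall>\<epsilon>\<in>scales \<epsilon>0. \<forall>js. set js \<subseteq> J - E k \<and> length js \<le> K + 1 \<longrightarrow>
           (\<forall>x\<in>goursat_set (Omega_disc J \<epsilon> r) (E k).
              shift \<epsilon> js x \<in> goursat_set (Omega_disc J \<epsilon> r) (E k) \<longrightarrow>
              norm (iter_diff_quot \<epsilon> js (g \<epsilon> k) x) \<le> Mg)"
      using H by (elim exE conjE)
    have "\<exists>M\<ge>0. \<exists>n1\<ge>N0. \<forall>n\<ge>n1. \<forall>js x. set js \<subseteq> J \<longrightarrow> length js \<le> K + 1 \<longrightarrow> x \<in> \<Omega> (e n) \<longrightarrow>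
      shift (e n) js x \<in> \<Omega> (e n) \<longrightarrow> norm (iter_diff_quot (e n) js (a (e n)) x) \<le> M"
    proof (rule quotients_bounded[OF _ _ order_refl])
      show "Cm_loc_convergent (scales \<epsilon>0) (state_space X) (K + 1) (\<lambda>\<epsilon>. f \<epsilon> k i)" if "i \<in> E k" for k i
        using H that by simp
      show "norm (iter_diff_quot \<epsilon> js (g \<epsilon> k) x) \<le> Mg"
        if "\<epsilon> \<in> scales \<epsilon>0" "set js \<subseteq> J - E k" "length js \<le> K + 1"
          "x \<in> goursat_set (Omega_disc J \<epsilon> r) (E k)" "shift \<epsilon> js x \<in> goursat_set (Omega_disc J \<epsilon> r) (E k)" for k \<epsilon> js x
        using Mg that by simp
    qed
    then obtain M n1 where "0 \<le> M" "N0 \<le> n1" and bd: "\<forall>n\<ge>n1. \<forall>js x. set js \<subseteq> J \<longrightarrow> length js \<le> K + 1 \<longrightarrow> x \<in> \<Omega> (e n) \<longrightarrow>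
      shift (e n) js x \<in> \<Omega> (e n) \<longrightarrow> norm (iter_diff_quot (e n) js (a (e n)) x) \<le> M"
      by (elim exE conjE)
    have bounded: "norm (iter_diff_quot (e n) js (a (e n)) x) \<le> M"
      if "n1 \<le> n" "set js \<subseteq> J" "length js \<le> K + 1" "x \<in> \<Omega> (e n)" "shift (e n) js x \<in> \<Omega> (e n)" for n js x
      using bd that by blast
    show ?thesis
      using a0_CK[OF \<open>N0 \<le> n1\<close> \<open>0 \<le> M\<close> bounded] quotients_converge[OF \<open>N0 \<le> n1\<close> \<open>0 \<le> M\<close> bounded]
      by blast
  qed
  show ?thesis
    by (rule exI[of _ rb], rule exI[of _ a0], intro conjI rb lip conv a0_solution)
      ((intro allI impI ballI, erule limit_solution_unique, assumption), intro allI impI, rule smooth)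
qed

end
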